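(* (1) The system $\mathsf{Z}_2^{\omega}+\mathsf{QF\text{-}AC}^{0,1}$ plus $\mathsf{CBT}$ and $\mathsf{PST}$ does not imply $\mathsf{NIN}_{[0,1]}$. (2) The system $\mathsf{ACA}_0^{\omega}$ plus $\mathsf{CBT}$ and $\mathsf{PST}$ cannot prove $\mathsf{ATR}_0$.
   Context: $\mathsf{RCA}_0^{\omega}$ is Kohlenbach's base theory of higher-order Reverse Mathematics: classical logic in the language of all finite types, primitive recursive arithmetic in all finite types (combinators, recursor for type $0$, quantifier-free induction, axiom of extensionality) plus $\mathsf{QF\text{-}AC}^{1,0}$, i.e. for quantifier-free $\varphi$: $(\forall f\in\mathbb{N}^{\mathbb{N}})(\exists n\in\mathbb{N})\varphi(f,n)\to(\exists\Phi:\mathbb{N}^{\mathbb{N}}\to\mathbb{N})(\forall f)\varphi(f,\Phi(f))$. $\mathsf{ACA}_0^{\omega}$ is $\mathsf{RCA}_0^{\omega}+(\exists^2)$, where $(\exists^2)$ is: $(\exists E:\mathbb{N}^{\mathbb{N}}\to\{0,1\})(\forall f\in\mathbb{N}^{\mathbb{N}})\big(E(f)=0\leftrightarrow(\exists n\in\mathbb{N})(f(n)=0)\big)$. $\mathsf{QF\text{-}AC}^{0,1}$: for quantifier-free $\varphi$ (parameters of any type allowed), if $(\forall n\in\mathbb{N})(\exists f\in\mathbb{N}^{\mathbb{N}})\varphi(f,n)$ then there is a sequence $(f_n)_{n\in\mathbb{N}}$ in $\mathbb{N}^{\mathbb{N}}$ with $(\forall n)\varphi(f_n,n)$. For $k\geq1$,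 $(\mathsf{S}_k^2)$ is the axiom stating the existence of a functional $\mathsf{S}_k^2:\mathbb{N}^{\mathbb{N}}\to\{0,1\}$ that decides the truth or falsity of $\Sigma^1_k$-formulas in (Kleene) normal form, with function parameter $f\in\mathbb{N}^{\mathbb{N}}$ as input; e.g. for $k=1$: $(\forall f)\big[(\exists g\in\mathbb{N}^{\mathbb{N}})(\forall n\in\mathbb{N})(f(\overline{g}n)=0)\leftrightarrow\mathsf{S}(f)=0\big]$, with $\overline{g}n$ the (coded) finite initial segment of $g$. $\Pi^1_k\text{-}\mathsf{CA}_0^{\omega}$ is $\mathsf{RCA}_0^{\omega}+(\mathsf{S}^2_k)$, and $\mathsf{Z}_2^{\omega}$ is $\bigcup_k\Pi^1_k\text{-}\mathsf{CA}_0^{\omega}$. $\mathsf{ATR}_0$ is the usual system of arithmetical transfinite recursion in second-order arithmetic. Reals are fast-converging Cauchy sequences of rationals; functions on $\mathbb{R}$ are functionals on Baire space respecting $=_{\mathbb{R}}$. A set $A\subset\mathbb{R}$ is given by a representation function $F_A:\mathbb{R}\to\mathbb{R}^{+}\cup\{0\}$ with $x\in A\leftrightarrow F_A(x)>0$ (over $\mathsf{ACA}_0^\omega$ equivalently by a characteristic function). $O$ is open if $x\in O$ implies $B(x,2^{-k})\subseteq O$ for some $k\in\mathbb{N}$, where $B(x,r)$ is the open ball; closed sets are complements of open sets (no codes assumed). A set $A\subset\mathbb{R}$ is countable if there is $Y:\mathbb{R}\to\mathbb{N}$ with $(\forall x,y\in A)(Y(x)=Y(y)\to x=_{\mathbb{R}}y)$,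 and uncountable otherwise. A set is perfect if it is closed and has no isolated points. $\mathsf{NIN}_{[0,1]}$: there is no injection from $[0,1]$ to $\mathbb{N}$. $\mathsf{CBT}$ (Cantor--Bendixson theorem): a closed $C\subset\mathbb{R}$ is the disjoint union of a (possibly empty) perfect closed set $P$ and a countable set $S$. $\mathsf{PST}$ (perfect set theorem): for any uncountable closed set $C\subset\mathbb{R}$, there exists a (non-empty) perfect set $P$ which is a subset of $C$. *)

theory Defs
  imports Main
begin

section \<open>The language of all finite types\<close>

datatype ty = N | Fn ty ty (infixr "\<rightarrow>" 60)

abbreviation N1 :: ty where "N1 \<equiv> N \<rightarrow> N"
abbreviation N2 :: ty where "N2 \<equiv> N1 \<rightarrow> N"

text \<open>A variable is a pair of a name and a type, so \<open>Var i \<sigma>\<close> and \<open>Var i \<tau>\<close> are different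
  variables if \<open>\<sigma> \<noteq> \<tau>\<close>.\<close>

datatype tm =
    Var nat ty
  | Zero
  | Succ
  | CombK ty ty
  | CombS ty ty ty
  | Rec
  | App tm tm (infixl "\<cdot>" 90)

fun cod :: "ty \<Rightarrow> ty" where
  "cod (\<sigma> \<rightarrow> \<tau>) = \<tau>"
| "cod N = N"

primrec typ_of :: "tm \<Rightarrow> ty" where
  "typ_of (Var i \<tau>) = \<tau>"
| "typ_of Zero = N"
| "typ_of Succ = N \<rightarrow> N"
| "typ_of (CombK \<sigma> \<tau>) = \<sigma> \<rightarrow> \<tau> \<rightarrow> \<sigma>"
| "typ_of (CombS \<rho> \<sigma> \<tau>) = (\<rho> \<rightarrow> \<sigma> \<rightarrow> \<tau>) \<rightarrow> (\<rho> \<rightarrow> \<sigma>) \<rightarrow> \<rho> \<rightarrow> \<tau>"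
| "typ_of Rec = N \<rightarrow> N \<rightarrow> (N \<rightarrow> N \<rightarrow> N) \<rightarrow> N"
| "typ_of (s \<cdot> t) = cod (typ_of s)"

text \<open>The value of \<open>typ_of\<close> is only meaningful on well-typed terms.\<close>

primrec well_typed :: "tm \<Rightarrow> bool" where
  "well_typed (Var i \<tau>) = True"
| "well_typed Zero = True"
| "well_typed Succ = True"
| "well_typed (CombK \<sigma> \<tau>) = True"
| "well_typed (CombS \<rho> \<sigma> \<tau>) = True"
| "well_typed Rec = True"
| "well_typed (s \<cdot> t) =
     (well_typed s \<and> well_typed t \<and> typ_of s = typ_of t \<rightarrow> cod (typ_of s))"

primrec vars :: "tm \<Rightarrow> (nat \<times> ty) set" where
  "vars (Var i \<tau>) = {(i, \<tau>)}"
| "vars Zero = {}"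
| "vars Succ = {}"
| "vars (CombK \<sigma> \<tau>) = {}"
| "vars (CombS \<rho> \<sigma> \<tau>) = {}"
| "vars Rec = {}"
| "vars (s \<cdot> t) = vars s \<union> vars t"

primrec subst_tm :: "nat \<Rightarrow> ty \<Rightarrow> tm \<Rightarrow> tm \<Rightarrow> tm" where
  "subst_tm i \<sigma> u (Var j \<tau>) = (if i = j \<and> \<sigma> = \<tau> then u else Var j \<tau>)"
| "subst_tm i \<sigma> u Zero = Zero"
| "subst_tm i \<sigma> u Succ = Succ"
| "subst_tm i \<sigma> u (CombK \<sigma>' \<tau>') = CombK \<sigma>' \<tau>'"
| "subst_tm i \<sigma> u (CombS \<rho>' \<sigma>' \<tau>') = CombS \<rho>' \<sigma>' \<tau>'"
| "subst_tm i \<sigma> u Rec = Rec"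
| "subst_tm i \<sigma> u (s \<cdot> t) = subst_tm i \<sigma> u s \<cdot> subst_tm i \<sigma> u t"

text \<open>The only prime formulas are equations between terms of type \<open>N\<close>; the logic is classical,
  so the remaining connectives are defined from \<open>Bot\<close>, \<open>Imp\<close> and \<open>All\<close>.\<close>

datatype fm =
    Eq tm tm
  | Bot
  | Imp fm fm
  | All nat ty fm

abbreviation Neg :: "fm \<Rightarrow> fm" where "Neg \<phi> \<equiv> Imp \<phi> Bot"
abbreviation Or :: "fm \<Rightarrow> fm \<Rightarrow> fm" where "Or \<phi> \<psi> \<equiv> Imp (Neg \<phi>) \<psi>"
abbreviation And :: "fm \<Rightarrow> fm \<Rightarrow> fm" where "And \<phi> \<psi> \<equiv> Neg (Imp \<phi> (Neg \<psi>))"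
abbreviation Iff :: "fm \<Rightarrow> fm \<Rightarrow> fm" where "Iff \<phi> \<psi> \<equiv> And (Imp \<phi> \<psi>) (Imp \<psi> \<phi>)"
abbreviation Ex :: "nat \<Rightarrow> ty \<Rightarrow> fm \<Rightarrow> fm" where "Ex i \<tau> \<phi> \<equiv> Neg (All i \<tau> (Neg \<phi>))"

primrec wf_fm :: "fm \<Rightarrow> bool" where
  "wf_fm (Eq s t) = (well_typed s \<and> well_typed t \<and> typ_of s = N \<and> typ_of t = N)"
| "wf_fm Bot = True"
| "wf_fm (Imp \<phi> \<psi>) = (wf_fm \<phi> \<and> wf_fm \<psi>)"
| "wf_fm (All i \<tau> \<phi>) = wf_fm \<phi>"

primrec qfree :: "fm \<Rightarrow> bool" where
  "qfree (Eq s t) = True"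
| "qfree Bot = True"
| "qfree (Imp \<phi> \<psi>) = (qfree \<phi> \<and> qfree \<psi>)"
| "qfree (All i \<tau> \<phi>) = False"

primrec fv :: "fm \<Rightarrow> (nat \<times> ty) set" where
  "fv (Eq s t) = vars s \<union> vars t"
| "fv Bot = {}"
| "fv (Imp \<phi> \<psi>) = fv \<phi> \<union> fv \<psi>"
| "fv (All i \<tau> \<phi>) = fv \<phi> - {(i, \<tau>)}"

text \<open>Substitution does not rename bound variables and is only used where \<open>free_for\<close> holds
  (which is automatic for quantifier-free formulas).\<close>

primrec subst :: "nat \<Rightarrow> ty \<Rightarrow> tm \<Rightarrow> fm \<Rightarrow> fm" where
  "subst i \<sigma> u (Eq s t) = Eq (subst_tm i \<sigma> u s) (subst_tm i \<sigma> u t)"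
| "subst i \<sigma> u Bot = Bot"
| "subst i \<sigma> u (Imp \<phi> \<psi>) = Imp (subst i \<sigma> u \<phi>) (subst i \<sigma> u \<psi>)"
| "subst i \<sigma> u (All j \<tau> \<phi>) =
     (if i = j \<and> \<sigma> = \<tau> then All j \<tau> \<phi> else All j \<tau> (subst i \<sigma> u \<phi>))"

primrec free_for :: "tm \<Rightarrow> nat \<Rightarrow> ty \<Rightarrow> fm \<Rightarrow> bool" where
  "free_for u i \<sigma> (Eq s t) = True"
| "free_for u i \<sigma> Bot = True"
| "free_for u i \<sigma> (Imp \<phi> \<psi>) = (free_for u i \<sigma> \<phi> \<and> free_for u i \<sigma> \<psi>)"
| "free_for u i \<sigma> (All j \<tau> \<phi>) =
     ((i, \<sigma>) \<notin> fv (All j \<tau> \<phi>) \<or> ((j, \<tau>) \<notin> vars u \<and> free_for u i \<sigma> \<phi>))"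

section \<open>Derivability in many-sorted classical logic\<close>

text \<open>A Hilbert calculus. Generalisation is unrestricted, so axioms with free variables stand for
  their universal closures.\<close>

inductive derivable :: "fm set \<Rightarrow> fm \<Rightarrow> bool" (infix "\<turnstile>" 50) for T :: "fm set" where
  ax: "\<phi> \<in> T \<Longrightarrow> T \<turnstile> \<phi>"
| weaken: "\<lbrakk>wf_fm \<phi>; wf_fm \<psi>\<rbrakk> \<Longrightarrow> T \<turnstile> Imp \<phi> (Imp \<psi> \<phi>)"
| distrib: "\<lbrakk>wf_fm \<phi>; wf_fm \<psi>; wf_fm \<chi>\<rbrakk> \<Longrightarrow>
    T \<turnstile> Imp (Imp \<phi> (Imp \<psi> \<chi>)) (Imp (Imp \<phi> \<psi>) (Imp \<phi> \<chi>))"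
| classical: "wf_fm \<phi> \<Longrightarrow> T \<turnstile> Imp (Neg (Neg \<phi>)) \<phi>"
| inst: "\<lbrakk>wf_fm \<phi>; well_typed t; typ_of t = \<tau>; free_for t i \<tau> \<phi>\<rbrakk> \<Longrightarrow>
    T \<turnstile> Imp (All i \<tau> \<phi>) (subst i \<tau> t \<phi>)"
| all_distrib: "\<lbrakk>wf_fm \<phi>; wf_fm \<psi>; (i, \<tau>) \<notin> fv \<phi>\<rbrakk> \<Longrightarrow>
    T \<turnstile> Imp (All i \<tau> (Imp \<phi> \<psi>)) (Imp \<phi> (All i \<tau> \<psi>))"
| mp: "\<lbrakk>T \<turnstile> Imp \<phi> \<psi>; T \<turnstile> \<phi>\<rbrakk> \<Longrightarrow> T \<turnstile> \<psi>"
| gen: "T \<turnstile> \<phi> \<Longrightarrow> T \<turnstile> All i \<tau> \<phi>"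

section \<open>Formula builders\<close>

text \<open>Concrete sentences are written as functions \<open>nat \<Rightarrow> fm\<close> whose argument \<open>d\<close> is a name such that
  no variable occurring free so far has a name \<open>\<ge> d\<close>. A quantifier uses \<open>d\<close> as the name of its
  variable and passes \<open>Suc d\<close> to its scope, so nothing is ever captured. A closed
  builder is turned into a sentence by applying it to \<open>0\<close>.\<close>

type_synonym pfm = "nat \<Rightarrow> fm"

definition all :: "ty \<Rightarrow> (tm \<Rightarrow> pfm) \<Rightarrow> pfm" where
  "all \<tau> F = (\<lambda>d. All d \<tau> (F (Var d \<tau>) (Suc d)))"

definition ex :: "ty \<Rightarrow> (tm \<Rightarrow> pfm) \<Rightarrow> pfm" where
  "ex \<tau> F = (\<lambda>d. Ex d \<tau> (F (Var d \<tau>) (Suc d)))"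

definition peq :: "tm \<Rightarrow> tm \<Rightarrow> pfm" (infix "\<doteq>" 50) where
  "s \<doteq> t = (\<lambda>d. Eq s t)"

definition pneg :: "pfm \<Rightarrow> pfm" ("\<^bold>\<not> _" [40] 40) where
  "(\<^bold>\<not> P) = (\<lambda>d. Neg (P d))"

definition pand :: "pfm \<Rightarrow> pfm \<Rightarrow> pfm" (infixr "\<^bold>\<and>" 35) where
  "(P \<^bold>\<and> Q) = (\<lambda>d. And (P d) (Q d))"

definition por :: "pfm \<Rightarrow> pfm \<Rightarrow> pfm" (infixr "\<^bold>\<or>" 30) where
  "(P \<^bold>\<or> Q) = (\<lambda>d. Or (P d) (Q d))"

definition pimp :: "pfm \<Rightarrow> pfm \<Rightarrow> pfm" (infixr "\<^bold>\<longrightarrow>" 25) where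
  "(P \<^bold>\<longrightarrow> Q) = (\<lambda>d. Imp (P d) (Q d))"

definition piff :: "pfm \<Rightarrow> pfm \<Rightarrow> pfm" (infixr "\<^bold>\<longleftrightarrow>" 25) where
  "(P \<^bold>\<longleftrightarrow> Q) = (\<lambda>d. Iff (P d) (Q d))"

text \<open>Quantification over a variable with a prescribed name.\<close>

definition all_var :: "nat \<Rightarrow> ty \<Rightarrow> pfm \<Rightarrow> pfm" where
  "all_var i \<tau> P = (\<lambda>d. All i \<tau> (P d))"

definition ex_var :: "nat \<Rightarrow> ty \<Rightarrow> pfm \<Rightarrow> pfm" where
  "ex_var i \<tau> P = (\<lambda>d. Ex i \<tau> (P d))"

section \<open>The base theories\<close>

text \<open>Equality at higher types is defined extensionally.\<close>

primrec eq_at :: "ty \<Rightarrow> tm \<Rightarrow> tm \<Rightarrow> pfm" where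
  "eq_at N = (\<lambda>s t. s \<doteq> t)"
| "eq_at (\<sigma> \<rightarrow> \<tau>) = (\<lambda>s t. all \<sigma> (\<lambda>x. eq_at \<tau> (s \<cdot> x) (t \<cdot> x)))"

definition eq_axioms :: "fm set" where
  "eq_axioms =
    {all N (\<lambda>x. x \<doteq> x) 0,
     all N (\<lambda>x. all N (\<lambda>y. x \<doteq> y \<^bold>\<longrightarrow> y \<doteq> x)) 0,
     all N (\<lambda>x. all N (\<lambda>y. all N (\<lambda>z. x \<doteq> y \<^bold>\<longrightarrow> y \<doteq> z \<^bold>\<longrightarrow> x \<doteq> z))) 0}"

definition succ_axioms :: "fm set" where
  "succ_axioms =
    {all N (\<lambda>x. \<^bold>\<not> (Succ \<cdot> x \<doteq> Zero)) 0,
     all N (\<lambda>x. all N (\<lambda>y. Succ \<cdot> x \<doteq> Succ \<cdot> y \<^bold>\<longrightarrow> x \<doteq> y)) 0}"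

definition comb_axioms :: "fm set" where
  "comb_axioms =
    {all \<sigma> (\<lambda>x. all \<tau> (\<lambda>y. eq_at \<sigma> (CombK \<sigma> \<tau> \<cdot> x \<cdot> y) x)) 0 | \<sigma> \<tau>. True} \<union>
    {all (\<rho> \<rightarrow> \<sigma> \<rightarrow> \<tau>) (\<lambda>x. all (\<rho> \<rightarrow> \<sigma>) (\<lambda>y. all \<rho> (\<lambda>z.
       eq_at \<tau> (CombS \<rho> \<sigma> \<tau> \<cdot> x \<cdot> y \<cdot> z) (x \<cdot> z \<cdot> (y \<cdot> z))))) 0 | \<rho> \<sigma> \<tau>. True}"

definition rec_axioms :: "fm set" where
  "rec_axioms =
    {all N (\<lambda>y. all (N \<rightarrow> N \<rightarrow> N) (\<lambda>z. Rec \<cdot> Zero \<cdot> y \<cdot> z \<doteq> y)) 0,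
     all N (\<lambda>x. all N (\<lambda>y. all (N \<rightarrow> N \<rightarrow> N) (\<lambda>z.
       Rec \<cdot> (Succ \<cdot> x) \<cdot> y \<cdot> z \<doteq> z \<cdot> (Rec \<cdot> x \<cdot> y \<cdot> z) \<cdot> x))) 0}"

definition ext_axioms :: "fm set" where
  "ext_axioms =
    {all \<sigma> (\<lambda>x. all \<sigma> (\<lambda>y. all (\<sigma> \<rightarrow> \<tau>) (\<lambda>F.
       eq_at \<sigma> x y \<^bold>\<longrightarrow> eq_at \<tau> (F \<cdot> x) (F \<cdot> y)))) 0 | \<sigma> \<tau>. True}"

definition qf_induction :: "fm set" where
  "qf_induction =
    {Imp (subst i N Zero \<phi>)
       (Imp (All i N (Imp \<phi> (subst i N (Succ \<cdot> Var i N) \<phi>))) (All i N \<phi>)) | i \<phi>.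
     wf_fm \<phi> \<and> qfree \<phi>}"

definition QF_AC_10 :: "fm set" where
  "QF_AC_10 =
    {Imp (All i N1 (Ex j N \<phi>))
       (Ex k N2 (All i N1 (subst j N (Var k N2 \<cdot> Var i N1) \<phi>))) | i j k \<phi>.
     wf_fm \<phi> \<and> qfree \<phi> \<and> (k, N2) \<notin> fv \<phi>}"

definition QF_AC_01 :: "fm set" where
  "QF_AC_01 =
    {Imp (All j N (Ex i N1 \<phi>))
       (Ex k (N \<rightarrow> N1) (All j N (subst i N1 (Var k (N \<rightarrow> N1) \<cdot> Var j N) \<phi>))) | i j k \<phi>.
     wf_fm \<phi> \<and> qfree \<phi> \<and> (k, N \<rightarrow> N1) \<notin> fv \<phi>}"

definition RCA0_omega :: "fm set" where
  "RCA0_omega = eq_axioms \<union> succ_axioms \<union> comb_axioms \<union> rec_axioms \<union> ext_axioms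
     \<union> qf_induction \<union> QF_AC_10"

section \<open>Primitive recursive terms\<close>

text \<open>Bracket abstraction: \<open>lam i \<sigma> t\<close> denotes the function sending the variable \<open>Var i \<sigma>\<close> to \<open>t\<close>.\<close>

fun lam :: "nat \<Rightarrow> ty \<Rightarrow> tm \<Rightarrow> tm" where
  "lam i \<sigma> (Var j \<tau>) =
     (if i = j \<and> \<sigma> = \<tau> then CombS \<sigma> (\<sigma> \<rightarrow> \<sigma>) \<sigma> \<cdot> CombK \<sigma> (\<sigma> \<rightarrow> \<sigma>) \<cdot> CombK \<sigma> \<sigma>
      else CombK \<tau> \<sigma> \<cdot> Var j \<tau>)"
| "lam i \<sigma> (s \<cdot> t) =
     (if (i, \<sigma>) \<in> vars (s \<cdot> t)
      then CombS \<sigma> (typ_of t) (typ_of (s \<cdot> t)) \<cdot> lam i \<sigma> s \<cdot> lam i \<sigma> t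
      else CombK (typ_of (s \<cdot> t)) \<sigma> \<cdot> (s \<cdot> t))"
| "lam i \<sigma> t = CombK (typ_of t) \<sigma> \<cdot> t"

abbreviation v :: "nat \<Rightarrow> tm" where "v i \<equiv> Var i N"

text \<open>Each operation below is a closed term applied to its arguments, so no variable of an argument
  can be captured.\<close>

definition plus_tm :: tm where
  "plus_tm = lam 0 N (lam 1 N (Rec \<cdot> v 1 \<cdot> v 0 \<cdot> lam 2 N (lam 3 N (Succ \<cdot> v 2))))"
abbreviation padd :: "tm \<Rightarrow> tm \<Rightarrow> tm" (infixl "\<oplus>" 65) where "s \<oplus> t \<equiv> plus_tm \<cdot> s \<cdot> t"

definition times_tm :: tm where
  "times_tm = lam 0 N (lam 1 N (Rec \<cdot> v 1 \<cdot> Zero \<cdot> lam 2 N (lam 3 N (v 2 \<oplus> v 0))))"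
abbreviation pmult :: "tm \<Rightarrow> tm \<Rightarrow> tm" (infixl "\<otimes>" 70) where "s \<otimes> t \<equiv> times_tm \<cdot> s \<cdot> t"

definition pred_tm :: tm where
  "pred_tm = lam 0 N (Rec \<cdot> v 0 \<cdot> Zero \<cdot> lam 1 N (lam 2 N (v 2)))"

definition monus_tm :: tm where
  "monus_tm = lam 0 N (lam 1 N (Rec \<cdot> v 1 \<cdot> v 0 \<cdot> lam 2 N (lam 3 N (pred_tm \<cdot> v 2))))"
abbreviation pmonus :: "tm \<Rightarrow> tm \<Rightarrow> tm" (infixl "\<ominus>" 65) where "s \<ominus> t \<equiv> monus_tm \<cdot> s \<cdot> t"

definition pow2_tm :: tm where
  "pow2_tm = lam 0 N (Rec \<cdot> v 0 \<cdot> (Succ \<cdot> Zero) \<cdot> lam 1 N (lam 2 N (v 1 \<oplus> v 1)))"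

text \<open>\<open>sum_tm \<cdot> f \<cdot> n\<close> is the sum of \<open>f m\<close> over \<open>m < n\<close>.\<close>

definition sum_tm :: tm where
  "sum_tm = lam 0 N1 (lam 1 N (Rec \<cdot> v 1 \<cdot> Zero \<cdot>
     lam 2 N (lam 3 N (v 2 \<oplus> Var 0 N1 \<cdot> v 3))))"

text \<open>Cantor pairing \<open>(x, y) \<mapsto> (x + y)(x + y + 1)/2 + y\<close>, a bijection; the projections are
  obtained by summing over all pairs of numbers up to the given code.\<close>

definition pair_tm :: tm where
  "pair_tm = lam 0 N (lam 1 N (sum_tm \<cdot> Succ \<cdot> (v 0 \<oplus> v 1) \<oplus> v 1))"
abbreviation pair :: "tm \<Rightarrow> tm \<Rightarrow> tm" where "pair s t \<equiv> pair_tm \<cdot> s \<cdot> t"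

definition eqchar_tm :: tm where
  "eqchar_tm = lam 0 N (lam 1 N (Succ \<cdot> Zero \<ominus> ((v 0 \<ominus> v 1) \<oplus> (v 1 \<ominus> v 0))))"

definition fst_tm :: tm where
  "fst_tm = lam 0 N (sum_tm \<cdot> lam 1 N (sum_tm \<cdot>
     lam 2 N (v 1 \<otimes> (eqchar_tm \<cdot> pair (v 1) (v 2) \<cdot> v 0)) \<cdot> (Succ \<cdot> v 0)) \<cdot> (Succ \<cdot> v 0))"

definition snd_tm :: tm where
  "snd_tm = lam 0 N (sum_tm \<cdot> lam 1 N (sum_tm \<cdot>
     lam 2 N (v 2 \<otimes> (eqchar_tm \<cdot> pair (v 1) (v 2) \<cdot> v 0)) \<cdot> (Succ \<cdot> v 0)) \<cdot> (Succ \<cdot> v 0))"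

definition Less :: "tm \<Rightarrow> tm \<Rightarrow> fm" where
  "Less s t = Eq (Succ \<cdot> s \<ominus> t) Zero"

definition pless :: "tm \<Rightarrow> tm \<Rightarrow> pfm" (infix "\<^bold><" 50) where
  "s \<^bold>< t = (\<lambda>d. Less s t)"

text \<open>The code of the initial segment \<open>(g 0, \<dots>, g (n - 1))\<close>: the empty sequence has code \<open>0\<close>, and
  appending \<open>a\<close> to a sequence with code \<open>c\<close> gives the code \<open>pair c a + 1\<close>.\<close>

definition init_tm :: tm where
  "init_tm = lam 0 N1 (lam 1 N (Rec \<cdot> v 1 \<cdot> Zero \<cdot>
     lam 2 N (lam 3 N (Succ \<cdot> pair (v 2) (Var 0 N1 \<cdot> v 3)))))"

fun tuple :: "tm list \<Rightarrow> tm" where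
  "tuple [] = Zero"
| "tuple [t] = t"
| "tuple (t # u # us) = pair t (tuple (u # us))"

section \<open>Comprehension functionals\<close>

definition exists2 :: fm where
  "exists2 = ex N2 (\<lambda>E. all N1 (\<lambda>f.
     (E \<cdot> f \<doteq> Zero \<^bold>\<or> E \<cdot> f \<doteq> Succ \<cdot> Zero) \<^bold>\<and>
     (E \<cdot> f \<doteq> Zero \<^bold>\<longleftrightarrow> ex N (\<lambda>n. f \<cdot> n \<doteq> Zero)))) 0"

definition ACA0_omega :: "fm set" where
  "ACA0_omega = RCA0_omega \<union> {exists2}"

text \<open>\<open>normal_form b k f gs\<close> is the formula with \<open>k\<close> alternating function quantifiers, the first
  one existential iff \<open>b\<close>, followed by a number quantifier of the opposite kind to the last of
  them, and the matrix \<open>f\<langle>g\<^sub>1n, \<dots>, g\<^sub>mn\<rangle> = 0\<close> on codes of initial segments, where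
  the list \<open>gs\<close> holds the functions that are already quantified. Thus \<open>normal_form True k f []\<close>
  is the Kleene normal form of a \<open>\<Sigma>\<^sup>1\<^sub>k\<close>-formula; for \<open>k = 1\<close> it is
  \<open>\<exists>g \<forall>n. f (init g n) = 0\<close>.\<close>

fun normal_form :: "bool \<Rightarrow> nat \<Rightarrow> tm \<Rightarrow> tm list \<Rightarrow> pfm" where
  "normal_form b 0 f gs =
     (if b then ex N (\<lambda>n. f \<cdot> tuple (map (\<lambda>g. init_tm \<cdot> g \<cdot> n) gs) \<doteq> Zero)
      else all N (\<lambda>n. f \<cdot> tuple (map (\<lambda>g. init_tm \<cdot> g \<cdot> n) gs) \<doteq> Zero))"
| "normal_form b (Suc k) f gs =
     (if b then ex N1 (\<lambda>g. normal_form False k f (gs @ [g]))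
      else all N1 (\<lambda>g. normal_form True k f (gs @ [g])))"

definition Suslin2 :: "nat \<Rightarrow> fm" where
  "Suslin2 k = ex N2 (\<lambda>S. all N1 (\<lambda>f.
     (S \<cdot> f \<doteq> Zero \<^bold>\<or> S \<cdot> f \<doteq> Succ \<cdot> Zero) \<^bold>\<and>
     (normal_form True k f [] \<^bold>\<longleftrightarrow> S \<cdot> f \<doteq> Zero))) 0"

definition Pi1_CA0_omega :: "nat \<Rightarrow> fm set" where
  "Pi1_CA0_omega k = RCA0_omega \<union> {Suslin2 k}"

definition Z2_omega :: "fm set" where
  "Z2_omega = (\<Union>k\<in>{1..}. Pi1_CA0_omega k)"

section \<open>Arithmetical transfinite recursion\<close>

text \<open>The language of second-order arithmetic is identified with a fragment of the present one: a set
  variable \<open>X\<close> is a variable of type \<open>N1\<close>, and \<open>n \<in> X\<close> means \<open>X n = 0\<close>.\<close>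

definition Mem :: "tm \<Rightarrow> tm \<Rightarrow> fm" where
  "Mem n X = Eq (X \<cdot> n) Zero"

definition mem :: "tm \<Rightarrow> tm \<Rightarrow> pfm" (infix "\<^bold>\<in>" 50) where
  "n \<^bold>\<in> X = (\<lambda>d. Mem n X)"

inductive l2_term :: "tm \<Rightarrow> bool" where
  "l2_term (Var i N)"
| "l2_term Zero"
| "l2_term t \<Longrightarrow> l2_term (Succ \<cdot> t)"
| "\<lbrakk>l2_term s; l2_term t\<rbrakk> \<Longrightarrow> l2_term (s \<oplus> t)"
| "\<lbrakk>l2_term s; l2_term t\<rbrakk> \<Longrightarrow> l2_term (s \<otimes> t)"

inductive arithmetical :: "fm \<Rightarrow> bool" where
  "\<lbrakk>l2_term s; l2_term t\<rbrakk> \<Longrightarrow> arithmetical (Eq s t)"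
| "\<lbrakk>l2_term s; l2_term t\<rbrakk> \<Longrightarrow> arithmetical (Less s t)"
| "l2_term t \<Longrightarrow> arithmetical (Mem t (Var i N1))"
| "arithmetical Bot"
| "\<lbrakk>arithmetical \<phi>; arithmetical \<psi>\<rbrakk> \<Longrightarrow> arithmetical (Imp \<phi> \<psi>)"
| "arithmetical \<phi> \<Longrightarrow> arithmetical (All i N \<phi>)"

definition basic_axioms :: "fm set" where
  "basic_axioms =
    {all N (\<lambda>n. \<^bold>\<not> (Succ \<cdot> n \<doteq> Zero)) 0,
     all N (\<lambda>m. all N (\<lambda>n. Succ \<cdot> m \<doteq> Succ \<cdot> n \<^bold>\<longrightarrow> m \<doteq> n)) 0,
     all N (\<lambda>m. m \<oplus> Zero \<doteq> m) 0,
     all N (\<lambda>m. all N (\<lambda>n. m \<oplus> Succ \<cdot> n \<doteq> Succ \<cdot> (m \<oplus> n))) 0,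
     all N (\<lambda>m. m \<otimes> Zero \<doteq> Zero) 0,
     all N (\<lambda>m. all N (\<lambda>n. m \<otimes> (Succ \<cdot> n) \<doteq> m \<otimes> n \<oplus> m)) 0,
     all N (\<lambda>m. \<^bold>\<not> (m \<^bold>< Zero)) 0,
     all N (\<lambda>m. all N (\<lambda>n. m \<^bold>< Succ \<cdot> n \<^bold>\<longleftrightarrow> (m \<^bold>< n \<^bold>\<or> m \<doteq> n))) 0}"

definition induction_axiom :: fm where
  "induction_axiom = all N1 (\<lambda>X.
     (Zero \<^bold>\<in> X \<^bold>\<and> all N (\<lambda>n. n \<^bold>\<in> X \<^bold>\<longrightarrow> Succ \<cdot> n \<^bold>\<in> X)) \<^bold>\<longrightarrow> all N (\<lambda>n. n \<^bold>\<in> X)) 0"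

definition arith_comprehension :: "fm set" where
  "arith_comprehension =
    {Ex k N1 (All i N (Iff (Mem (Var i N) (Var k N1)) \<phi>)) | i k \<phi>.
     arithmetical \<phi> \<and> (k, N1) \<notin> fv \<phi>}"

definition ACA0 :: "fm set" where
  "ACA0 = basic_axioms \<union> {induction_axiom} \<union> arith_comprehension"

text \<open>Binary relations and linear orders as sets of pairs, with the pairing term
  \<open>(i + j)\<^sup>2 + i\<close> of second-order arithmetic.\<close>

definition l2_pair :: "tm \<Rightarrow> tm \<Rightarrow> tm" where
  "l2_pair i j = (i \<oplus> j) \<otimes> (i \<oplus> j) \<oplus> i"

definition in_field :: "tm \<Rightarrow> tm \<Rightarrow> pfm" where
  "in_field X i = (l2_pair i i \<^bold>\<in> X)"

definition ord_less :: "tm \<Rightarrow> tm \<Rightarrow> tm \<Rightarrow> pfm" where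
  "ord_less X i j = (l2_pair i j \<^bold>\<in> X \<^bold>\<and> \<^bold>\<not> (l2_pair j i \<^bold>\<in> X))"

definition linear_order :: "tm \<Rightarrow> pfm" where
  "linear_order X =
    (all N (\<lambda>i. all N (\<lambda>j. l2_pair i j \<^bold>\<in> X \<^bold>\<longrightarrow> in_field X i \<^bold>\<and> in_field X j)) \<^bold>\<and>
     all N (\<lambda>i. all N (\<lambda>j. all N (\<lambda>k.
       l2_pair i j \<^bold>\<in> X \<^bold>\<and> l2_pair j k \<^bold>\<in> X \<^bold>\<longrightarrow> l2_pair i k \<^bold>\<in> X))) \<^bold>\<and>
     all N (\<lambda>i. all N (\<lambda>j. l2_pair i j \<^bold>\<in> X \<^bold>\<and> l2_pair j i \<^bold>\<in> X \<^bold>\<longrightarrow> i \<doteq> j)) \<^bold>\<and>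
     all N (\<lambda>i. all N (\<lambda>j. in_field X i \<^bold>\<and> in_field X j \<^bold>\<longrightarrow>
       l2_pair i j \<^bold>\<in> X \<^bold>\<or> l2_pair j i \<^bold>\<in> X)))"

text \<open>Functions from numbers to numbers are quantified directly instead of being coded as sets of
  pairs.\<close>

definition well_order :: "tm \<Rightarrow> pfm" where
  "well_order X = (linear_order X \<^bold>\<and>
     \<^bold>\<not> ex N1 (\<lambda>f. all N (\<lambda>n. in_field X (f \<cdot> n) \<^bold>\<and> ord_less X (f \<cdot> (Succ \<cdot> n)) (f \<cdot> n))))"

text \<open>\<open>Z = {(m, i). i <\<^sub>X j \<and> (m, i) \<in> Y}\<close>\<close>

definition is_below :: "tm \<Rightarrow> tm \<Rightarrow> tm \<Rightarrow> tm \<Rightarrow> pfm" where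
  "is_below X Y j Z = all N (\<lambda>p. p \<^bold>\<in> Z \<^bold>\<longleftrightarrow>
     ex N (\<lambda>m. ex N (\<lambda>i. p \<doteq> l2_pair m i \<^bold>\<and> ord_less X i j \<^bold>\<and> p \<^bold>\<in> Y)))"

text \<open>\<open>Y = {(n, j). j \<in> field X \<and> \<theta>(n, {(m, i). i <\<^sub>X j \<and> (m, i) \<in> Y})}\<close>, where the variables
  \<open>n\<close> and \<open>Z\<close> of \<open>\<theta>(n, Z)\<close> are \<open>Var a N\<close> and \<open>Var b N1\<close>. The other free variables of \<open>\<theta>\<close> are
  parameters.\<close>

definition recursion_along :: "fm \<Rightarrow> nat \<Rightarrow> nat \<Rightarrow> tm \<Rightarrow> tm \<Rightarrow> pfm" where
  "recursion_along \<theta> a b X Y = all N (\<lambda>p. p \<^bold>\<in> Y \<^bold>\<longleftrightarrow>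
     ex N (\<lambda>j. ex_var a N (p \<doteq> l2_pair (Var a N) j \<^bold>\<and> in_field X j \<^bold>\<and>
       all_var b N1 (is_below X Y j (Var b N1) \<^bold>\<longrightarrow> (\<lambda>d. \<theta>)))))"

definition ATR_axioms :: "fm set" where
  "ATR_axioms =
    {all N1 (\<lambda>X. well_order X \<^bold>\<longrightarrow> ex N1 (\<lambda>Y. recursion_along \<theta> a b X Y)) d | \<theta> a b d.
     arithmetical \<theta> \<and> a < d \<and> b < d \<and> (\<forall>(i, \<tau>) \<in> fv \<theta>. i < d)}"

definition ATR0 :: "fm set" where
  "ATR0 = ACA0 \<union> ATR_axioms"

section \<open>Rational and real numbers\<close>

text \<open>The number \<open>pair (pair p m) d\<close> codes the rational \<open>(p - m) / (d + 1)\<close>; every number is a code.\<close>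

abbreviation qpos :: "tm \<Rightarrow> tm" where "qpos q \<equiv> fst_tm \<cdot> (fst_tm \<cdot> q)"
abbreviation qneg :: "tm \<Rightarrow> tm" where "qneg q \<equiv> snd_tm \<cdot> (fst_tm \<cdot> q)"
abbreviation qden :: "tm \<Rightarrow> tm" where "qden q \<equiv> Succ \<cdot> (snd_tm \<cdot> q)"

definition qadd_tm :: tm where
  "qadd_tm = lam 0 N (lam 1 N (pair
     (pair (qpos (v 0) \<otimes> qden (v 1) \<oplus> qpos (v 1) \<otimes> qden (v 0))
           (qneg (v 0) \<otimes> qden (v 1) \<oplus> qneg (v 1) \<otimes> qden (v 0)))
     (pred_tm \<cdot> (qden (v 0) \<otimes> qden (v 1)))))"
abbreviation qadd :: "tm \<Rightarrow> tm \<Rightarrow> tm" (infixl "\<oplus>\<^sub>Q" 65) where "q \<oplus>\<^sub>Q r \<equiv> qadd_tm \<cdot> q \<cdot> r"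

definition qless :: "tm \<Rightarrow> tm \<Rightarrow> pfm" (infix "<\<^sub>Q" 50) where
  "q <\<^sub>Q r = (qpos q \<otimes> qden r \<oplus> qneg r \<otimes> qden q \<^bold>< qpos r \<otimes> qden q \<oplus> qneg q \<otimes> qden r)"

definition qle :: "tm \<Rightarrow> tm \<Rightarrow> pfm" (infix "\<le>\<^sub>Q" 50) where
  "q \<le>\<^sub>Q r = (\<^bold>\<not> (r <\<^sub>Q q))"

text \<open>\<open>dyadic c n\<close> is the rational \<open>c / 2\<^sup>n\<close>.\<close>

definition dyadic_tm :: tm where
  "dyadic_tm = lam 0 N (lam 1 N (pair (pair (v 0) Zero) (pred_tm \<cdot> (pow2_tm \<cdot> v 1))))"
abbreviation dyadic :: "tm \<Rightarrow> tm \<Rightarrow> tm" where "dyadic c n \<equiv> dyadic_tm \<cdot> c \<cdot> n"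

abbreviation one :: tm where "one \<equiv> Succ \<cdot> Zero"
abbreviation two :: tm where "two \<equiv> Succ \<cdot> (Succ \<cdot> Zero)"

text \<open>\<open>|x\<^sub>n - x\<^sub>n\<^sub>+\<^sub>i| < 2\<^sup>-\<^sup>n\<close> for all \<open>n, i\<close>. Hence \<open>|x - x\<^sub>n| \<le> 2\<^sup>-\<^sup>n\<close> for the limit, which leads to
  \<open>x =\<^sub>R y\<close> iff \<open>|x\<^sub>n - y\<^sub>n| \<le> 2 / 2\<^sup>n\<close> for all \<open>n\<close>, and \<open>x <\<^sub>R y\<close> iff \<open>x\<^sub>n + 2 / 2\<^sup>n < y\<^sub>n\<close> for
  some \<open>n\<close>.\<close>

definition is_real :: "tm \<Rightarrow> pfm" where
  "is_real x = all N (\<lambda>n. all N (\<lambda>i.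
     x \<cdot> n <\<^sub>Q x \<cdot> (n \<oplus> i) \<oplus>\<^sub>Q dyadic one n \<^bold>\<and> x \<cdot> (n \<oplus> i) <\<^sub>Q x \<cdot> n \<oplus>\<^sub>Q dyadic one n))"

definition req :: "tm \<Rightarrow> tm \<Rightarrow> pfm" (infix "=\<^sub>R" 50) where
  "x =\<^sub>R y = all N (\<lambda>n.
     x \<cdot> n \<le>\<^sub>Q y \<cdot> n \<oplus>\<^sub>Q dyadic two n \<^bold>\<and> y \<cdot> n \<le>\<^sub>Q x \<cdot> n \<oplus>\<^sub>Q dyadic two n)"

definition rless :: "tm \<Rightarrow> tm \<Rightarrow> pfm" (infix "<\<^sub>R" 50) where
  "x <\<^sub>R y = ex N (\<lambda>n. x \<cdot> n \<oplus>\<^sub>Q dyadic two n <\<^sub>Q y \<cdot> n)"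

definition rle :: "tm \<Rightarrow> tm \<Rightarrow> pfm" (infix "\<le>\<^sub>R" 50) where
  "x \<le>\<^sub>R y = (\<^bold>\<not> (y <\<^sub>R x))"

definition all_real :: "(tm \<Rightarrow> pfm) \<Rightarrow> pfm" where
  "all_real P = all N1 (\<lambda>x. is_real x \<^bold>\<longrightarrow> P x)"

definition ex_real :: "(tm \<Rightarrow> pfm) \<Rightarrow> pfm" where
  "ex_real P = ex N1 (\<lambda>x. is_real x \<^bold>\<and> P x)"

definition rzero :: tm where "rzero = CombK N N \<cdot> dyadic Zero Zero"
definition rone :: tm where "rone = CombK N N \<cdot> dyadic one Zero"

text \<open>\<open>shift x k\<close> is \<open>x + 2\<^sup>-\<^sup>k\<close>, and \<open>in_ball x k y\<close> says that \<open>|x - y| < 2\<^sup>-\<^sup>k\<close>.\<close>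

definition shift_tm :: tm where
  "shift_tm = lam 0 N1 (lam 1 N (lam 2 N (Var 0 N1 \<cdot> v 2 \<oplus>\<^sub>Q dyadic one (v 1))))"
abbreviation shift :: "tm \<Rightarrow> tm \<Rightarrow> tm" where "shift x k \<equiv> shift_tm \<cdot> x \<cdot> k"

definition in_ball :: "tm \<Rightarrow> tm \<Rightarrow> tm \<Rightarrow> pfm" where
  "in_ball x k y = (x <\<^sub>R shift y k \<^bold>\<and> y <\<^sub>R shift x k)"

section \<open>Sets of reals\<close>

abbreviation RtoR :: ty where "RtoR \<equiv> N1 \<rightarrow> N1"

text \<open>A set of reals is given by a function \<open>F\<close> from the reals to the non-negative reals, and
  \<open>x\<close> belongs to it iff \<open>F x > 0\<close>.\<close>

definition is_set :: "tm \<Rightarrow> pfm" where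
  "is_set F =
    (all_real (\<lambda>x. is_real (F \<cdot> x) \<^bold>\<and> rzero \<le>\<^sub>R F \<cdot> x) \<^bold>\<and>
     all_real (\<lambda>x. all_real (\<lambda>y. x =\<^sub>R y \<^bold>\<longrightarrow> F \<cdot> x =\<^sub>R F \<cdot> y)))"

definition elem :: "tm \<Rightarrow> tm \<Rightarrow> pfm" (infix "\<in>\<^sub>R" 50) where
  "x \<in>\<^sub>R F = (rzero <\<^sub>R F \<cdot> x)"

text \<open>Openness is defined for an arbitrary property of reals, so that it applies to complements.\<close>

definition open_class :: "(tm \<Rightarrow> pfm) \<Rightarrow> pfm" where
  "open_class P = all_real (\<lambda>x. P x \<^bold>\<longrightarrow>
     ex N (\<lambda>k. all_real (\<lambda>y. in_ball x k y \<^bold>\<longrightarrow> P y)))"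

definition closed_set :: "tm \<Rightarrow> pfm" where
  "closed_set C = (is_set C \<^bold>\<and> open_class (\<lambda>x. \<^bold>\<not> (x \<in>\<^sub>R C)))"

definition countable_set :: "tm \<Rightarrow> pfm" where
  "countable_set A = ex N2 (\<lambda>Y.
     all_real (\<lambda>x. all_real (\<lambda>y. x =\<^sub>R y \<^bold>\<longrightarrow> Y \<cdot> x \<doteq> Y \<cdot> y)) \<^bold>\<and>
     all_real (\<lambda>x. all_real (\<lambda>y.
       x \<in>\<^sub>R A \<^bold>\<and> y \<in>\<^sub>R A \<^bold>\<longrightarrow> Y \<cdot> x \<doteq> Y \<cdot> y \<^bold>\<longrightarrow> x =\<^sub>R y)))"

definition perfect_set :: "tm \<Rightarrow> pfm" where
  "perfect_set P = (closed_set P \<^bold>\<and>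
     \<^bold>\<not> ex_real (\<lambda>x. x \<in>\<^sub>R P \<^bold>\<and>
       ex N (\<lambda>k. all_real (\<lambda>y. y \<in>\<^sub>R P \<^bold>\<and> in_ball x k y \<^bold>\<longrightarrow> y =\<^sub>R x))))"

definition in_unit :: "tm \<Rightarrow> pfm" where
  "in_unit x = (rzero \<le>\<^sub>R x \<^bold>\<and> x \<le>\<^sub>R rone)"

definition NIN :: fm where
  "NIN = (\<^bold>\<not> ex N2 (\<lambda>Y.
     all_real (\<lambda>x. all_real (\<lambda>y. in_unit x \<^bold>\<and> in_unit y \<^bold>\<longrightarrow> x =\<^sub>R y \<^bold>\<longrightarrow> Y \<cdot> x \<doteq> Y \<cdot> y)) \<^bold>\<and>
     all_real (\<lambda>x. all_real (\<lambda>y. in_unit x \<^bold>\<and> in_unit y \<^bold>\<longrightarrow> Y \<cdot> x \<doteq> Y \<cdot> y \<^bold>\<longrightarrow> x =\<^sub>R y)))) 0"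

definition CBT :: fm where
  "CBT = all RtoR (\<lambda>C. closed_set C \<^bold>\<longrightarrow>
     ex RtoR (\<lambda>P. ex RtoR (\<lambda>S.
       perfect_set P \<^bold>\<and> is_set S \<^bold>\<and> countable_set S \<^bold>\<and>
       all_real (\<lambda>x. x \<in>\<^sub>R C \<^bold>\<longleftrightarrow> (x \<in>\<^sub>R P \<^bold>\<or> x \<in>\<^sub>R S)) \<^bold>\<and>
       \<^bold>\<not> ex_real (\<lambda>x. x \<in>\<^sub>R P \<^bold>\<and> x \<in>\<^sub>R S)))) 0"

definition PST :: fm where
  "PST = all RtoR (\<lambda>C. closed_set C \<^bold>\<and> \<^bold>\<not> countable_set C \<^bold>\<longrightarrow>
     ex RtoR (\<lambda>P. perfect_set P \<^bold>\<and> ex_real (\<lambda>x. x \<in>\<^sub>R P) \<^bold>\<and>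
       all_real (\<lambda>x. x \<in>\<^sub>R P \<^bold>\<longrightarrow> x \<in>\<^sub>R C))) 0"

end

theory Submission
  imports Defs "HOL-Library.Countable_Set" "HOL-Library.Nat_Bijection" Complex_Main
begin

text \<open>
  Both parts use term models. Given a countable set \<open>A\<close> of number-theoretic functions and some type 2
  oracles, the objects of a model are the closed applicative terms over the oracles and constants for
  the members of \<open>A\<close>, and equations of type \<open>N\<close> compare values. If \<open>A\<close> has simple closure properties
  and contains \<open>\<lambda>n. G f\<^sub>n\<close> for every oracle \<open>G\<close> and every sequence \<open>(f\<^sub>n)\<close> coded in \<open>A\<close>, then all terms
  have values, the model is extensional, and its type 1 objects are exactly the members of \<open>A\<close>. One of
  the oracles is injective on the reals in \<open>A\<close>. So NIN fails and every set of reals is countable in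
  the model; hence CBT holds with an empty perfect part, and PST holds vacuously.

  For the first part, \<open>A\<close> is moreover closed under Skolem functions for second-order arithmetic, so that
  the true Suslin functionals, restricted to \<open>A\<close>, are correct in the model. The set \<open>A\<close> and the
  injective oracle are built simultaneously by forcing with countable partial injections that leave
  infinitely many values in reserve. Given an instance of \<open>QF_AC_01\<close>, either some condition refutes its
  hypothesis for one number, or an increasing sequence of conditions yields a sequence of witnesses,
  which can be added to \<open>A\<close>.

  For the second part, \<open>A\<close> consists of the arithmetical functions. The cut of a real in \<open>A\<close> is mapped to
  a code of its definition of least rank; this map has the required closure property since truth is
  arithmetical for each bounded rank. Arithmetical transfinite recursion along \<open>\<omega>\<close> fails in this model,
  since it would yield an arithmetical truth definition.
\<close>

section \<open>Applicative terms and their evaluation\<close>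

text \<open>In the full type structure NIN is Cantor's theorem, so the set \<open>A\<close> has to
  be small, and the difficulty is to close it under an injective oracle. A term with a free number
  variable computes a sequence, and an oracle only accepts members of \<open>A\<close>; hence all
  values of the oracle along a sequence must form one function in \<open>A\<close>, and the values
  of the injection become information inside \<open>A\<close>. The injection can therefore not be
  added once \<open>A\<close> is fixed. For choice, the obstacle is that witnesses found one after
  the other keep using up values of the injection, while the limit must again be extendable.
  Moreover, an instance without solution has to fail for a reason that later decisions cannot undo;
  this is why a refutation speaks of all extensions. For arithmetical functions, the obstacle is
  that a map to definitions seems to need a truth predicate for all ranks. The way out is that the
  columns of a single arithmetical function have definitions of a common rank.\<close>

instance ty :: countable by countable_datatype

datatype 'a cm =
    CZero | CSucc | CK ty ty | CS ty ty ty | CRec | COrc nat | CFun 'a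
  | CApp "'a cm" "'a cm" (infixl "\<bullet>" 90)

instance cm :: (countable) countable by countable_datatype

type_synonym fn = "nat \<Rightarrow> nat"
type_synonym orcs = "nat \<Rightarrow> fn \<Rightarrow> nat"

inductive has_ty :: "'a set \<Rightarrow> 'a cm \<Rightarrow> ty \<Rightarrow> bool" for A where
  has_ty_Zero: "has_ty A CZero N"
| has_ty_Succ: "has_ty A CSucc N1"
| has_ty_K: "has_ty A (CK \<sigma> \<tau>) (\<sigma> \<rightarrow> \<tau> \<rightarrow> \<sigma>)"
| has_ty_S: "has_ty A (CS \<rho> \<sigma> \<tau>) ((\<rho> \<rightarrow> \<sigma> \<rightarrow> \<tau>) \<rightarrow> (\<rho> \<rightarrow> \<sigma>) \<rightarrow> \<rho> \<rightarrow> \<tau>)"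
| has_ty_Rec: "has_ty A CRec (N \<rightarrow> N \<rightarrow> (N \<rightarrow> N \<rightarrow> N) \<rightarrow> N)"
| has_ty_Orc: "has_ty A (COrc i) N2"
| has_ty_Fun: "f \<in> A \<Longrightarrow> has_ty A (CFun f) N1"
| has_ty_App: "has_ty A s (\<sigma> \<rightarrow> \<tau>) \<Longrightarrow> has_ty A t \<sigma> \<Longrightarrow> has_ty A (s \<bullet> t) \<tau>"

primrec num :: "nat \<Rightarrow> 'a cm" where
  "num 0 = CZero"
| "num (Suc n) = CSucc \<bullet> num n"

inductive red :: "'a cm \<Rightarrow> 'a cm \<Rightarrow> bool" where
  red_K: "red (CK \<sigma> \<tau> \<bullet> x \<bullet> y) x"
| red_S: "red (CS \<rho> \<sigma> \<tau> \<bullet> x \<bullet> y \<bullet> z) (x \<bullet> z \<bullet> (y \<bullet> z))"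
| red_App: "red s s' \<Longrightarrow> red (s \<bullet> t) (s' \<bullet> t)"

text \<open>In the oracle rule the argument has to lie in \<open>A\<close>. This makes evaluation monotone in \<open>A\<close>
  and dependent only on the restriction of the oracles to \<open>A\<close>.\<close>

inductive ev :: "fn set \<Rightarrow> orcs \<Rightarrow> fn cm \<Rightarrow> nat \<Rightarrow> bool" for A G where
  ev_red: "red t t' \<Longrightarrow> ev A G t' n \<Longrightarrow> ev A G t n"
| ev_Zero: "ev A G CZero 0"
| ev_Succ: "ev A G t n \<Longrightarrow> ev A G (CSucc \<bullet> t) (Suc n)"
| ev_Rec_0: "ev A G x 0 \<Longrightarrow> ev A G y n \<Longrightarrow> ev A G (CRec \<bullet> x \<bullet> y \<bullet> z) n"
| ev_Rec_Suc: "ev A G x (Suc m) \<Longrightarrow> ev A G (z \<bullet> (CRec \<bullet> num m \<bullet> y \<bullet> z) \<bullet> num m) n \<Longrightarrow>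
    ev A G (CRec \<bullet> x \<bullet> y \<bullet> z) n"
| ev_Fun: "ev A G t n \<Longrightarrow> ev A G (CFun f \<bullet> t) (f n)"
| ev_Orc: "(\<And>n. ev A G (t \<bullet> num n) (f n)) \<Longrightarrow> f \<in> A \<Longrightarrow> ev A G (COrc i \<bullet> t) (G i f)"

inductive_cases red_ZeroE: "red CZero t"
inductive_cases red_SuccE: "red CSucc t"
inductive_cases red_RecE: "red CRec t"
inductive_cases red_FunE: "red (CFun f) t"
inductive_cases red_OrcE: "red (COrc i) t"
inductive_cases red_KE: "red (CK \<sigma> \<tau>) t"
inductive_cases red_SE: "red (CS \<rho> \<sigma> \<tau>) t"
inductive_cases red_AppE: "red (s \<bullet> t) u"
lemmas red_elims = red_ZeroE red_SuccE red_RecE red_FunE red_OrcE red_KE red_SE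

lemma red_det: "red t u \<Longrightarrow> red t u' \<Longrightarrow> u = u'"
proof (induction arbitrary: u' rule: red.induct)
  case (red_K \<sigma> \<tau> x y)
  then show ?case by (auto elim!: red_AppE red_elims)
next
  case (red_S \<rho> \<sigma> \<tau> x y z)
  then show ?case by (auto elim!: red_AppE red_elims)
next
  case (red_App s s' t)
  from red_App.prems show ?case
  proof (cases rule: red.cases)
    case red_K
    with red_App.hyps show ?thesis by (auto elim!: red_AppE red_elims)
  next
    case red_S
    with red_App.hyps show ?thesis by (auto elim!: red_AppE red_elims)
  next
    case (red_App s'')
    with \<open>\<And>u'. red s u' \<Longrightarrow> s' = u'\<close> show ?thesis by auto
  qed
qed

text \<open>The head symbol decides which rule applies, because \<open>red\<close> only contracts
  \<open>CK\<close> and \<open>CS\<close> at the head. In the oracle case the argument function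
  itself is determined, by the induction hypothesis at every numeral.\<close>

lemma ev_det: "ev A G t n \<Longrightarrow> ev A G t n' \<Longrightarrow> n = n'"
proof (induction arbitrary: n' rule: ev.induct)
  case (ev_red t t' n)
  from ev_red.prems obtain t'' where "red t t''" "ev A G t'' n'"
    using ev_red.hyps(1)
    by (cases rule: ev.cases) (auto elim!: red_AppE red_elims)
  then show ?case using ev_red red_det by blast
next
  case ev_Zero
  then show ?case by (cases rule: ev.cases) (auto elim!: red_elims)
next
  case (ev_Succ t n)
  from ev_Succ.prems show ?case
    by (cases rule: ev.cases) (auto elim!: red_AppE red_elims dest: ev_Succ.IH)
next
  case (ev_Rec_0 x y n z)
  from ev_Rec_0.prems show ?case
    by (cases rule: ev.cases) (auto elim!: red_AppE red_elims dest: ev_Rec_0.IH)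
next
  case (ev_Rec_Suc x m z y n)
  from ev_Rec_Suc.prems show ?case
    by (cases rule: ev.cases) (auto elim!: red_AppE red_elims dest: ev_Rec_Suc.IH)
next
  case (ev_Fun t n f)
  from ev_Fun.prems show ?case
    by (cases rule: ev.cases) (auto elim!: red_AppE red_elims dest: ev_Fun.IH)
next
  case (ev_Orc t f i)
  from ev_Orc.prems show ?case
  proof (cases rule: ev.cases)
    case (ev_Orc g)
    then have "f = g" using ev_Orc.IH by blast
    then show ?thesis using ev_Orc by simp
  qed (auto elim!: red_AppE red_elims)
qed

lemma ev_mono:
  assumes "ev A G t n" "A \<subseteq> A'" "\<And>i f. f \<in> A \<Longrightarrow> G' i f = G i f"
  shows "ev A' G' t n"
  using assms(1)
proof induction
  case (ev_Orc t f i)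
  then show ?case using assms(2,3) ev.ev_Orc[of A' G' t f i] by auto
qed (auto intro: ev.intros)

lemma has_ty_mono: "has_ty A t \<sigma> \<Longrightarrow> A \<subseteq> A' \<Longrightarrow> has_ty A' t \<sigma>"
  by (induction rule: has_ty.induct) (auto intro: has_ty.intros)

lemma has_ty_num: "has_ty A (num n) N"
  by (induction n) (auto intro: has_ty.intros)

lemma has_ty_set_cm: "has_ty A t \<sigma> \<Longrightarrow> set_cm t \<subseteq> A"
  by (induction rule: has_ty.induct) auto

text \<open>A term mentions only finitely many functions, so a term over the union of an increasing
  chain of sets is already a term over one of them.\<close>

lemma has_ty_restrict: "has_ty A t \<sigma> \<Longrightarrow> set_cm t \<subseteq> B \<Longrightarrow> has_ty B t \<sigma>"
  by (induction rule: has_ty.induct) (auto intro: has_ty.intros)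

lemma finite_set_cm: "finite (set_cm t)"
  by (induction t) auto

text \<open>The type \<open>fn cm\<close> is uncountable, but the terms over \<open>A\<close> are
  images of terms of the countable type \<open>nat cm\<close> under an enumeration of
  \<open>A\<close>.\<close>

lemma countable_has_ty:
  assumes "countable A"
  shows "countable {t. has_ty A t \<sigma>}"
proof -
  have "{t. has_ty A t \<sigma>} \<subseteq> range (map_cm (from_nat_into A))"
  proof
    fix t assume "t \<in> {t. has_ty A t \<sigma>}"
    then have "set_cm t \<subseteq> A" using has_ty_set_cm by auto
    then have "map_cm (\<lambda>x. from_nat_into A (to_nat_on A x)) t = map_cm (\<lambda>x. x) t"
      by (intro cm.map_cong) (auto intro: from_nat_into_to_nat_on assms)
    then show "t \<in> range (map_cm (from_nat_into A))"
      by (metis (no_types, lifting) cm.map_comp cm.map_ident comp_apply cm.map_cong rangeI)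
  qed
  then show ?thesis by (rule countable_subset) simp
qed

section \<open>Frames and the logical relation on families of terms\<close>

definition pr :: "nat \<Rightarrow> nat \<Rightarrow> nat" where "pr x y = prod_encode (x, y)"
definition pfst :: "nat \<Rightarrow> nat" where "pfst n = fst (prod_decode n)"
definition psnd :: "nat \<Rightarrow> nat" where "psnd n = snd (prod_decode n)"

lemma pr_simps [simp]: "pfst (pr x y) = x" "psnd (pr x y) = y" "pr (pfst n) (psnd n) = n"
  by (simp_all add: pr_def pfst_def psnd_def)

lemma pr_inject [simp]: "pr x y = pr x' y' \<longleftrightarrow> x = x' \<and> y = y'"
  by (simp add: pr_def)

abbreviation col :: "fn \<Rightarrow> nat \<Rightarrow> fn" where "col f n \<equiv> \<lambda>m. f (pr n m)"

text \<open>Each closure condition is consumed by the induction for \<open>rel_refl\<close>. In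
  \<open>A_rec\<close> the initial value, the step and the bound may all depend on the index
  \<open>n\<close>, and in \<open>A_orc\<close> the argument of the oracle may, because terms are
  treated in families.\<close>

locale frame =
  fixes A :: "fn set" and G :: orcs
  assumes A_id: "(\<lambda>n. n) \<in> A"
    and A_const: "(\<lambda>_. c) \<in> A"
    and A_Suc: "Suc \<in> A"
    and A_fst: "pfst \<in> A"
    and A_snd: "psnd \<in> A"
    and A_pair: "f \<in> A \<Longrightarrow> g \<in> A \<Longrightarrow> (\<lambda>n. pr (f n) (g n)) \<in> A"
    and A_comp: "f \<in> A \<Longrightarrow> g \<in> A \<Longrightarrow> (\<lambda>n. f (g n)) \<in> A"
    and A_rec: "f \<in> A \<Longrightarrow> g \<in> A \<Longrightarrow> h \<in> A \<Longrightarrow>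
      (\<lambda>n. rec_nat (f n) (\<lambda>m a. g (pr n (pr a m))) (h n)) \<in> A"
    and A_orc: "f \<in> A \<Longrightarrow> (\<lambda>n. G i (col f n)) \<in> A"
begin

abbreviation D :: "ty \<Rightarrow> fn cm set" where "D \<sigma> \<equiv> {t. has_ty A t \<sigma>}"
abbreviation "E \<equiv> ev A G"

lemma A_col: "f \<in> A \<Longrightarrow> col f n \<in> A"
  by (rule A_comp[of f "\<lambda>m. pr n m"]) (auto intro: A_pair A_const A_id)

lemma ev_num: "E (num n) n"
  by (induction n) (auto intro: ev.intros)

text \<open>Families indexed by numbers take the role of terms with a free number variable: relatedness of
  a family at type \<open>N\<close> includes that its value, as a function of the index, belongs to \<open>A\<close>.\<close>

primrec rel :: "ty \<Rightarrow> (nat \<Rightarrow> fn cm) \<Rightarrow> (nat \<Rightarrow> fn cm) \<Rightarrow> bool" where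
  "rel N T T' = (\<exists>f\<in>A. \<forall>n. E (T n) (f n) \<and> E (T' n) (f n))"
| "rel (\<sigma> \<rightarrow> \<tau>) T T' = (\<forall>r\<in>A. \<forall>S S'. (\<forall>n. S n \<in> D \<sigma> \<and> S' n \<in> D \<sigma>) \<longrightarrow> rel \<sigma> S S' \<longrightarrow>
     rel \<tau> (\<lambda>n. T (r n) \<bullet> S n) (\<lambda>n. T' (r n) \<bullet> S' n))"

lemma relI:
  assumes "\<And>r S S'. r \<in> A \<Longrightarrow> (\<And>n. S n \<in> D \<sigma>) \<Longrightarrow> (\<And>n. S' n \<in> D \<sigma>) \<Longrightarrow> rel \<sigma> S S' \<Longrightarrow>
    rel \<tau> (\<lambda>n. T (r n) \<bullet> S n) (\<lambda>n. T' (r n) \<bullet> S' n)"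
  shows "rel (\<sigma> \<rightarrow> \<tau>) T T'"
  unfolding rel.simps by (intro ballI allI impI assms) simp_all

lemma relD:
  assumes "rel (\<sigma> \<rightarrow> \<tau>) T T'" "r \<in> A" "\<And>n. S n \<in> D \<sigma>" "\<And>n. S' n \<in> D \<sigma>" "rel \<sigma> S S'"
  shows "rel \<tau> (\<lambda>n. T (r n) \<bullet> S n) (\<lambda>n. T' (r n) \<bullet> S' n)"
  by (rule assms(1)[unfolded rel.simps, rule_format]) (use assms in auto)

declare rel.simps(2) [simp del]

text \<open>The reindexing \<open>r\<close> in the clause for function types builds this closure in,
  as in a Kripke logical relation. It is needed when a function is applied to an argument that
  depends on a finer index than the function does.\<close>

lemma rel_reindex: "rel \<sigma> T T' \<Longrightarrow> r \<in> A \<Longrightarrow> rel \<sigma> (\<lambda>n. T (r n)) (\<lambda>n. T' (r n))"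
proof (cases \<sigma>)
  case N
  assume "rel \<sigma> T T'" "r \<in> A"
  then obtain f where "f \<in> A" "\<forall>n. E (T n) (f n) \<and> E (T' n) (f n)" using N by auto
  then show ?thesis using N A_comp[of f r] \<open>r \<in> A\<close> by (auto intro!: bexI[of _ "\<lambda>n. f (r n)"])
next
  case (Fn \<sigma>1 \<sigma>2)
  assume *: "rel \<sigma> T T'" "r \<in> A"
  show ?thesis unfolding Fn
  proof (rule relI)
    fix r' S S' assume "r' \<in> A" "\<And>n. S n \<in> D \<sigma>1" "\<And>n. S' n \<in> D \<sigma>1" "rel \<sigma>1 S S'"
    then show "rel \<sigma>2 (\<lambda>n. T (r (r' n)) \<bullet> S n) (\<lambda>n. T' (r (r' n)) \<bullet> S' n)"
      using relD[OF *(1)[unfolded Fn] A_comp[OF \<open>r \<in> A\<close> \<open>r' \<in> A\<close>]] by blast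
  qed
qed

lemma rel_red: "rel \<sigma> U U' \<Longrightarrow> (\<And>n. red (T n) (U n)) \<Longrightarrow> (\<And>n. red (T' n) (U' n)) \<Longrightarrow> rel \<sigma> T T'"
proof (induction \<sigma> arbitrary: T T' U U')
  case N
  then show ?case by (meson ev_red rel.simps(1))
next
  case (Fn \<sigma> \<tau>)
  show ?case
  proof (rule relI)
    fix r S S' assume "r \<in> A" "\<And>n. S n \<in> D \<sigma>" "\<And>n. S' n \<in> D \<sigma>" "rel \<sigma> S S'"
    then have "rel \<tau> (\<lambda>n. U (r n) \<bullet> S n) (\<lambda>n. U' (r n) \<bullet> S' n)" by (rule relD[OF Fn.prems(1)])
    then show "rel \<tau> (\<lambda>n. T (r n) \<bullet> S n) (\<lambda>n. T' (r n) \<bullet> S' n)"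
      by (rule Fn.IH(2)) (auto intro: red_App Fn.prems)
  qed
qed

lemma rel_sym: "rel \<sigma> T T' \<Longrightarrow> rel \<sigma> T' T"
proof (induction \<sigma> arbitrary: T T')
  case N
  then show ?case by auto
next
  case (Fn \<sigma> \<tau>)
  show ?case
  proof (rule relI)
    fix r S S' assume *: "r \<in> A" "\<And>n. S n \<in> D \<sigma>" "\<And>n. S' n \<in> D \<sigma>" "rel \<sigma> S S'"
    have "rel \<tau> (\<lambda>n. T (r n) \<bullet> S' n) (\<lambda>n. T' (r n) \<bullet> S n)"
      by (rule relD[OF Fn.prems *(1,3,2) Fn.IH(1)[OF *(4)]])
    then show "rel \<tau> (\<lambda>n. T' (r n) \<bullet> S n) (\<lambda>n. T (r n) \<bullet> S' n)" by (rule Fn.IH(2))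
  qed
qed

lemma rel_trans: "rel \<sigma> T U \<Longrightarrow> rel \<sigma> U V \<Longrightarrow> rel \<sigma> T V"
proof (induction \<sigma> arbitrary: T U V)
  case N
  then obtain f g where fg: "f \<in> A" "\<forall>n. E (T n) (f n) \<and> E (U n) (f n)"
    "g \<in> A" "\<forall>n. E (U n) (g n) \<and> E (V n) (g n)" by auto
  then have "f n = g n" for n using ev_det by blast
  then show ?case using fg by (auto intro!: bexI[of _ f])
next
  case (Fn \<sigma> \<tau>)
  show ?case
  proof (rule relI)
    fix r S S' assume *: "r \<in> A" "\<And>n. S n \<in> D \<sigma>" "\<And>n. S' n \<in> D \<sigma>" "rel \<sigma> S S'"
    \<comment> \<open>Relatedness to anything implies relatedness to oneself, so both hypotheses can
      be met at the middle term \<open>U (r n) \<bullet> S n\<close>.\<close>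
    have S: "rel \<sigma> S S" by (rule Fn.IH(1)[OF *(4) rel_sym[OF *(4)]])
    have "rel \<tau> (\<lambda>n. T (r n) \<bullet> S n) (\<lambda>n. U (r n) \<bullet> S n)"
      by (rule relD[OF Fn.prems(1) *(1,2,2) S])
    moreover have "rel \<tau> (\<lambda>n. U (r n) \<bullet> S n) (\<lambda>n. V (r n) \<bullet> S' n)"
      by (rule relD[OF Fn.prems(2) *])
    ultimately show "rel \<tau> (\<lambda>n. T (r n) \<bullet> S n) (\<lambda>n. V (r n) \<bullet> S' n)" by (rule Fn.IH(2))
  qed
qed

lemma rel_num: "f \<in> A \<Longrightarrow> rel N (\<lambda>n. num (f n)) (\<lambda>n. num (f n))"
  unfolding rel.simps by (intro bexI[of _ f]) (simp_all add: ev_num)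

lemma rel_app:
  "rel (\<sigma> \<rightarrow> \<tau>) T T' \<Longrightarrow> rel \<sigma> S S' \<Longrightarrow> (\<And>n. S n \<in> D \<sigma>) \<Longrightarrow> (\<And>n. S' n \<in> D \<sigma>) \<Longrightarrow>
   rel \<tau> (\<lambda>n. T n \<bullet> S n) (\<lambda>n. T' n \<bullet> S' n)"
  by (rule relD[OF _ A_id])

text \<open>The number argument is absorbed into the index: the clause for function types is used
  with reindexing \<open>pfst\<close> and the family of numerals of \<open>psnd\<close>.\<close>

lemma rel_type1:
  assumes "rel (N \<rightarrow> \<sigma>) T T'"
  shows "rel \<sigma> (\<lambda>p. T (pfst p) \<bullet> num (psnd p)) (\<lambda>p. T' (pfst p) \<bullet> num (psnd p))"
  by (rule relD[OF assms A_fst _ _ rel_num[OF A_snd]]) (simp_all add: has_ty_num)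

text \<open>A family of type 1 objects is thus given by a single member of \<open>A\<close>, whose
  \<open>n\<close>-th column is the \<open>n\<close>-th object. This is the form in which
  \<open>A_orc\<close> takes its argument.\<close>

lemma rel_N1:
  assumes "rel N1 T T'"
  obtains f where "f \<in> A" "\<And>n m. E (T n \<bullet> num m) (f (pr n m))" "\<And>n m. E (T' n \<bullet> num m) (f (pr n m))"
proof -
  obtain f where "f \<in> A" and f: "\<And>p. E (T (pfst p) \<bullet> num (psnd p)) (f p)"
    "\<And>p. E (T' (pfst p) \<bullet> num (psnd p)) (f p)"
    using rel_type1[OF assms] by auto
  show thesis using that[OF \<open>f \<in> A\<close>] f[of "pr _ _"] by simp
qed

text \<open>The evaluation rule hands the unevaluated recursive call to the step function. Since
  \<open>Z\<close> is related to itself, the call may be replaced by the numeral of its value; then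
  all values come from one \<open>rec_nat\<close> whose data lie in \<open>A\<close>.\<close>

lemma rel_Rec: "rel (N \<rightarrow> N \<rightarrow> (N \<rightarrow> N \<rightarrow> N) \<rightarrow> N) (\<lambda>_. CRec) (\<lambda>_. CRec)"
proof -
  have main: "\<exists>f\<in>A. \<forall>n. E (CRec \<bullet> X n \<bullet> Y n \<bullet> Z n) (f n) \<and> E (CRec \<bullet> X' n \<bullet> Y' n \<bullet> Z' n) (f n)"
    if X: "\<And>n. X n \<in> D N" "\<And>n. X' n \<in> D N" "rel N X X'"
      and Y: "\<And>n. Y n \<in> D N" "\<And>n. Y' n \<in> D N" "rel N Y Y'"
      and Z: "\<And>n. Z n \<in> D (N \<rightarrow> N \<rightarrow> N)" "\<And>n. Z' n \<in> D (N \<rightarrow> N \<rightarrow> N)" "rel (N \<rightarrow> N \<rightarrow> N) Z Z'"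
    for X X' Y Y' Z Z'
  proof -
    from X obtain x where x: "x \<in> A" "\<And>n. E (X n) (x n)" "\<And>n. E (X' n) (x n)" by auto
    from Y obtain y where y: "y \<in> A" "\<And>n. E (Y n) (y n)" "\<And>n. E (Y' n) (y n)" by auto
    from rel_type1[OF Z(3)] have "rel N1 (\<lambda>p. Z (pfst p) \<bullet> num (psnd p)) (\<lambda>p. Z' (pfst p) \<bullet> num (psnd p))" .
    then obtain g where g: "g \<in> A"
      "\<And>p m. E (Z (pfst p) \<bullet> num (psnd p) \<bullet> num m) (g (pr p m))"
      "\<And>p m. E (Z' (pfst p) \<bullet> num (psnd p) \<bullet> num m) (g (pr p m))" by (rule rel_N1) (rule that, auto)
    \<comment> \<open>\<open>g\<close> reads its arguments as \<open>pr (pr n a) m\<close>, whereas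
      \<open>A_rec\<close> supplies them as \<open>pr n (pr a m)\<close>.\<close>
    define g' where "g' = (\<lambda>q. g (pr (pr (pfst q) (pfst (psnd q))) (psnd (psnd q))))"
    have "g' \<in> A" unfolding g'_def
      by (intro A_comp[OF g(1)] A_pair A_fst A_comp[OF A_fst A_snd] A_comp[OF A_snd A_snd])
    define f where "f = (\<lambda>n. rec_nat (y n) (\<lambda>m a. g' (pr n (pr a m))) (x n))"
    have "f \<in> A" unfolding f_def by (rule A_rec[OF y(1) \<open>g' \<in> A\<close> x(1)])
    have step: "E (CRec \<bullet> num m \<bullet> YY n \<bullet> ZZ n) (rec_nat (y n) (\<lambda>m a. g' (pr n (pr a m))) m)"
      if YY: "\<And>n. YY n \<in> D N" "\<And>n. E (YY n) (y n)"
        and ZZ: "\<And>n. ZZ n \<in> D (N \<rightarrow> N \<rightarrow> N)" "rel (N \<rightarrow> N \<rightarrow> N) ZZ ZZ"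
        "\<And>p m. E (ZZ (pfst p) \<bullet> num (psnd p) \<bullet> num m) (g (pr p m))" for YY ZZ n m
    proof (induction m)
      case 0
      then show ?case using YY by (auto intro: ev.intros)
    next
      case (Suc m)
      define h where "h = rec_nat (y n) (\<lambda>m a. g' (pr n (pr a m))) m"
      have "rel N (\<lambda>_. CRec \<bullet> num m \<bullet> YY n \<bullet> ZZ n) (\<lambda>_. num h)"
        using Suc.IH by (auto simp: h_def ev_num intro: A_const)
      moreover have "rel (N \<rightarrow> N \<rightarrow> N) (\<lambda>_. ZZ n) (\<lambda>_. ZZ n)"
        using rel_reindex[OF ZZ(2), of "\<lambda>_. n"] A_const by simp
      moreover have "has_ty A (CRec \<bullet> num m \<bullet> YY n \<bullet> ZZ n) N"
        by (rule has_ty_App[OF has_ty_App[OF has_ty_App[OF has_ty_Rec has_ty_num]]])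
          (use YY(1) ZZ(1) in auto)
      ultimately have "rel N1 (\<lambda>_. ZZ n \<bullet> (CRec \<bullet> num m \<bullet> YY n \<bullet> ZZ n)) (\<lambda>_. ZZ n \<bullet> num h)"
        by (intro rel_app) (auto simp: has_ty_num)
      then obtain k where "k \<in> A" and k: "\<And>n' m'. E (ZZ n \<bullet> (CRec \<bullet> num m \<bullet> YY n \<bullet> ZZ n) \<bullet> num m') (k (pr n' m'))"
        "\<And>n' m'. E (ZZ n \<bullet> num h \<bullet> num m') (k (pr n' m'))" by (rule rel_N1) (rule that, auto)
      have "E (ZZ n \<bullet> num h \<bullet> num m) (g (pr (pr n h) m))" using ZZ(3)[of "pr n h" m] by simp
      then have "k (pr 0 m) = g (pr (pr n h) m)" using k(2) ev_det by blast
      then have "E (ZZ n \<bullet> (CRec \<bullet> num m \<bullet> YY n \<bullet> ZZ n) \<bullet> num m) (g (pr (pr n h) m))"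
        using k(1)[of m 0] by simp
      then have "E (CRec \<bullet> num (Suc m) \<bullet> YY n \<bullet> ZZ n) (g (pr (pr n h) m))"
        by (rule ev_Rec_Suc[OF ev_num])
      then show ?case by (simp add: h_def g'_def)
    qed
    \<comment> \<open>Passage from numerals to arbitrary first arguments: the evaluation at the
      numeral is inverted to recover the premise of \<open>ev_Rec_Suc\<close>, which then applies to
      \<open>XX n\<close> itself.\<close>
    have step': "E (CRec \<bullet> XX n \<bullet> YY n \<bullet> ZZ n) (f n)"
      if "\<And>n. E (XX n) (x n)" "\<And>n m. E (CRec \<bullet> num m \<bullet> YY n \<bullet> ZZ n) (rec_nat (y n) (\<lambda>m a. g' (pr n (pr a m))) m)"
        "\<And>n. E (YY n) (y n)"
      for XX YY ZZ n
    proof (cases "x n")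
      case 0
      then show ?thesis using that(1)[of n] that(3)[of n] ev_Rec_0[of A G "XX n" "YY n" "y n"]
        by (simp add: f_def)
    next
      case (Suc m)
      have "E (CRec \<bullet> num (Suc m) \<bullet> YY n \<bullet> ZZ n) (f n)" using that(2)[where m = "Suc m" and n = n] Suc by (simp add: f_def)
      then have "E (ZZ n \<bullet> (CRec \<bullet> num m \<bullet> YY n \<bullet> ZZ n) \<bullet> num m) (f n)"
      proof (cases rule: ev.cases)
        case (ev_Rec_0 )
        then show ?thesis using ev_det[OF _ ev_num[of "Suc m"]] by auto
      next
        case (ev_Rec_Suc m')
        then have "m' = m" using ev_det[OF _ ev_num[of "Suc m"]] by auto
        then show ?thesis using ev_Rec_Suc by simp
      qed (auto elim!: red_AppE red_elims)
      then show ?thesis using ev_Rec_Suc that(1)[of n] Suc by auto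
    qed
    have ZZ: "rel (N \<rightarrow> N \<rightarrow> N) Z Z" "rel (N \<rightarrow> N \<rightarrow> N) Z' Z'"
      using Z(3) rel_sym rel_trans by blast+
    have "E (CRec \<bullet> X n \<bullet> Y n \<bullet> Z n) (f n)" for n
      by (rule step'[of X Y Z n, OF x(2) step[of Y Z, OF Y(1) y(2) Z(1) ZZ(1) g(2)] y(2)])
    moreover have "E (CRec \<bullet> X' n \<bullet> Y' n \<bullet> Z' n) (f n)" for n
      by (rule step'[of X' Y' Z' n, OF x(3) step[of Y' Z', OF Y(2) y(3) Z(2) ZZ(2) g(3)] y(3)])
    ultimately show ?thesis using \<open>f \<in> A\<close> by auto
  qed
  show ?thesis
  proof (intro relI)
    fix r1 X X' r2 Y Y' r3 Z Z'
    assume r: "r1 \<in> A" "r2 \<in> A" "r3 \<in> A"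
      and X: "\<And>n. X n \<in> D N" "\<And>n. X' n \<in> D N" "rel N X X'"
      and Y: "\<And>n. Y n \<in> D N" "\<And>n. Y' n \<in> D N" "rel N Y Y'"
      and Z: "\<And>n. Z n \<in> D (N \<rightarrow> N \<rightarrow> N)" "\<And>n. Z' n \<in> D (N \<rightarrow> N \<rightarrow> N)" "rel (N \<rightarrow> N \<rightarrow> N) Z Z'"
    have "rel N (\<lambda>n. X (r2 (r3 n))) (\<lambda>n. X' (r2 (r3 n)))" "rel N (\<lambda>n. Y (r3 n)) (\<lambda>n. Y' (r3 n))"
      using rel_reindex[OF X(3) A_comp[OF r(2,3)]] rel_reindex[OF Y(3) r(3)] by blast+
    from main[OF X(1,2) this(1) Y(1,2) this(2) Z]
    show "rel N (\<lambda>n. CRec \<bullet> X (r2 (r3 n)) \<bullet> Y (r3 n) \<bullet> Z n)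
        (\<lambda>n. CRec \<bullet> X' (r2 (r3 n)) \<bullet> Y' (r3 n) \<bullet> Z' n)" by simp
  qed
qed

text \<open>The fundamental lemma of the logical relation, for a term seen as a constant family. At
  type \<open>N\<close> it yields termination (\<open>ev_val\<close>), at type 1 membership in
  \<open>A\<close> (\<open>fnv_in_A\<close>), and at function types extensionality
  (\<open>eqd_app\<close>).\<close>

lemma rel_refl: "has_ty A t \<sigma> \<Longrightarrow> rel \<sigma> (\<lambda>_. t) (\<lambda>_. t)"
proof (induction rule: has_ty.induct)
  case has_ty_Zero
  show ?case using A_const[of 0] by (auto intro!: bexI[of _ "\<lambda>_. 0"] ev_Zero)
next
  case has_ty_Succ
  show ?case
  proof (rule relI)
    fix r S S' assume "rel N S S'"
    then obtain f where "f \<in> A" "\<And>n. E (S n) (f n)" "\<And>n. E (S' n) (f n)" by auto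
    then show "rel N (\<lambda>n. CSucc \<bullet> S n) (\<lambda>n. CSucc \<bullet> S' n)"
      using A_comp[OF A_Suc] ev_Succ unfolding rel.simps(1) by (intro bexI[of _ "\<lambda>n. Suc (f n)"]) auto
  qed
next
  case (has_ty_K \<sigma> \<tau>)
  show ?case
  proof (intro relI)
    fix r X X' r' Y Y'
    assume "rel \<sigma> X X'" "r' \<in> A"
    from rel_reindex[OF this] show "rel \<sigma> (\<lambda>n. CK \<sigma> \<tau> \<bullet> X (r' n) \<bullet> Y n) (\<lambda>n. CK \<sigma> \<tau> \<bullet> X' (r' n) \<bullet> Y' n)"
      by (rule rel_red) (rule red_K)+
  qed
next
  case (has_ty_S \<rho> \<sigma> \<tau>)
  show ?case
  proof (rule relI, rule relI, rule relI)
    fix r X X' r' Y Y' r'' Z Z'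
    assume X: "rel (\<rho> \<rightarrow> \<sigma> \<rightarrow> \<tau>) X X'" and Y: "rel (\<rho> \<rightarrow> \<sigma>) Y Y'"
      and DY: "\<And>n. Y n \<in> D (\<rho> \<rightarrow> \<sigma>)" "\<And>n. Y' n \<in> D (\<rho> \<rightarrow> \<sigma>)"
      and r: "r' \<in> A" "r'' \<in> A"
      and Z: "\<And>n. Z n \<in> D \<rho>" "\<And>n. Z' n \<in> D \<rho>" "rel \<rho> Z Z'"
    have "rel \<tau> (\<lambda>n. X (r' (r'' n)) \<bullet> Z n \<bullet> (Y (r'' n) \<bullet> Z n))
        (\<lambda>n. X' (r' (r'' n)) \<bullet> Z' n \<bullet> (Y' (r'' n) \<bullet> Z' n))"
      by (rule rel_app[OF relD[OF X A_comp[OF r] Z] relD[OF Y r(2) Z]])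
        (simp_all, (rule has_ty_App[OF DY(1)[simplified] Z(1)[simplified]]
           has_ty_App[OF DY(2)[simplified] Z(2)[simplified]])+)
    then show "rel \<tau> (\<lambda>n. CS \<rho> \<sigma> \<tau> \<bullet> X (r' (r'' n)) \<bullet> Y (r'' n) \<bullet> Z n)
        (\<lambda>n. CS \<rho> \<sigma> \<tau> \<bullet> X' (r' (r'' n)) \<bullet> Y' (r'' n) \<bullet> Z' n)"
      by (rule rel_red) (rule red_S)+
  qed
next
  case has_ty_Rec
  show ?case by (rule rel_Rec)
next
  case (has_ty_Orc i)
  show ?case
  proof (rule relI)
    fix r T T' assume "rel N1 T T'"
    then obtain f where f: "f \<in> A" "\<And>n m. E (T n \<bullet> num m) (f (pr n m))"
      "\<And>n m. E (T' n \<bullet> num m) (f (pr n m))"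
      by (rule rel_N1) (rule that, auto)
    then show "rel N (\<lambda>n. COrc i \<bullet> T n) (\<lambda>n. COrc i \<bullet> T' n)"
      unfolding rel.simps(1) by (intro bexI[OF _ A_orc[OF f(1), of i]] allI conjI ev_Orc A_col)
  qed
next
  case (has_ty_Fun f)
  show ?case
  proof (rule relI)
    fix r S S' assume "rel N S S'"
    then obtain g where "g \<in> A" "\<And>n. E (S n) (g n)" "\<And>n. E (S' n) (g n)" by auto
    then show "rel N (\<lambda>n. CFun f \<bullet> S n) (\<lambda>n. CFun f \<bullet> S' n)"
      using A_comp[OF has_ty_Fun] ev_Fun unfolding rel.simps(1) by (intro bexI[of _ "\<lambda>n. f (g n)"]) auto
  qed
next
  case (has_ty_App s \<sigma> \<tau> t)
  show ?case by (rule rel_app[OF has_ty_App.IH]) (use has_ty_App in auto)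
qed

section \<open>Values and extensional equality of terms\<close>

definition val :: "fn cm \<Rightarrow> nat" where "val t = (THE n. E t n)"

lemma val_eq: "E t n \<Longrightarrow> val t = n"
  unfolding val_def using ev_det by blast

lemma ev_val: "t \<in> D N \<Longrightarrow> E t (val t)"
  using rel_refl[of t N] val_eq[of t] by (metis mem_Collect_eq rel.simps(1))

primrec eqd :: "ty \<Rightarrow> fn cm \<Rightarrow> fn cm \<Rightarrow> bool" where
  "eqd N t u = (val t = val u)"
| "eqd (\<sigma> \<rightarrow> \<tau>) t u = (\<forall>x\<in>D \<sigma>. eqd \<tau> (t \<bullet> x) (u \<bullet> x))"

lemma eqd_refl [simp, intro]: "eqd \<sigma> t t"
  by (induction \<sigma> arbitrary: t) auto

lemma eqd_trans [trans]: "eqd \<sigma> t u \<Longrightarrow> eqd \<sigma> u w \<Longrightarrow> eqd \<sigma> t w"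
  by (induction \<sigma> arbitrary: t u w) (simp, simp, blast)

lemma rel_imp_eqd: "rel \<sigma> T U \<Longrightarrow> eqd \<sigma> (T n) (U n)"
proof (induction \<sigma> arbitrary: T U)
  case N
  then show ?case by (metis eqd.simps(1) rel.simps(1) val_eq)
next
  case (Fn \<sigma> \<tau>)
  show ?case unfolding eqd.simps
  proof
    fix x assume "x \<in> D \<sigma>"
    then have "rel \<tau> (\<lambda>n. T n \<bullet> x) (\<lambda>n. U n \<bullet> x)"
      using rel_app[OF Fn.prems rel_refl[of x \<sigma>]] by simp
    then show "eqd \<tau> (T n \<bullet> x) (U n \<bullet> x)" by (rule Fn.IH(2))
  qed
qed

text \<open>Together with \<open>rel_imp_eqd\<close> this identifies \<open>rel\<close> with
  pointwise extensional equality on self-related families. Self-relatedness of a function thereby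
  becomes respect for \<open>eqd\<close>.\<close>

lemma eqd_imp_rel: "rel \<sigma> T T \<Longrightarrow> rel \<sigma> U U \<Longrightarrow> (\<And>n. eqd \<sigma> (T n) (U n)) \<Longrightarrow> rel \<sigma> T U"
proof (induction \<sigma> arbitrary: T U)
  case N
  then obtain f g where fg: "f \<in> A" "\<forall>n. E (T n) (f n)" "\<forall>n. E (U n) (g n)" by auto
  then have "f n = g n" for n using N.prems(3)[of n] val_eq by (metis eqd.simps(1))
  then show ?case using fg by (auto intro!: bexI[of _ f])
next
  case (Fn \<sigma> \<tau>)
  show ?case
  proof (rule relI)
    fix r S S' assume *: "r \<in> A" "\<And>n. S n \<in> D \<sigma>" "\<And>n. S' n \<in> D \<sigma>" "rel \<sigma> S S'"
    have S: "rel \<sigma> S S" "rel \<sigma> S' S'"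
      using rel_trans[OF *(4) rel_sym[OF *(4)]] rel_trans[OF rel_sym[OF *(4)] *(4)] by simp_all
    show "rel \<tau> (\<lambda>n. T (r n) \<bullet> S n) (\<lambda>n. U (r n) \<bullet> S' n)"
    proof (rule Fn.IH(2))
      show "rel \<tau> (\<lambda>n. T (r n) \<bullet> S n) (\<lambda>n. T (r n) \<bullet> S n)" by (rule relD[OF Fn.prems(1) *(1,2,2) S(1)])
      show "rel \<tau> (\<lambda>n. U (r n) \<bullet> S' n) (\<lambda>n. U (r n) \<bullet> S' n)" by (rule relD[OF Fn.prems(2) *(1,3,3) S(2)])
      fix n
      have "rel \<tau> (\<lambda>n. T (r n) \<bullet> S n) (\<lambda>n. T (r n) \<bullet> S' n)" by (rule relD[OF Fn.prems(1) *])
      then have "eqd \<tau> (T (r n) \<bullet> S n) (T (r n) \<bullet> S' n)" by (rule rel_imp_eqd)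
      also have "eqd \<tau> (T (r n) \<bullet> S' n) (U (r n) \<bullet> S' n)" using Fn.prems(3)[of "r n"] * by simp
      finally show "eqd \<tau> (T (r n) \<bullet> S n) (U (r n) \<bullet> S' n)" .
    qed
  qed
qed

lemma eqd_app:
  assumes "F \<in> D (\<sigma> \<rightarrow> \<tau>)" "x \<in> D \<sigma>" "y \<in> D \<sigma>" "eqd \<sigma> x y"
  shows "eqd \<tau> (F \<bullet> x) (F \<bullet> y)"
proof -
  have "rel \<sigma> (\<lambda>_. x) (\<lambda>_. y)"
    by (rule eqd_imp_rel[OF rel_refl rel_refl]) (use assms in simp_all)
  from rel_app[OF rel_refl this] have "rel \<tau> (\<lambda>_. F \<bullet> x) (\<lambda>_. F \<bullet> y)"
    using assms by simp
  then show ?thesis by (rule rel_imp_eqd)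
qed

lemma eqd_cong:
  assumes "eqd (\<sigma> \<rightarrow> \<tau>) F F'" "F \<in> D (\<sigma> \<rightarrow> \<tau>)" "eqd \<sigma> x y" "x \<in> D \<sigma>" "y \<in> D \<sigma>"
  shows "eqd \<tau> (F \<bullet> x) (F' \<bullet> y)"
  using eqd_app[OF assms(2,4,5,3)] eqd_trans assms(1,5) by auto

lemma val_red: "red t u \<Longrightarrow> val t = val u"
proof -
  assume "red t u"
  then have "E t n \<longleftrightarrow> E u n" for n
  proof (intro iffI)
    assume "E t n"
    then show "E u n" using \<open>red t u\<close>
      by (cases rule: ev.cases) (auto elim!: red_AppE red_elims dest: red_det)
  qed (rule ev_red)
  then have "E t = E u" by blast
  then show ?thesis unfolding val_def by simp
qed

lemma eqd_red: "red t u \<Longrightarrow> eqd \<sigma> t u"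
proof (induction \<sigma> arbitrary: t u)
  case (Fn \<sigma> \<tau>)
  show ?case unfolding eqd.simps by (intro ballI Fn.IH(2) red_App Fn.prems)
qed (simp add: val_red)

definition fnv :: "fn cm \<Rightarrow> fn" where "fnv t n = val (t \<bullet> num n)"

lemma val_num [simp]: "val (num n) = n"
  by (rule val_eq[OF ev_num])

lemma val_Zero [simp]: "val CZero = 0"
  using val_num[of 0] by simp

lemma num_in_D [simp]: "num n \<in> D N" "has_ty A (num n) N"
  by (auto simp: has_ty_num)

lemma val_app: "t \<in> D N1 \<Longrightarrow> u \<in> D N \<Longrightarrow> val (t \<bullet> u) = fnv t (val u)"
  using eqd_app[of t N N u "num (val u)"] by (auto simp: fnv_def)

lemma val_Succ: "t \<in> D N \<Longrightarrow> val (CSucc \<bullet> t) = Suc (val t)"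
  by (rule val_eq[OF ev_Succ[OF ev_val]])

lemma fnv_in_A: "t \<in> D N1 \<Longrightarrow> fnv t \<in> A"
proof -
  assume "t \<in> D N1"
  then obtain f where f: "f \<in> A" "\<And>n m. E (t \<bullet> num m) (f (pr n m))"
    using rel_N1[OF rel_refl[of t N1]] by auto
  then have "fnv t = (\<lambda>m. f (pr 0 m))" unfolding fnv_def using val_eq by blast
  then show ?thesis using A_col[OF f(1)] by simp
qed

lemma fnv_Fun [simp]: "fnv (CFun f) = f"
  unfolding fnv_def by (auto intro: val_eq ev.intros ev_num)

lemma Fun_in_D: "f \<in> A \<Longrightarrow> CFun f \<in> D N1" by (auto intro: has_ty.intros)

lemma eqd_Fun_fnv: "t \<in> D N1 \<Longrightarrow> eqd N1 t (CFun (fnv t))"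
  using fnv_in_A Fun_in_D by (simp add: val_app)

lemma val_Orc: "t \<in> D N1 \<Longrightarrow> val (COrc i \<bullet> t) = G i (fnv t)"
proof (rule val_eq, rule ev_Orc)
  assume t: "t \<in> D N1"
  show "E (t \<bullet> num n) (fnv t n)" for n
    unfolding fnv_def by (rule ev_val) (use t in \<open>auto intro: has_ty_App\<close>)
  show "fnv t \<in> A" using t by (rule fnv_in_A)
qed

lemma val_Rec:
  assumes "x \<in> D N" "y \<in> D N" "z \<in> D (N \<rightarrow> N \<rightarrow> N)"
  shows "val (CRec \<bullet> x \<bullet> y \<bullet> z) = rec_nat (val y) (\<lambda>m a. val (z \<bullet> num a \<bullet> num m)) (val x)"
proof -
  have R: "has_ty A (CRec \<bullet> num m \<bullet> y \<bullet> z) N" for m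
    by (rule has_ty_App[OF has_ty_App[OF has_ty_App[OF has_ty_Rec has_ty_num]]]) (use assms in auto)
  have num: "val (CRec \<bullet> num m \<bullet> y \<bullet> z) = rec_nat (val y) (\<lambda>m a. val (z \<bullet> num a \<bullet> num m)) m" for m
  proof (induction m)
    case 0
    show ?case using ev_Rec_0[OF ev_num[of 0] ev_val[OF assms(2)]] val_eq by auto
  next
    case (Suc m)
    have "has_ty A (z \<bullet> (CRec \<bullet> num m \<bullet> y \<bullet> z) \<bullet> num m) N"
      by (rule has_ty_App[OF has_ty_App[OF _ R] has_ty_num]) (use assms in auto)
    then have "val (CRec \<bullet> num (Suc m) \<bullet> y \<bullet> z) = val (z \<bullet> (CRec \<bullet> num m \<bullet> y \<bullet> z) \<bullet> num m)"
      using ev_Rec_Suc[OF ev_num[of "Suc m"] ev_val] val_eq by auto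
    moreover have "eqd N1 (z \<bullet> (CRec \<bullet> num m \<bullet> y \<bullet> z)) (z \<bullet> num (val (CRec \<bullet> num m \<bullet> y \<bullet> z)))"
      by (rule eqd_app) (use assms R in auto)
    ultimately show ?case using Suc by auto
  qed
  have "eqd (N \<rightarrow> (N \<rightarrow> N \<rightarrow> N) \<rightarrow> N) (CRec \<bullet> x) (CRec \<bullet> num (val x))"
    by (rule eqd_app[OF _ assms(1)]) (use assms has_ty_Rec in auto)
  then have "val (CRec \<bullet> x \<bullet> y \<bullet> z) = val (CRec \<bullet> num (val x) \<bullet> y \<bullet> z)" using assms by simp
  then show ?thesis using num by simp
qed

end

section \<open>Semantics of formulas in the term model\<close>

type_synonym asg = "nat \<times> ty \<Rightarrow> fn cm"

primrec den :: "asg \<Rightarrow> tm \<Rightarrow> fn cm" where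
  "den s (Var i \<tau>) = s (i, \<tau>)"
| "den s Zero = CZero"
| "den s Succ = CSucc"
| "den s (CombK \<sigma> \<tau>) = CK \<sigma> \<tau>"
| "den s (CombS \<rho> \<sigma> \<tau>) = CS \<rho> \<sigma> \<tau>"
| "den s Rec = CRec"
| "den s (t \<cdot> u) = den s t \<bullet> den s u"

declare den.simps(7) [simp del]
declare lam.simps [simp del]

lemma den_cong: "(\<And>x. x \<in> vars t \<Longrightarrow> s x = s' x) \<Longrightarrow> den s t = den s' t"
  by (induction t) (auto simp: den.simps(7))

lemma den_upd: "x \<notin> vars t \<Longrightarrow> den (s(x := y)) t = den s t"
  by (rule den_cong) auto

lemma den_subst: "den s (subst_tm i \<sigma> u t) = den (s((i, \<sigma>) := den s u)) t"
  by (induction t) (auto simp: den.simps(7))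

lemma subst_tm_id: "(i, \<sigma>) \<notin> vars t \<Longrightarrow> subst_tm i \<sigma> u t = t"
  by (induction t) auto

lemma subst_id: "(i, \<sigma>) \<notin> fv \<phi> \<Longrightarrow> subst i \<sigma> u \<phi> = \<phi>"
proof (induction \<phi>)
  case (All j \<tau> \<phi>)
  show ?case
  proof (cases "i = j \<and> \<sigma> = \<tau>")
    case False
    then have "(i, \<sigma>) \<notin> fv \<phi>" using All.prems by auto
    from All.IH[OF this] show ?thesis by simp
  qed simp
qed (simp_all add: subst_tm_id)

lemma qfree_free_for: "qfree \<phi> \<Longrightarrow> free_for u i \<sigma> \<phi>"
  by (induction \<phi>) auto

lemma well_typed_AppE:
  assumes "well_typed (t \<cdot> u)"
  obtains \<tau> where "well_typed t" "well_typed u" "typ_of t = typ_of u \<rightarrow> \<tau>" "typ_of (t \<cdot> u) = \<tau>"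
proof -
  note * = assms[THEN well_typed.simps(7)[THEN iffD1]]
  show thesis
    by (rule that[OF *[THEN conjunct1] *[THEN conjunct2, THEN conjunct1]
          *[THEN conjunct2, THEN conjunct2] typ_of.simps(7)])
qed

lemma typ_lam:
  "well_typed t \<Longrightarrow> well_typed (lam i \<sigma> t) \<and> typ_of (lam i \<sigma> t) = \<sigma> \<rightarrow> typ_of t"
proof (induction t)
  case (App t u)
  from App.prems obtain \<tau> where t: "well_typed t" "well_typed u" "typ_of t = typ_of u \<rightarrow> \<tau>"
    by (rule well_typed_AppE)
  show ?case using App.IH(1)[OF t(1)] App.IH(2)[OF t(2)] t by (simp add: lam.simps)
qed (simp_all add: lam.simps)

lemma well_typed_lam [simp]: "well_typed t \<Longrightarrow> well_typed (lam i \<sigma> t)"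
  and typ_of_lam [simp]: "well_typed t \<Longrightarrow> typ_of (lam i \<sigma> t) = \<sigma> \<rightarrow> typ_of t"
  using typ_lam by auto

lemma vars_lam [simp]: "vars (lam i \<sigma> t) = vars t - {(i, \<sigma>)}"
  by (induction t) (auto simp: lam.simps)

context frame
begin

definition proper :: "asg \<Rightarrow> bool" where
  "proper s \<longleftrightarrow> (\<forall>i \<tau>. has_ty A (s (i, \<tau>)) \<tau>)"

lemma properD: "proper s \<Longrightarrow> has_ty A (s (i, \<tau>)) \<tau>"
  by (simp add: proper_def)

lemma proper_upd [simp]: "proper s \<Longrightarrow> has_ty A x \<tau> \<Longrightarrow> proper (s((i, \<tau>) := x))"
  by (auto simp: proper_def)

lemma den_ty: "proper s \<Longrightarrow> well_typed t \<Longrightarrow> has_ty A (den s t) (typ_of t)"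
proof (induction t)
  case (App t u)
  from App.prems(2) obtain \<tau> where t: "well_typed t" "well_typed u" "typ_of t = typ_of u \<rightarrow> \<tau>"
    by (rule well_typed_AppE)
  show ?case
    using has_ty_App[of A "den s t" "typ_of u" \<tau>] App.IH(1)[OF App.prems(1) t(1)]
      App.IH(2)[OF App.prems(1) t(2)] t(3) by (simp add: den.simps(7))
qed (auto intro: has_ty.intros simp: proper_def)

lemma den_ty' [simp]: "proper s \<Longrightarrow> well_typed t \<Longrightarrow> typ_of t = \<tau> \<Longrightarrow> has_ty A (den s t) \<tau>"
  using den_ty by blast

primrec holds :: "asg \<Rightarrow> fm \<Rightarrow> bool" where
  "holds s (Eq t u) = (val (den s t) = val (den s u))"
| "holds s Bot = False"
| "holds s (Imp \<phi> \<psi>) = (holds s \<phi> \<longrightarrow> holds s \<psi>)"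
| "holds s (All i \<tau> \<phi>) = (\<forall>x. has_ty A x \<tau> \<longrightarrow> holds (s((i, \<tau>) := x)) \<phi>)"

lemma holds_cong: "(\<And>x. x \<in> fv \<phi> \<Longrightarrow> s x = s' x) \<Longrightarrow> holds s \<phi> = holds s' \<phi>"
proof (induction \<phi> arbitrary: s s')
  case (Eq t u)
  then show ?case using den_cong[of t s s'] den_cong[of u s s'] by simp
next
  case (Imp \<phi> \<psi>)
  then show ?case by (metis UnCI fv.simps(3) holds.simps(3))
next
  case (All i \<tau> \<phi>)
  have "holds (s((i, \<tau>) := x)) \<phi> = holds (s'((i, \<tau>) := x)) \<phi>" for x
    by (rule All.IH) (use All.prems in auto)
  then show ?case by simp
qed simp

lemma holds_subst:
  "free_for u i \<sigma> \<phi> \<Longrightarrow> holds s (subst i \<sigma> u \<phi>) = holds (s((i, \<sigma>) := den s u)) \<phi>"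
proof (induction \<phi> arbitrary: s)
  case (All j \<tau> \<phi>)
  show ?case
  proof (cases "(i, \<sigma>) = (j, \<tau>)")
    case False
    show ?thesis
    proof (cases "(i, \<sigma>) \<in> fv \<phi>")
      case True
      then have u: "(j, \<tau>) \<notin> vars u" "free_for u i \<sigma> \<phi>" using All.prems False by auto
      have "holds (s((j, \<tau>) := x)) (subst i \<sigma> u \<phi>) = holds (s((i, \<sigma>) := den s u, (j, \<tau>) := x)) \<phi>" for x
        using All.IH[OF u(2), of "s((j, \<tau>) := x)"] den_upd[OF u(1), of s x]
          fun_upd_twist[OF False, of s "den s u" x] by (simp only:)
      moreover have "subst i \<sigma> u (All j \<tau> \<phi>) = All j \<tau> (subst i \<sigma> u \<phi>)" using False by auto
      ultimately show ?thesis by (simp only: holds.simps(4))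
    next
      case notin: False
      then have "subst i \<sigma> u (All j \<tau> \<phi>) = All j \<tau> \<phi>" by (simp add: subst_id)
      moreover have "holds (s((i, \<sigma>) := den s u)) (All j \<tau> \<phi>) = holds s (All j \<tau> \<phi>)"
        by (rule holds_cong) (use notin in auto)
      ultimately show ?thesis by (simp only:)
    qed
  next
    case True
    have "holds s (All j \<tau> \<phi>) = holds (s((i, \<sigma>) := den s u)) (All j \<tau> \<phi>)"
      by (rule holds_cong) (use True in auto)
    moreover have "subst i \<sigma> u (All j \<tau> \<phi>) = All j \<tau> \<phi>" using True by simp
    ultimately show ?thesis by (simp only:)
  qed
qed (auto simp: den_subst)

definition valid :: "fm \<Rightarrow> bool" where
  "valid \<phi> \<longleftrightarrow> (\<forall>s. proper s \<longrightarrow> holds s \<phi>)"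

lemma soundness: "T \<turnstile> \<phi> \<Longrightarrow> (\<And>\<psi>. \<psi> \<in> T \<Longrightarrow> valid \<psi>) \<Longrightarrow> valid \<phi>"
proof (induction rule: derivable.induct)
  case (inst \<phi> t \<tau> i)
  then show ?case by (auto simp: valid_def holds_subst)
next
  case (all_distrib \<phi> \<psi> i \<tau>)
  then have "holds (s((i, \<tau>) := x)) \<phi> = holds s \<phi>" for s x by (intro holds_cong) auto
  then show ?case by (auto simp: valid_def)
qed (auto simp: valid_def)

lemma den_eqd:
  assumes "\<And>i \<tau>. eqd \<tau> (s (i, \<tau>)) (s' (i, \<tau>))" "proper s" "proper s'"
  shows "well_typed t \<Longrightarrow> eqd (typ_of t) (den s t) (den s' t)"
proof (induction t)
  case (App t u)
  from App.prems obtain \<tau> where t: "well_typed t" "well_typed u" "typ_of t = typ_of u \<rightarrow> \<tau>"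
    by (rule well_typed_AppE)
  have "eqd \<tau> (den s t \<bullet> den s u) (den s' t \<bullet> den s' u)"
    by (rule eqd_cong[OF App.IH(1)[OF t(1), unfolded t(3)] _ App.IH(2)[OF t(2)]])
      (use t assms(2,3) den_ty in \<open>simp_all del: eqd.simps\<close>)
  then show ?case using t(3) by (simp add: den.simps(7))
qed (auto simp del: eqd.simps simp: assms(1))

text \<open>This allows objects of type \<open>N\<close> to be replaced by numerals and objects of
  type 1 by constants \<open>CFun f\<close> with \<open>f\<close> in \<open>A\<close>, so
  quantifiers of these types can be read as quantifiers over numbers and over
  \<open>A\<close>.\<close>

lemma holds_eqd:
  assumes "\<And>i \<tau>. eqd \<tau> (s (i, \<tau>)) (s' (i, \<tau>))" "proper s" "proper s'" "wf_fm \<phi>"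
  shows "holds s \<phi> = holds s' \<phi>"
  using assms
proof (induction \<phi> arbitrary: s s')
  case (Eq t u)
  from Eq den_eqd[of s s' t] den_eqd[of s s' u] show ?case by simp
next
  case (Imp \<phi> \<psi>)
  then show ?case by (metis holds.simps(3) wf_fm.simps(3))
next
  case (All i \<tau> \<phi>)
  have "holds (s((i, \<tau>) := x)) \<phi> = holds (s'((i, \<tau>) := x)) \<phi>" if "has_ty A x \<tau>" for x
    using All.prems(4)
    by (intro All.IH[OF _ proper_upd[OF All.prems(2) that] proper_upd[OF All.prems(3) that]])
      (auto simp: All.prems(1))
  then show ?case by simp
qed simp

lemma holds_num:
  assumes "proper s" "wf_fm \<phi>" "has_ty A x N"
  shows "holds (s((i, N) := x)) \<phi> = holds (s((i, N) := num (val x))) \<phi>"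
  by (rule holds_eqd) (use assms in auto)

lemma holds_Fun:
  assumes "proper s" "wf_fm \<phi>" "has_ty A x N1"
  shows "holds (s((i, N1) := x)) \<phi> = holds (s((i, N1) := CFun (fnv x))) \<phi>"
  by (rule holds_eqd) (use assms eqd_Fun_fnv[of x] Fun_in_D[OF fnv_in_A[of x]] in auto)

text \<open>The combinators reproduce the body only up to \<open>eqd\<close>: in the application
  case function and argument are replaced simultaneously, which rests on extensionality.\<close>

lemma den_lam:
  assumes "proper s" "well_typed t" "has_ty A x \<sigma>"
  shows "eqd (typ_of t) (den s (lam i \<sigma> t) \<bullet> x) (den (s((i, \<sigma>) := x)) t)"
  using assms(2)
proof (induction t)
  case (Var j \<tau>)
  show ?case
  proof (cases "i = j \<and> \<sigma> = \<tau>")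
    case True
    have "eqd \<tau> (CS \<tau> (\<tau> \<rightarrow> \<tau>) \<tau> \<bullet> CK \<tau> (\<tau> \<rightarrow> \<tau>) \<bullet> CK \<tau> \<tau> \<bullet> x) (CK \<tau> (\<tau> \<rightarrow> \<tau>) \<bullet> x \<bullet> (CK \<tau> \<tau> \<bullet> x))"
      by (rule eqd_red[OF red_S])
    also have "eqd \<tau> \<dots> x" by (rule eqd_red[OF red_K])
    finally show ?thesis using True by (simp add: lam.simps den.simps(7))
  next
    case False
    then show ?thesis by (auto simp: lam.simps den.simps(7) intro: eqd_red red_K)
  qed
next
  case (App t u)
  from App.prems obtain \<tau> where tu: "well_typed t" "well_typed u" and t: "typ_of t = typ_of u \<rightarrow> \<tau>"
    by (rule well_typed_AppE)
  note IH = App.IH(1)[OF tu(1)] App.IH(2)[OF tu(2)]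
  show ?case
  proof (cases "(i, \<sigma>) \<in> vars (t \<cdot> u)")
    case True
    let ?s = "s((i, \<sigma>) := x)"
    have "eqd \<tau> (den s (lam i \<sigma> (t \<cdot> u)) \<bullet> x) (den s (lam i \<sigma> t) \<bullet> x \<bullet> (den s (lam i \<sigma> u) \<bullet> x))"
      using True t by (auto simp: lam.simps den.simps(7) intro: eqd_red red_S)
    also have "eqd \<tau> \<dots> (den ?s t \<bullet> den ?s u)"
    proof (rule eqd_cong)
      show "eqd (typ_of u \<rightarrow> \<tau>) (den s (lam i \<sigma> t) \<bullet> x) (den ?s t)" by (rule IH(1)[unfolded t])
      show "eqd (typ_of u) (den s (lam i \<sigma> u) \<bullet> x) (den ?s u)" by (rule IH(2))
      show "den s (lam i \<sigma> t) \<bullet> x \<in> D (typ_of u \<rightarrow> \<tau>)" "den s (lam i \<sigma> u) \<bullet> x \<in> D (typ_of u)"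
        using has_ty_App[of A "den s (lam i \<sigma> t)" \<sigma> "typ_of u \<rightarrow> \<tau>" x]
          has_ty_App[of A "den s (lam i \<sigma> u)" \<sigma> "typ_of u" x] assms(1,3) t tu by simp_all
      show "den ?s u \<in> D (typ_of u)" using assms(1,3) tu by simp
    qed
    finally show ?thesis by (simp only: t den.simps(7) typ_of.simps cod.simps)
  next
    case False
    then have "den (s((i, \<sigma>) := x)) (t \<cdot> u) = den s (t \<cdot> u)" by (rule den_upd)
    moreover have "den s (lam i \<sigma> (t \<cdot> u)) \<bullet> x = CK (typ_of (t \<cdot> u)) \<sigma> \<bullet> den s (t \<cdot> u) \<bullet> x"
      using False by (simp add: lam.simps den.simps(7))
    ultimately show ?thesis by (simp only:) (rule eqd_red[OF red_K])
  qed
qed (auto simp: lam.simps den.simps(7) simp del: eqd.simps intro: eqd_red red_K)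

lemma lam_app:
  "proper s \<Longrightarrow> well_typed t \<Longrightarrow> well_typed a \<Longrightarrow> typ_of a = \<sigma> \<Longrightarrow>
   eqd (typ_of t) (den s (lam i \<sigma> t \<cdot> a)) (den (s((i, \<sigma>) := den s a)) t)"
  using den_lam[of s t "den s a"] by (simp add: den.simps(7))

lemma val_lam1 [simp]:
  assumes "proper s" "well_typed t" "typ_of t = N" "well_typed a" "typ_of a = \<sigma>"
  shows "val (den s (lam i \<sigma> t \<cdot> a)) = val (den (s((i, \<sigma>) := den s a)) t)"
  using lam_app[OF assms(1,2,4,5)] assms(3) by simp

lemma val_lam2 [simp]:
  assumes "proper s" "well_typed t" "typ_of t = N" "well_typed a" "typ_of a = \<sigma>"
    "well_typed b" "typ_of b = \<tau>"
  shows "val (den s (lam i \<sigma> (lam j \<tau> t) \<cdot> a \<cdot> b)) =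
    val (den (s((i, \<sigma>) := den s a, (j, \<tau>) := den s b)) t)"
proof -
  let ?s = "s((i, \<sigma>) := den s a)"
  have "eqd (\<tau> \<rightarrow> N) (den s (lam i \<sigma> (lam j \<tau> t) \<cdot> a)) (den ?s (lam j \<tau> t))"
    using lam_app[of s "lam j \<tau> t" a \<sigma> i] assms by simp
  then have "val (den s (lam i \<sigma> (lam j \<tau> t) \<cdot> a \<cdot> b)) = val (den ?s (lam j \<tau> t) \<bullet> den s b)"
    using assms by (auto simp: den.simps(7))
  also have "\<dots> = val (den (?s((j, \<tau>) := den s b)) t)"
    using den_lam[of ?s t "den s b" \<tau> j] assms by simp
  finally show ?thesis .
qed

lemma fnv_lam [simp]:
  assumes "proper s" "well_typed t" "typ_of t = N"
  shows "fnv (den s (lam i N t)) n = val (den (s((i, N) := num n)) t)"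
  using den_lam[of s t "num n" N i] assms by (simp add: fnv_def)

lemma val_App [simp]:
  assumes "proper s" "well_typed u" "typ_of u = N"
  shows "val (den s (Var i N1 \<cdot> u)) = fnv (s (i, N1)) (val (den s u))"
    and "val (den s (Succ \<cdot> u)) = Suc (val (den s u))"
  using assms by (auto simp: den.simps(7) val_app val_Succ properD)

lemma val_App':
  assumes "proper s" "well_typed u" "typ_of u = N" "well_typed t" "typ_of t = N1"
  shows "val (den s (t \<cdot> u)) = fnv (den s t) (val (den s u))"
  using assms by (auto simp: den.simps(7) val_app)

lemma val_App2:
  assumes "has_ty A z (N \<rightarrow> N \<rightarrow> N)" "has_ty A a N" "has_ty A b N"
  shows "val (z \<bullet> a \<bullet> b) = val (z \<bullet> num (val a) \<bullet> num (val b))"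
proof -
  have "eqd N1 (z \<bullet> a) (z \<bullet> num (val a))" by (rule eqd_app) (use assms in auto)
  moreover have "eqd N (z \<bullet> num (val a) \<bullet> b) (z \<bullet> num (val a) \<bullet> num (val b))"
    by (rule eqd_app) (use assms in \<open>auto intro!: has_ty_App[of _ _ N]\<close>)
  ultimately show ?thesis using assms(3) by simp
qed

lemma val_Rec1:
  assumes "proper s" "well_typed x" "typ_of x = N" "well_typed y" "typ_of y = N"
    "well_typed z" "typ_of z = N \<rightarrow> N \<rightarrow> N"
  shows "val (den s (Rec \<cdot> x \<cdot> y \<cdot> z)) =
    rec_nat (val (den s y)) (\<lambda>m a. val (den s z \<bullet> num a \<bullet> num m)) (val (den s x))"
  using assms by (auto simp: den.simps(7) val_Rec)

lemma val_Rec2 [simp]: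
  assumes "proper s" "well_typed x" "typ_of x = N" "well_typed y" "typ_of y = N"
    "well_typed t" "typ_of t = N"
  shows "val (den s (Rec \<cdot> x \<cdot> y \<cdot> lam i N (lam j N t))) =
    rec_nat (val (den s y)) (\<lambda>m a. val (den (s((i, N) := num a, (j, N) := num m)) t)) (val (den s x))"
proof -
  have "val (den s (lam i N (lam j N t)) \<bullet> num a \<bullet> num m) =
      val (den (s((i, N) := num a, (j, N) := num m)) t)" for a m
  proof -
    let ?s = "s((i, N) := num a)"
    have "eqd (N \<rightarrow> N) (den s (lam i N (lam j N t)) \<bullet> num a) (den ?s (lam j N t))"
      using den_lam[of s "lam j N t" "num a" N i] assms by simp
    moreover have "eqd N (den ?s (lam j N t) \<bullet> num m) (den (?s((j, N) := num m)) t)"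
      using den_lam[of ?s t "num m" N j] assms by simp
    ultimately show ?thesis by simp
  qed
  then show ?thesis using val_Rec1[of s x y "lam i N (lam j N t)"] assms by simp
qed

end

section \<open>Values of the primitive recursive terms\<close>

lemma rec_nat_plus: "rec_nat x (\<lambda>m. Suc) n = x + n"
  by (induction n) auto
lemma rec_nat_times: "rec_nat 0 (\<lambda>m a. a + x) n = x * n"
  by (induction n) auto
lemma rec_nat_pred: "rec_nat 0 (\<lambda>m a. m) n = n - 1"
  by (cases n) auto
lemma rec_nat_monus: "rec_nat x (\<lambda>m a. a - Suc 0) n = x - n"
  by (induction n) auto
lemma rec_nat_pow2: "rec_nat (Suc 0) (\<lambda>m a. a + a) n = 2 ^ n"
  by (induction n) auto
lemma rec_nat_sum: "rec_nat 0 (\<lambda>m a. a + f m) n = sum f {..<n}"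
  by (induction n) auto

text \<open>Cantor pairing in the language adds its second argument to the triangular number,
  \<open>prod_encode\<close> its first. Hence the arguments are exchanged in the value of every
  \<open>pair\<close>, and \<open>fst_tm\<close> computes \<open>psnd\<close>; this also explains
  the order of the components in \<open>rat_val\<close>.\<close>

lemma triangle_pair_eq: "sum Suc {..<x + y} + y = pr y x"
proof -
  have "sum Suc {..<n} = triangle n" for n by (induction n) auto
  then show ?thesis by (simp add: pr_def prod_encode_def add.commute)
qed

context frame
begin

lemma types_plus [simp]: "well_typed plus_tm" "typ_of plus_tm = N \<rightarrow> N \<rightarrow> N" "vars plus_tm = {}"
  by (auto simp: plus_tm_def)

lemma val_plus [simp]:
  assumes "proper s" "well_typed a" "typ_of a = N" "well_typed b" "typ_of b = N"
  shows "val (den s (a \<oplus> b)) = val (den s a) + val (den s b)"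
  unfolding plus_tm_def using assms by (simp add: rec_nat_plus)

lemma types_times [simp]: "well_typed times_tm" "typ_of times_tm = N \<rightarrow> N \<rightarrow> N" "vars times_tm = {}"
  by (auto simp: times_tm_def)

lemma val_times [simp]:
  assumes "proper s" "well_typed a" "typ_of a = N" "well_typed b" "typ_of b = N"
  shows "val (den s (a \<otimes> b)) = val (den s a) * val (den s b)"
  unfolding times_tm_def using assms by (simp add: rec_nat_times)

lemma types_pred [simp]: "well_typed pred_tm" "typ_of pred_tm = N1" "vars pred_tm = {}"
  by (auto simp: pred_tm_def)

lemma val_pred [simp]:
  assumes "proper s" "well_typed a" "typ_of a = N"
  shows "val (den s (pred_tm \<cdot> a)) = val (den s a) - Suc 0"
  unfolding pred_tm_def using assms by (simp add: rec_nat_pred)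

lemma types_monus [simp]: "well_typed monus_tm" "typ_of monus_tm = N \<rightarrow> N \<rightarrow> N" "vars monus_tm = {}"
  by (auto simp: monus_tm_def)

lemma val_monus [simp]:
  assumes "proper s" "well_typed a" "typ_of a = N" "well_typed b" "typ_of b = N"
  shows "val (den s (a \<ominus> b)) = val (den s a) - val (den s b)"
  unfolding monus_tm_def using assms by (simp add: rec_nat_monus)

lemma types_pow2 [simp]: "well_typed pow2_tm" "typ_of pow2_tm = N1" "vars pow2_tm = {}"
  by (auto simp: pow2_tm_def)

lemma val_pow2 [simp]:
  assumes "proper s" "well_typed a" "typ_of a = N"
  shows "val (den s (pow2_tm \<cdot> a)) = 2 ^ val (den s a)"
  unfolding pow2_tm_def using assms by (simp add: rec_nat_pow2)

lemma types_sum [simp]: "well_typed sum_tm" "typ_of sum_tm = N1 \<rightarrow> N \<rightarrow> N" "vars sum_tm = {}"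
  by (auto simp: sum_tm_def)

lemma val_sum [simp]:
  assumes "proper s" "well_typed a" "typ_of a = N1" "well_typed b" "typ_of b = N"
  shows "val (den s (sum_tm \<cdot> a \<cdot> b)) = sum (fnv (den s a)) {..<val (den s b)}"
  unfolding sum_tm_def using assms by (simp add: rec_nat_sum)

lemma fnv_Succ [simp]: "fnv CSucc = Suc"
  by (auto simp: fnv_def val_Succ)

lemma types_pair [simp]: "well_typed pair_tm" "typ_of pair_tm = N \<rightarrow> N \<rightarrow> N" "vars pair_tm = {}"
  by (auto simp: pair_tm_def)

lemma val_pair [simp]:
  assumes "proper s" "well_typed a" "typ_of a = N" "well_typed b" "typ_of b = N"
  shows "val (den s (pair a b)) = pr (val (den s b)) (val (den s a))"
  unfolding pair_tm_def using assms by (simp add: triangle_pair_eq)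

lemma types_eqchar [simp]: "well_typed eqchar_tm" "typ_of eqchar_tm = N \<rightarrow> N \<rightarrow> N" "vars eqchar_tm = {}"
  by (auto simp: eqchar_tm_def)

lemma val_eqchar [simp]:
  assumes "proper s" "well_typed a" "typ_of a = N" "well_typed b" "typ_of b = N"
  shows "val (den s (eqchar_tm \<cdot> a \<cdot> b)) = of_bool (val (den s a) = val (den s b))"
  unfolding eqchar_tm_def using assms by simp

lemma types_fst [simp]: "well_typed fst_tm" "typ_of fst_tm = N1" "vars fst_tm = {}"
  and types_snd [simp]: "well_typed snd_tm" "typ_of snd_tm = N1" "vars snd_tm = {}"
  by (auto simp: fst_tm_def snd_tm_def)

end

lemma pfst_le: "pfst n \<le> n" and psnd_le: "psnd n \<le> n"
  by (metis le_prod_encode_1 le_prod_encode_2 pr_def pr_simps(3))+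

text \<open>Exactly one pair has code \<open>n\<close>, and its components are at most
  \<open>n\<close>, so the double sum ranges over it and all other summands vanish.\<close>

lemma sum_pair_search:
  fixes f :: "nat \<Rightarrow> nat \<Rightarrow> nat"
  shows
  "(\<Sum>i<Suc n. \<Sum>j<Suc n. f i j * of_bool (pr j i = n)) = f (psnd n) (pfst n)"
proof -
  have "(\<Sum>j<Suc n. f i j * of_bool (pr j i = n)) = (if i = psnd n then f i (pfst n) else 0)" for i
  proof -
    have "pr j i = n \<longleftrightarrow> j = pfst n \<and> i = psnd n" for j
      by (metis pr_simps)
    then have "(\<Sum>j<Suc n. f i j * of_bool (pr j i = n)) =
        (\<Sum>j<Suc n. if j = pfst n then (if i = psnd n then f i (pfst n) else 0) else 0)"
      by (intro sum.cong) simp_all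
    also have "\<dots> = (if i = psnd n then f i (pfst n) else 0)"
      using pfst_le[of n] by (subst sum.delta) (auto simp: less_Suc_eq_le)
    finally show ?thesis .
  qed
  then show ?thesis using psnd_le[of n] by (subst sum.cong[OF refl]) (auto simp: less_Suc_eq_le)
qed

context frame
begin

lemma val_fst [simp]:
  assumes "proper s" "well_typed a" "typ_of a = N"
  shows "val (den s (fst_tm \<cdot> a)) = psnd (val (den s a))"
  unfolding fst_tm_def using assms sum_pair_search[of "\<lambda>i j. i"] by simp

lemma val_snd [simp]:
  assumes "proper s" "well_typed a" "typ_of a = N"
  shows "val (den s (snd_tm \<cdot> a)) = pfst (val (den s a))"
  unfolding snd_tm_def using assms sum_pair_search[of "\<lambda>i j. j"] by simp

lemma types_init [simp]: "well_typed init_tm" "typ_of init_tm = N1 \<rightarrow> N \<rightarrow> N" "vars init_tm = {}"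
  by (auto simp: init_tm_def)

end

definition init_seg :: "fn \<Rightarrow> nat \<Rightarrow> nat" where
  "init_seg g n = rec_nat 0 (\<lambda>m a. Suc (pr (g m) a)) n"

fun tuple_val :: "nat list \<Rightarrow> nat" where
  "tuple_val [] = 0"
| "tuple_val [t] = t"
| "tuple_val (t # u # us) = pr (tuple_val (u # us)) t"

context frame
begin

lemma val_init [simp]:
  assumes "proper s" "well_typed a" "typ_of a = N1" "well_typed b" "typ_of b = N"
  shows "val (den s (init_tm \<cdot> a \<cdot> b)) = init_seg (fnv (den s a)) (val (den s b))"
  unfolding init_tm_def init_seg_def using assms by simp

lemma types_tuple: "(\<And>t. t \<in> set ts \<Longrightarrow> well_typed t \<and> typ_of t = N) \<Longrightarrow>
    well_typed (tuple ts) \<and> typ_of (tuple ts) = N"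
  by (induction ts rule: tuple.induct) auto

lemma val_tuple: "proper s \<Longrightarrow> (\<And>t. t \<in> set ts \<Longrightarrow> well_typed t \<and> typ_of t = N) \<Longrightarrow>
    val (den s (tuple ts)) = tuple_val (map (\<lambda>t. val (den s t)) ts)"
proof (induction ts rule: tuple.induct)
  case (3 t u us)
  then show ?case using types_tuple[of "u # us"] by simp
qed auto

lemma holds_Less [simp]:
  assumes "proper s" "well_typed a" "typ_of a = N" "well_typed b" "typ_of b = N"
  shows "holds s (Less a b) \<longleftrightarrow> val (den s a) < val (den s b)"
  unfolding Less_def using assms by auto

end

section \<open>Validity of the axioms\<close>

definition rat_val :: "nat \<Rightarrow> real" where
  "rat_val c = (real (psnd (psnd c)) - real (pfst (psnd c))) / real (Suc (pfst c))"

definition real_code :: "fn \<Rightarrow> bool" where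
  "real_code f \<longleftrightarrow> (\<forall>n i. rat_val (f n) < rat_val (f (n + i)) + 1 / 2 ^ n \<and> rat_val (f (n + i)) < rat_val (f n) + 1 / 2 ^ n)"

definition real_eq :: "fn \<Rightarrow> fn \<Rightarrow> bool" where
  "real_eq f g \<longleftrightarrow> (\<forall>n. rat_val (f n) \<le> rat_val (g n) + 2 / 2 ^ n \<and> rat_val (g n) \<le> rat_val (f n) + 2 / 2 ^ n)"

definition real_less :: "fn \<Rightarrow> fn \<Rightarrow> bool" where
  "real_less f g \<longleftrightarrow> (\<exists>n. rat_val (f n) + 2 / 2 ^ n < rat_val (g n))"

text \<open>For a real code these are the codes of the rationals strictly below the real. The set
  depends only on the real and not on the Cauchy sequence, so a map that factors through
  \<open>cut\<close> respects equality of reals.\<close>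

definition cut :: "fn \<Rightarrow> nat set" where
  "cut f = {q. \<exists>m. rat_val q + 2 / 2 ^ m < rat_val (f m)}"

lemma rat_val_add: "rat_val (pr (Suc (pfst a) * Suc (pfst b) - Suc 0)
    (pr (pfst (psnd a) * Suc (pfst b) + pfst (psnd b) * Suc (pfst a))
      (psnd (psnd a) * Suc (pfst b) + psnd (psnd b) * Suc (pfst a)))) = rat_val a + rat_val b"
proof -
  have "Suc (Suc (pfst a) * Suc (pfst b) - Suc 0) = Suc (pfst a) * Suc (pfst b)" by simp
  then show ?thesis unfolding rat_val_def pr_simps
    by (simp only: of_nat_add of_nat_mult) (simp add: divide_simps, simp add: algebra_simps)
qed

lemma rat_val_less: "rat_val a < rat_val b \<longleftrightarrow>
  psnd (psnd a) * Suc (pfst b) + pfst (psnd b) * Suc (pfst a) <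
  psnd (psnd b) * Suc (pfst a) + pfst (psnd a) * Suc (pfst b)"
proof -
  have "rat_val a < rat_val b \<longleftrightarrow> real (psnd (psnd a) * Suc (pfst b) + pfst (psnd b) * Suc (pfst a)) <
      real (psnd (psnd b) * Suc (pfst a) + pfst (psnd a) * Suc (pfst b))"
    unfolding rat_val_def of_nat_add of_nat_mult by (simp add: divide_simps) (simp add: algebra_simps)
  then show ?thesis unfolding of_nat_less_iff .
qed

lemma rat_val_dyadic: "rat_val (pr (2 ^ n - Suc 0) (pr 0 c)) = c / 2 ^ n"
proof -
  have "Suc (2 ^ n - Suc 0) = 2 ^ n" by simp
  then show ?thesis unfolding rat_val_def pr_simps by simp
qed

lemma rat_val_surj: "r \<in> \<rat> \<Longrightarrow> \<exists>q. rat_val q = r"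
proof -
  assume "r \<in> \<rat>"
  then obtain a b where r: "r = of_int a / of_int b" "b > 0" by (rule Rats_cases')
  have "rat_val (pr (nat b - 1) (pr (nat (- a)) (nat a))) = r"
    using r by (cases "a \<ge> 0") (auto simp: rat_val_def of_nat_diff)
  then show ?thesis by blast
qed

lemma half_power_small: "(e::real) > 0 \<Longrightarrow> \<exists>m. c / 2 ^ m < e"
proof -
  assume "e > 0"
  have "(\<lambda>m. c * (1 / 2) ^ m) \<longlonglongrightarrow> c * 0" by (intro tendsto_intros LIMSEQ_power_zero) auto
  then have "eventually (\<lambda>m. c * (1 / 2) ^ m < e) sequentially"
    using \<open>e > 0\<close> by (auto intro: order_tendstoD)
  then obtain m where "c * (1 / 2) ^ m < e" by (auto simp: eventually_sequentially)
  then show ?thesis by (auto simp: power_divide field_simps intro!: exI[of _ m])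
qed

lemma real_code_limit:
  assumes "real_code f"
  obtains L where "\<And>n. \<bar>rat_val (f n) - L\<bar> \<le> 1 / 2 ^ n"
proof -
  have d: "\<bar>rat_val (f n) - rat_val (f m)\<bar> < 1 / 2 ^ n" if "n \<le> m" for n m
    using assms[unfolded real_code_def, rule_format, of n "m - n"] that by auto
  have "Cauchy (\<lambda>n. rat_val (f n))"
  proof (rule metric_CauchyI)
    fix e :: real assume "e > 0"
    then obtain M where M: "2 / 2 ^ M < e" using half_power_small by blast
    show "\<exists>M. \<forall>m\<ge>M. \<forall>n\<ge>M. dist (rat_val (f m)) (rat_val (f n)) < e"
    proof (intro exI[of _ M] allI impI)
      fix m n assume "m \<ge> M" "n \<ge> M"
      from d[OF this(1)] d[OF this(2)] M show "dist (rat_val (f m)) (rat_val (f n)) < e"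
        by (auto simp: dist_real_def)
    qed
  qed
  then obtain L where L: "(\<lambda>n. rat_val (f n)) \<longlonglongrightarrow> L"
    using Cauchy_convergent_iff convergent_def by blast
  have "\<bar>rat_val (f n) - L\<bar> \<le> 1 / 2 ^ n" for n
  proof (rule Lim_bounded[where M = n])
    show "(\<lambda>m. \<bar>rat_val (f n) - rat_val (f m)\<bar>) \<longlonglongrightarrow> \<bar>rat_val (f n) - L\<bar>" by (intro tendsto_intros L)
    show "\<forall>m\<ge>n. \<bar>rat_val (f n) - rat_val (f m)\<bar> \<le> 1 / 2 ^ n" using d less_imp_le by blast
  qed
  then show thesis by (rule that)
qed

text \<open>Both sides express that the limits of the two sequences coincide: the cut consists of
  the rationals below the limit, and the rationals are dense.\<close>

lemma cut_eq_iff: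
  assumes "real_code f" "real_code g"
  shows "cut f = cut g \<longleftrightarrow> real_eq f g"
proof -
  have cut: "cut f = {q. rat_val q < L}" if "\<And>n. \<bar>rat_val (f n) - L\<bar> \<le> 1 / 2 ^ n" for f L
  proof (intro equalityI subsetI)
    fix q assume "q \<in> cut f"
    then obtain m where "rat_val q + 2 / 2 ^ m < rat_val (f m)" by (auto simp: cut_def)
    moreover have "(0::real) < 1 / 2 ^ m" by simp
    ultimately show "q \<in> {q. rat_val q < L}" using that[of m] by (auto simp: abs_le_iff)
  next
    fix q assume "q \<in> {q. rat_val q < L}"
    \<comment> \<open>Of the three units, two are the margin in the definition of \<open>cut\<close>
      and one is the error of the approximation \<open>f m\<close>.\<close>
    then obtain m where "3 / 2 ^ m < L - rat_val q" using half_power_small[of "L - rat_val q" 3] by auto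
    moreover have "L - rat_val (f m) \<le> 1 / 2 ^ m" using that[of m] by auto
    ultimately have "rat_val q + 2 / 2 ^ m < rat_val (f m)" by (simp add: field_simps)
    then show "q \<in> cut f" by (auto simp: cut_def)
  qed
  obtain L where L: "\<And>n. \<bar>rat_val (f n) - L\<bar> \<le> 1 / 2 ^ n" using real_code_limit[OF assms(1)] by blast
  obtain M where M: "\<And>n. \<bar>rat_val (g n) - M\<bar> \<le> 1 / 2 ^ n" using real_code_limit[OF assms(2)] by blast
  have sep: "{q. rat_val q < x} \<noteq> {q. rat_val q < y}" if xy: "x < y" for x y
  proof -
    obtain r where "r \<in> \<rat>" "x < r" "r < y" using Rats_dense_in_real[OF xy] by blast
    then show ?thesis using rat_val_surj by force
  qed
  have "real_eq f g \<longleftrightarrow> L = M"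
  proof
    assume "L = M"
    show "real_eq f g" unfolding real_eq_def
    proof
      fix n show "rat_val (f n) \<le> rat_val (g n) + 2 / 2 ^ n \<and> rat_val (g n) \<le> rat_val (f n) + 2 / 2 ^ n"
        using L[of n] M[of n] \<open>L = M\<close> by (auto simp: abs_le_iff)
    qed
  next
    assume real_eq: "real_eq f g"
    show "L = M"
    proof (rule ccontr)
      assume "L \<noteq> M"
      \<comment> \<open>Two units are the tolerance in \<open>real_eq\<close>, and one more is the
        error of each approximation.\<close>
      then obtain n where n: "4 / 2 ^ n < \<bar>L - M\<bar>" using half_power_small[of "\<bar>L - M\<bar>" 4] by auto
      have "\<bar>rat_val (f n) - rat_val (g n)\<bar> \<le> 2 / 2 ^ n"
        using real_eq[unfolded real_eq_def, rule_format, of n] by (auto simp: abs_le_iff)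
      then have "\<bar>L - M\<bar> \<le> 2 / 2 ^ n + 1 / 2 ^ n + 1 / 2 ^ n" using L[of n] M[of n] by linarith
      then show False using n by (simp add: field_simps)
    qed
  qed
  then show ?thesis using cut[OF L] cut[OF M] sep[of L M] sep[of M L] by (metis linorder_neqE_linordered_idom)
qed

section \<open>Axioms of the base theory, choice and Suslin functionals\<close>

lemmas builder_defs = all_def ex_def peq_def pneg_def pand_def por_def pimp_def piff_def
  all_var_def ex_var_def mem_def pless_def

text \<open>The value 0 stands for truth. In the clause for implications the recursor acts as a case
  distinction: if the premise has value 0 it returns the value of the conclusion, and otherwise
  0.\<close>

primrec chi :: "fm \<Rightarrow> tm" where
  "chi (Eq s t) = (s \<ominus> t) \<oplus> (t \<ominus> s)"
| "chi Bot = Succ \<cdot> Zero"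
| "chi (Imp \<phi> \<psi>) = Rec \<cdot> chi \<phi> \<cdot> chi \<psi> \<cdot> lam 0 N (lam 1 N Zero)"
| "chi (All i \<tau> \<phi>) = Zero"

fun nf :: "fn set \<Rightarrow> bool \<Rightarrow> nat \<Rightarrow> fn \<Rightarrow> fn list \<Rightarrow> bool" where
  "nf A b 0 f gs = (if b then \<exists>n. f (tuple_val (map (\<lambda>g. init_seg g n) gs)) = 0
     else \<forall>n. f (tuple_val (map (\<lambda>g. init_seg g n) gs)) = 0)"
| "nf A b (Suc k) f gs = (if b then \<exists>g\<in>A. nf A False k f (gs @ [g])
     else \<forall>g\<in>A. nf A True k f (gs @ [g]))"

text \<open>Every type needs an inhabitant, so that proper assignments exist and a valid formula
  holds under at least one of them.\<close>

primrec dflt :: "ty \<Rightarrow> fn cm" where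
  "dflt N = CZero"
| "dflt (\<sigma> \<rightarrow> \<tau>) = CK \<tau> \<sigma> \<bullet> dflt \<tau>"

lemma has_ty_dflt: "has_ty A (dflt \<tau>) \<tau>"
  by (induction \<tau>) (auto intro: has_ty.intros)

context frame
begin

definition asg0 :: asg where "asg0 = (\<lambda>(i, \<tau>). dflt \<tau>)"

lemma proper_asg0: "proper asg0"
  by (simp add: proper_def asg0_def has_ty_dflt)

lemmas has_ty_consts [simp] = has_ty_Orc [of A] has_ty_Zero [of A] has_ty_Succ [of A] has_ty_K [of A] has_ty_Rec [of A]

lemma ball_D_N: "(\<forall>x. has_ty A x N \<longrightarrow> P (val x)) \<longleftrightarrow> (\<forall>n. P n)"
  by (metis num_in_D(2) val_num)

lemma bex_D_N: "(\<exists>x. has_ty A x N \<and> P (val x)) \<longleftrightarrow> (\<exists>n. P n)"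
  by (metis num_in_D(2) val_num)

lemma ball_D_N1: "(\<forall>x. has_ty A x N1 \<longrightarrow> P (fnv x)) \<longleftrightarrow> (\<forall>f\<in>A. P f)"
  using Fun_in_D fnv_in_A by (metis fnv_Fun mem_Collect_eq)

lemma bex_D_N1: "(\<exists>x. has_ty A x N1 \<and> P (fnv x)) \<longleftrightarrow> (\<exists>f\<in>A. P f)"
  using Fun_in_D fnv_in_A by (metis fnv_Fun mem_Collect_eq)

lemma holds_eq_at:
  assumes "proper s" "well_typed t" "typ_of t = \<sigma>" "well_typed u" "typ_of u = \<sigma>"
    "\<forall>x\<in>vars t. fst x < d" "\<forall>x\<in>vars u. fst x < d"
  shows "holds s (eq_at \<sigma> t u d) \<longleftrightarrow> eqd \<sigma> (den s t) (den s u)"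
  using assms
proof (induction \<sigma> arbitrary: s t u d)
  case N
  then show ?case by (simp add: peq_def)
next
  case (Fn \<sigma> \<tau>)
  have "holds (s((d, \<sigma>) := x)) (eq_at \<tau> (t \<cdot> Var d \<sigma>) (u \<cdot> Var d \<sigma>) (Suc d)) \<longleftrightarrow>
      eqd \<tau> (den s t \<bullet> x) (den s u \<bullet> x)" if x: "has_ty A x \<sigma>" for x
  proof -
    have "(d, \<sigma>) \<notin> vars t" "(d, \<sigma>) \<notin> vars u" using Fn.prems(6,7) by force+
    then have *: "den (s((d, \<sigma>) := x)) t = den s t" "den (s((d, \<sigma>) := x)) u = den s u"
      by (simp_all add: den_upd)
    have "holds (s((d, \<sigma>) := x)) (eq_at \<tau> (t \<cdot> Var d \<sigma>) (u \<cdot> Var d \<sigma>) (Suc d)) \<longleftrightarrow>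
      eqd \<tau> (den (s((d, \<sigma>) := x)) (t \<cdot> Var d \<sigma>)) (den (s((d, \<sigma>) := x)) (u \<cdot> Var d \<sigma>))"
    proof (rule Fn.IH(2))
      show "proper (s((d, \<sigma>) := x))" using Fn.prems x by simp
    qed (use Fn.prems x in \<open>auto intro: less_SucI\<close>)
    then show ?thesis by (simp only: den.simps * fun_upd_same)
  qed
  then show ?case by (simp add: all_def)
qed

lemma valid_eq_axioms: "\<phi> \<in> eq_axioms \<Longrightarrow> valid \<phi>"
  by (auto simp: eq_axioms_def valid_def builder_defs)

lemma valid_succ_axioms: "\<phi> \<in> succ_axioms \<Longrightarrow> valid \<phi>"
  by (auto simp: succ_axioms_def valid_def builder_defs)

lemma valid_comb_axioms: "\<phi> \<in> comb_axioms \<Longrightarrow> valid \<phi>"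
proof -
  assume "\<phi> \<in> comb_axioms"
  then consider \<sigma> \<tau> where "\<phi> = all \<sigma> (\<lambda>x. all \<tau> (\<lambda>y. eq_at \<sigma> (CombK \<sigma> \<tau> \<cdot> x \<cdot> y) x)) 0"
    | \<rho> \<sigma> \<tau> where "\<phi> = all (\<rho> \<rightarrow> \<sigma> \<rightarrow> \<tau>) (\<lambda>x. all (\<rho> \<rightarrow> \<sigma>) (\<lambda>y. all \<rho> (\<lambda>z.
       eq_at \<tau> (CombS \<rho> \<sigma> \<tau> \<cdot> x \<cdot> y \<cdot> z) (x \<cdot> z \<cdot> (y \<cdot> z))))) 0"
    unfolding comb_axioms_def by auto
  then show ?thesis
  proof cases
    case (1 \<sigma> \<tau>)
    then show ?thesis
      by (auto simp: valid_def all_def holds_eq_at den.simps(7) intro: eqd_red red_K)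
  next
    case (2 \<rho> \<sigma> \<tau>)
    then show ?thesis
      by (auto simp: valid_def all_def holds_eq_at den.simps(7) intro: eqd_red red_S)
  qed
qed

lemma valid_rec_axioms: "\<phi> \<in> rec_axioms \<Longrightarrow> valid \<phi>"
  unfolding rec_axioms_def
proof (elim insertE emptyE; hypsubst)
  show "valid (all N (\<lambda>y. all (N \<rightarrow> N \<rightarrow> N) (\<lambda>z. Rec \<cdot> Zero \<cdot> y \<cdot> z \<doteq> y)) 0)"
    by (auto simp: valid_def builder_defs val_Rec1)
  show "valid (all N (\<lambda>x. all N (\<lambda>y. all (N \<rightarrow> N \<rightarrow> N) (\<lambda>z.
       Rec \<cdot> (Succ \<cdot> x) \<cdot> y \<cdot> z \<doteq> z \<cdot> (Rec \<cdot> x \<cdot> y \<cdot> z) \<cdot> x))) 0)"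
    unfolding valid_def builder_defs
  proof (simp, intro allI impI)
    fix s :: asg and x y z
    assume s: "proper s" "has_ty A x N" "has_ty A y N" "has_ty A z (N \<rightarrow> N \<rightarrow> N)"
    define s' where "s' = s((0, N) := x, (Suc 0, N) := y, (Suc (Suc 0), N \<rightarrow> N \<rightarrow> N) := z)"
    have s': "proper s'" using s by (simp add: s'_def)
    have z: "s' (Suc (Suc 0), N \<rightarrow> N \<rightarrow> N) = z" "s' (0, N) = x" by (simp_all add: s'_def)
    let ?R = "Rec \<cdot> Var 0 N \<cdot> Var (Suc 0) N \<cdot> Var (Suc (Suc 0)) (N \<rightarrow> N \<rightarrow> N)"
    have "val (den s' (Var (Suc (Suc 0)) (N \<rightarrow> N \<rightarrow> N) \<cdot> ?R \<cdot> Var 0 N)) = val (z \<bullet> den s' ?R \<bullet> x)"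
      using z by (simp add: den.simps(7))
    also have "\<dots> = val (z \<bullet> num (val (den s' ?R)) \<bullet> num (val x))"
      by (rule val_App2) (use s s' in auto)
    also have "\<dots> = val (den s' (Rec \<cdot> (Succ \<cdot> Var 0 N) \<cdot> Var (Suc 0) N \<cdot> Var (Suc (Suc 0)) (N \<rightarrow> N \<rightarrow> N)))"
      using s' z by (simp add: val_Rec1)
    finally show "val (den (s((0, N) := x, (Suc 0, N) := y, (Suc (Suc 0), N \<rightarrow> N \<rightarrow> N) := z))
          (Rec \<cdot> (Succ \<cdot> Var 0 N) \<cdot> Var (Suc 0) N \<cdot> Var (Suc (Suc 0)) (N \<rightarrow> N \<rightarrow> N))) =
       val (den (s((0, N) := x, (Suc 0, N) := y, (Suc (Suc 0), N \<rightarrow> N \<rightarrow> N) := z))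
          (Var (Suc (Suc 0)) (N \<rightarrow> N \<rightarrow> N) \<cdot> ?R \<cdot> Var 0 N))"
      unfolding s'_def by simp
  qed
qed

lemma valid_ext_axioms: "\<phi> \<in> ext_axioms \<Longrightarrow> valid \<phi>"
  by (auto simp: ext_axioms_def valid_def all_def pimp_def holds_eq_at den.simps(7)
      simp del: eqd.simps intro: eqd_app)

lemma valid_qf_induction: "\<phi> \<in> qf_induction \<Longrightarrow> valid \<phi>"
proof -
  assume "\<phi> \<in> qf_induction"
  then obtain i \<psi> where \<phi>: "\<phi> = Imp (subst i N Zero \<psi>)
       (Imp (All i N (Imp \<psi> (subst i N (Succ \<cdot> Var i N) \<psi>))) (All i N \<psi>))"
    and \<psi>: "wf_fm \<psi>" "qfree \<psi>" unfolding qf_induction_def by blast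
  have "holds (s((i, N) := num n)) \<psi>" if s: "proper s" "holds s (subst i N Zero \<psi>)"
    "holds s (All i N (Imp \<psi> (subst i N (Succ \<cdot> Var i N) \<psi>)))" for s n
  proof (induction n)
    case 0
    then show ?case using s(2) unfolding holds_subst[OF qfree_free_for[OF \<psi>(2)]] by (simp only: num.simps den.simps)
  next
    case (Suc n)
    then have "holds (s((i, N) := num n)) (subst i N (Succ \<cdot> Var i N) \<psi>)"
      using s(3) num_in_D(2) unfolding holds.simps by blast
    then have "holds (s((i, N) := num n, (i, N) := CSucc \<bullet> num n)) \<psi>"
      unfolding holds_subst[OF qfree_free_for[OF \<psi>(2)]] by (simp only: den.simps fun_upd_same)
    then show ?case by (simp only: num.simps fun_upd_upd)
  qed
  then have "holds (s((i, N) := x)) \<psi>" if "proper s" "holds s (subst i N Zero \<psi>)"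
    "holds s (All i N (Imp \<psi> (subst i N (Succ \<cdot> Var i N) \<psi>)))" "has_ty A x N" for s x
    unfolding holds_num[OF that(1) \<psi>(1) that(4)] using that by blast
  then show ?thesis unfolding \<phi> valid_def holds.simps(3)
    by (intro allI impI) (unfold holds.simps(4), blast)
qed

lemma chi_props:
  assumes "wf_fm \<phi>" "qfree \<phi>"
  shows "well_typed (chi \<phi>) \<and> typ_of (chi \<phi>) = N \<and> (\<forall>s. proper s \<longrightarrow> (val (den s (chi \<phi>)) = 0 \<longleftrightarrow> holds s \<phi>))"
  using assms
proof (induction \<phi>)
  case (Eq s t)
  then show ?case by auto
next
  case (Imp \<phi> \<psi>)
  have *: "rec_nat b (\<lambda>m a. 0) n = 0 \<longleftrightarrow> (n = 0 \<longrightarrow> b = 0)" for b n :: nat by (cases n) auto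
  show ?case using Imp by (simp add: *)
qed auto

lemma den_lam2:
  assumes "proper s" "well_typed t" "has_ty A x \<sigma>" "has_ty A y \<tau>"
  shows "eqd (typ_of t) (den s (lam i \<sigma> (lam j \<tau> t)) \<bullet> x \<bullet> y) (den (s((i, \<sigma>) := x, (j, \<tau>) := y)) t)"
proof -
  have "eqd (\<tau> \<rightarrow> typ_of t) (den s (lam i \<sigma> (lam j \<tau> t)) \<bullet> x) (den (s((i, \<sigma>) := x)) (lam j \<tau> t))"
    using den_lam[of s "lam j \<tau> t" x \<sigma> i] assms by simp
  then have "eqd (typ_of t) (den s (lam i \<sigma> (lam j \<tau> t)) \<bullet> x \<bullet> y) (den (s((i, \<sigma>) := x)) (lam j \<tau> t) \<bullet> y)"
    using assms(4) by simp
  also have "eqd (typ_of t) \<dots> (den (s((i, \<sigma>) := x, (j, \<tau>) := y)) t)"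
    by (rule den_lam) (use assms in auto)
  finally show ?thesis .
qed

text \<open>With \<open>chi\<close> and bracket abstraction the matrix and its parameters become a
  single object \<open>T\<close>, and a sequence of functions is coded by the columns of one member
  of \<open>A\<close>. This leaves a statement about values of terms, which the forcing construction
  can handle.\<close>

lemma valid_QF_AC_01:
  assumes choice: "\<And>T. has_ty A T (N \<rightarrow> N1 \<rightarrow> N) \<Longrightarrow> (\<And>n. \<exists>f\<in>A. val (T \<bullet> num n \<bullet> CFun f) = 0) \<Longrightarrow>
      \<exists>g\<in>A. \<forall>n. val (T \<bullet> num n \<bullet> CFun (col g n)) = 0"
    and "\<phi> \<in> QF_AC_01"
  shows "valid \<phi>"
proof -
  from assms(2) obtain i j k \<psi> where \<phi>: "\<phi> = Imp (All j N (Ex i N1 \<psi>))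
       (Ex k (N \<rightarrow> N1) (All j N (subst i N1 (Var k (N \<rightarrow> N1) \<cdot> Var j N) \<psi>)))"
    and \<psi>: "wf_fm \<psi>" "qfree \<psi>" "(k, N \<rightarrow> N1) \<notin> fv \<psi>" unfolding QF_AC_01_def by blast
  show ?thesis unfolding valid_def
  proof (intro allI impI)
    fix s assume s: "proper s"
    define T where "T = den s (lam j N (lam i N1 (chi \<psi>)))"
    have T: "has_ty A T (N \<rightarrow> N1 \<rightarrow> N)" unfolding T_def using s chi_props[OF \<psi>(1,2)] by simp
    have Tval: "val (T \<bullet> num n \<bullet> CFun f) = 0 \<longleftrightarrow> holds (s((j, N) := num n, (i, N1) := CFun f)) \<psi>"
      if "f \<in> A" for n f
      using den_lam2[OF s, of "chi \<psi>" "num n" N "CFun f" N1 j i] chi_props[OF \<psi>(1,2)] Fun_in_D[OF that] s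
      by (simp add: T_def)
    show "holds s \<phi>" unfolding \<phi>
    proof (subst holds.simps(3), rule impI)
      assume H: "holds s (All j N (Ex i N1 \<psi>))"
      have "\<exists>f\<in>A. val (T \<bullet> num n \<bullet> CFun f) = 0" for n
      proof -
        have "holds (s((j, N) := num n)) (Ex i N1 \<psi>)" using H num_in_D(2) unfolding holds.simps by blast
        then obtain x where x: "has_ty A x N1" "holds (s((j, N) := num n, (i, N1) := x)) \<psi>" by auto
        then have "holds (s((j, N) := num n, (i, N1) := CFun (fnv x))) \<psi>"
          using holds_Fun[of "s((j, N) := num n)" \<psi> x i] s \<psi> by simp
        then show ?thesis using Tval[of "fnv x" n] fnv_in_A[of x] x(1) by auto
      qed
      from choice[OF T this] obtain g where g: "g \<in> A" "\<And>n. val (T \<bullet> num n \<bullet> CFun (col g n)) = 0" by blast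
      define s' where "s' = s((2, N1) := CFun g)"
      have s': "proper s'" using s Fun_in_D[OF g(1)] by (simp add: s'_def)
      \<comment> \<open>The exchanged arguments of \<open>pair\<close> make the value
        \<open>g (pr x y)\<close>, so that \<open>F\<close> sends \<open>x\<close> to the column
        \<open>x\<close> of \<open>g\<close>.\<close>
      define F where "F = den s' (lam 0 N (lam 1 N (Var 2 N1 \<cdot> pair (v 1) (v 0))))"
      have F: "has_ty A F (N \<rightarrow> N1)" unfolding F_def using s' by simp
      have FN1: "eqd N1 (F \<bullet> x) (CFun (col g (val x)))" if x: "has_ty A x N" for x
      proof -
        have "val (F \<bullet> x \<bullet> y) = fnv (CFun g) (pr (val x) (val y))" if y: "has_ty A y N" for y
          unfolding F_def using den_lam2[OF s', of "Var 2 N1 \<cdot> pair (v 1) (v 0)" x N y N 0 1] x y s'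
          by (simp add: s'_def)
        then show ?thesis using val_app Fun_in_D[OF A_col[OF g(1)]] by simp
      qed
      have "holds (s((k, N \<rightarrow> N1) := F, (j, N) := x)) (subst i N1 (Var k (N \<rightarrow> N1) \<cdot> Var j N) \<psi>)"
        if x: "has_ty A x N" for x
      proof -
        let ?s = "s((k, N \<rightarrow> N1) := F, (j, N) := x)"
        have "holds ?s (subst i N1 (Var k (N \<rightarrow> N1) \<cdot> Var j N) \<psi>) = holds (?s((i, N1) := F \<bullet> x)) \<psi>"
          using holds_subst[OF qfree_free_for[OF \<psi>(2)], of ?s i N1 "Var k (N \<rightarrow> N1) \<cdot> Var j N"]
          by (simp add: den.simps(7))
        also have "\<dots> = holds (s((j, N) := x, (i, N1) := F \<bullet> x)) \<psi>"
          by (rule holds_cong) (use \<psi>(3) in auto)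
        also have "\<dots> = holds (s((j, N) := num (val x), (i, N1) := CFun (col g (val x)))) \<psi>"
        proof (rule holds_eqd)
          show "proper (s((j, N) := x, (i, N1) := F \<bullet> x))"
            using s x has_ty_App[OF F x] by simp
          show "proper (s((j, N) := num (val x), (i, N1) := CFun (col g (val x))))"
            using s Fun_in_D[OF A_col[OF g(1)]] by simp
        qed (use \<psi>(1) FN1[OF x] in auto)
        also have "\<dots>" using Tval[OF A_col[OF g(1)]] g(2) by blast
        finally show ?thesis by blast
      qed
      then have "holds (s((k, N \<rightarrow> N1) := F)) (All j N (subst i N1 (Var k (N \<rightarrow> N1) \<cdot> Var j N) \<psi>))" by simp
      then show "holds s (Ex k (N \<rightarrow> N1) (All j N (subst i N1 (Var k (N \<rightarrow> N1) \<cdot> Var j N) \<psi>)))"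
        using F by auto
    qed
  qed
qed

lemma den_upd_fresh: "\<forall>x\<in>vars t. fst x < d \<Longrightarrow> den (s((d, \<sigma>) := x)) t = den s t"
  by (rule den_upd) force

lemma holds_normal_form:
  assumes "proper s" "well_typed f" "typ_of f = N1" "\<forall>x\<in>vars f. fst x < d"
    "\<And>g. g \<in> set gs \<Longrightarrow> well_typed g \<and> typ_of g = N1 \<and> (\<forall>x\<in>vars g. fst x < d)"
  shows "holds s (normal_form b k f gs d) \<longleftrightarrow> nf A b k (fnv (den s f)) (map (\<lambda>g. fnv (den s g)) gs)"
  using assms
proof (induction k arbitrary: b s gs d)
  case 0
  let ?t = "tuple (map (\<lambda>g. init_tm \<cdot> g \<cdot> Var d N) gs)"
  have t: "well_typed ?t \<and> typ_of ?t = N"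
    by (rule types_tuple) (use 0 in auto)
  have "val (den (s((d, N) := x)) (f \<cdot> ?t)) =
      fnv (den s f) (tuple_val (map (\<lambda>g. init_seg g (val x)) (map (\<lambda>g. fnv (den s g)) gs)))"
    if x: "has_ty A x N" for x
  proof -
    let ?s = "s((d, N) := x)"
    have s: "proper ?s" using 0 x by simp
    have "val (den ?s (f \<cdot> ?t)) = fnv (den s f) (val (den ?s ?t))"
      using val_App'[OF s _ _ 0(2,3), of ?t] t den_upd_fresh[OF 0(4)] by simp
    also have "val (den ?s ?t) = tuple_val (map (\<lambda>t. val (den ?s t)) (map (\<lambda>g. init_tm \<cdot> g \<cdot> Var d N) gs))"
      by (rule val_tuple[OF s]) (use 0 in auto)
    also have "map (\<lambda>t. val (den ?s t)) (map (\<lambda>g. init_tm \<cdot> g \<cdot> Var d N) gs) =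
        map (\<lambda>g. init_seg g (val x)) (map (\<lambda>g. fnv (den s g)) gs)"
      unfolding map_map
    proof (rule map_cong[OF refl])
      fix g assume "g \<in> set gs"
      then have g: "well_typed g" "typ_of g = N1" "\<forall>x\<in>vars g. fst x < d" using 0(5) by blast+
      then show "((\<lambda>t. val (den ?s t)) \<circ> (\<lambda>g. init_tm \<cdot> g \<cdot> Var d N)) g =
          ((\<lambda>g. init_seg g (val x)) \<circ> (\<lambda>g. fnv (den s g))) g"
        using s den_upd_fresh[OF g(3)] by simp
    qed
    finally show ?thesis .
  qed
  then show ?case using ball_D_N[of "\<lambda>n. fnv (den s f) (tuple_val (map (\<lambda>g. init_seg g n) (map (\<lambda>g. fnv (den s g)) gs))) = 0"]
      bex_D_N[of "\<lambda>n. fnv (den s f) (tuple_val (map (\<lambda>g. init_seg g n) (map (\<lambda>g. fnv (den s g)) gs))) = 0"]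
    by (auto simp: all_def ex_def peq_def)
next
  case (Suc k)
  have *: "holds (s((d, N1) := x)) (normal_form b k f (gs @ [Var d N1]) (Suc d)) \<longleftrightarrow>
      nf A b k (fnv (den s f)) (map (\<lambda>g. fnv (den s g)) gs @ [fnv x])" if x: "has_ty A x N1" for x b
  proof -
    let ?s = "s((d, N1) := x)"
    have "den ?s g = den s g" if "g \<in> set gs" for g using Suc.prems(5)[OF that] den_upd_fresh by blast
    then have m: "map (\<lambda>g. fnv (den ?s g)) (gs @ [Var d N1]) = map (\<lambda>g. fnv (den s g)) gs @ [fnv x]"
      by simp
    have "holds ?s (normal_form b k f (gs @ [Var d N1]) (Suc d)) \<longleftrightarrow>
        nf A b k (fnv (den ?s f)) (map (\<lambda>g. fnv (den ?s g)) (gs @ [Var d N1]))"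
    proof (rule Suc.IH)
      show "proper ?s" using Suc.prems(1) x by simp
      show "well_typed g \<and> typ_of g = N1 \<and> (\<forall>x\<in>vars g. fst x < Suc d)"
        if "g \<in> set (gs @ [Var d N1])" for g
        using that Suc.prems(5)[of g] by (auto intro: less_SucI)
    qed (use Suc.prems(1-4) x less_SucI in auto)
    then show ?thesis unfolding m using den_upd_fresh[OF Suc.prems(4)] by simp
  qed
  show ?case
    using ball_D_N1[of "\<lambda>h. nf A True k (fnv (den s f)) (map (\<lambda>g. fnv (den s g)) gs @ [h])"]
      bex_D_N1[of "\<lambda>h. nf A False k (fnv (den s f)) (map (\<lambda>g. fnv (den s g)) gs @ [h])"] *
    by (auto simp: all_def ex_def)
qed

lemma val_Orc_Var [simp]:
  assumes "proper s" "s (i, N2) = COrc k" "well_typed u" "typ_of u = N1"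
  shows "val (den s (Var i N2 \<cdot> u)) = G k (fnv (den s u))"
  using assms val_Orc[of "den s u" k] by (simp add: den.simps(7))

lemma valid_Suslin2:
  assumes "\<And>f. f \<in> A \<Longrightarrow> G i f = (if nf A True k f [] then 0 else 1)"
  shows "valid (Suslin2 k)"
proof -
  have "holds s (Suslin2 k)" if s: "proper s" for s
  proof -
    let ?s = "\<lambda>x. s((0, N2) := COrc i, (1, N1) := x)"
    have "holds (?s x) (normal_form True k (Var 1 N1) [] 2) \<longleftrightarrow> nf A True k (fnv x) []"
      if "has_ty A x N1" for x
      using holds_normal_form[of "?s x" "Var 1 N1" 2 "[]" True k] s that by simp
    moreover have "G i (fnv x) = (if nf A True k (fnv x) [] then 0 else 1)" if "has_ty A x N1" for x
      using assms fnv_in_A that by simp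
    ultimately show ?thesis
      unfolding Suslin2_def builder_defs using s
      by (auto intro!: exI[of _ "COrc i"] simp: numeral_2_eq_2 split: if_splits)
  qed
  then show ?thesis by (simp add: valid_def)
qed

end

text \<open>Oracle 0 searches for a zero and realises \<open>QF_AC_10\<close>, oracle 1 is the
  injection on reals, and oracle 2 witnesses \<open>exists2\<close>.\<close>

locale model = frame +
  assumes G0: "f \<in> A \<Longrightarrow> \<exists>n. f n = 0 \<Longrightarrow> f (G 0 f) = 0"
    and G1: "f \<in> A \<Longrightarrow> g \<in> A \<Longrightarrow> real_code f \<Longrightarrow> real_code g \<Longrightarrow> G 1 f = G 1 g \<longleftrightarrow> cut f = cut g"
    and G2: "f \<in> A \<Longrightarrow> G 2 f = (if \<exists>n. f n = 0 then 0 else 1)"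
begin

text \<open>The choice functional sends \<open>f\<close> to the result of the search oracle at the
  characteristic function of the matrix for \<open>f\<close>.\<close>

lemma valid_QF_AC_10: "\<phi> \<in> QF_AC_10 \<Longrightarrow> valid \<phi>"
proof -
  assume "\<phi> \<in> QF_AC_10"
  then obtain i j k \<psi> where \<phi>: "\<phi> = Imp (All i N1 (Ex j N \<psi>))
       (Ex k N2 (All i N1 (subst j N (Var k N2 \<cdot> Var i N1) \<psi>)))"
    and \<psi>: "wf_fm \<psi>" "qfree \<psi>" "(k, N2) \<notin> fv \<psi>" unfolding QF_AC_10_def by blast
  note chi = chi_props[OF \<psi>(1,2)]
  have "holds s \<phi>" if s: "proper s" for s
    unfolding \<phi>
  proof (subst holds.simps(3), rule impI)
    assume H: "holds s (All i N1 (Ex j N \<psi>))"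
    \<comment> \<open>Terms of the language contain no oracles, so oracle 0 enters through the
      variable \<open>Var k N2\<close>, which is not free in the matrix.\<close>
    define s' where "s' = s((k, N2) := COrc 0)"
    have s': "proper s'" using s by (simp add: s'_def)
    define F where "F = den s' (lam i N1 (Var k N2 \<cdot> lam j N (chi \<psi>)))"
    have F: "has_ty A F N2" unfolding F_def using s' chi by simp
    have "holds (s((k, N2) := F, (i, N1) := x)) (subst j N (Var k N2 \<cdot> Var i N1) \<psi>)"
      if x: "has_ty A x N1" for x
    proof -
      let ?s = "s((k, N2) := F, (i, N1) := x)" and ?s' = "s'((i, N1) := x)"
      define h where "h = fnv (den ?s' (lam j N (chi \<psi>)))"
      have "h \<in> A" unfolding h_def by (rule fnv_in_A) (use s' x chi in simp)
      have h: "h n = 0 \<longleftrightarrow> holds (s((i, N1) := x, (j, N) := num n)) \<psi>" for n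
      proof -
        have "h n = 0 \<longleftrightarrow> holds (?s'((j, N) := num n)) \<psi>"
          unfolding h_def using s' x chi by simp
        also have "\<dots> = holds (s((i, N1) := x, (j, N) := num n)) \<psi>"
          by (rule holds_cong) (use \<psi>(3) in \<open>auto simp: s'_def\<close>)
        finally show ?thesis .
      qed
      have "val (F \<bullet> x) = val (den ?s' (Var k N2 \<cdot> lam j N (chi \<psi>)))"
        unfolding F_def using den_lam[OF s', of "Var k N2 \<cdot> lam j N (chi \<psi>)" x N1 i] x chi by simp
      also have "\<dots> = G 0 h" unfolding h_def
        by (rule val_Orc_Var) (use s' x chi in \<open>auto simp: s'_def\<close>)
      finally have FG: "val (F \<bullet> x) = G 0 h" .
      from H x obtain y where y: "has_ty A y N" "holds (s((i, N1) := x, (j, N) := y)) \<psi>" by auto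
      then have "h (val y) = 0" using h holds_num[of "s((i, N1) := x)" \<psi> y j] s x \<psi>(1) by simp
      then have "h (G 0 h) = 0" using G0[OF \<open>h \<in> A\<close>] by blast
      then have "holds (s((i, N1) := x, (j, N) := num (val (F \<bullet> x)))) \<psi>" using h FG by simp
      then have "holds (s((i, N1) := x, (j, N) := F \<bullet> x)) \<psi>"
        using holds_num[of "s((i, N1) := x)" \<psi> "F \<bullet> x" j] s x \<psi>(1) has_ty_App[OF F x] by simp
      also have "holds (s((i, N1) := x, (j, N) := F \<bullet> x)) \<psi> = holds (?s((j, N) := F \<bullet> x)) \<psi>"
        by (rule holds_cong) (use \<psi>(3) in auto)
      finally show ?thesis
        using holds_subst[OF qfree_free_for[OF \<psi>(2)], of ?s j N "Var k N2 \<cdot> Var i N1"]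
        by (simp add: den.simps(7))
    qed
    then have "holds (s((k, N2) := F)) (All i N1 (subst j N (Var k N2 \<cdot> Var i N1) \<psi>))" by simp
    then show "holds s (Ex k N2 (All i N1 (subst j N (Var k N2 \<cdot> Var i N1) \<psi>)))"
      using F by auto
  qed
  then show ?thesis by (simp add: valid_def)
qed

lemma valid_RCA0_omega: "\<phi> \<in> RCA0_omega \<Longrightarrow> valid \<phi>"
  unfolding RCA0_omega_def
  using valid_eq_axioms valid_succ_axioms valid_comb_axioms valid_rec_axioms valid_ext_axioms
    valid_qf_induction valid_QF_AC_10 by blast

lemma valid_exists2: "valid exists2"
proof -
  have "holds s exists2" if s: "proper s" for s
    unfolding exists2_def builder_defs using s G2[OF fnv_in_A]
      bex_D_N[of "\<lambda>n. fnv f n = 0" for f]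
    by (auto intro!: exI[of _ "COrc 2"] split: if_splits)
  then show ?thesis by (simp add: valid_def)
qed

end

section \<open>Real arithmetic and the empty set in the model\<close>

context frame
begin

lemma types_qadd [simp]: "well_typed qadd_tm" "typ_of qadd_tm = N \<rightarrow> N \<rightarrow> N" "vars qadd_tm = {}"
  by (auto simp: qadd_tm_def)

lemma val_qadd [simp]:
  assumes "proper s" "well_typed a" "typ_of a = N" "well_typed b" "typ_of b = N"
  shows "rat_val (val (den s (a \<oplus>\<^sub>Q b))) = rat_val (val (den s a)) + rat_val (val (den s b))"
  unfolding qadd_tm_def using assms rat_val_add by simp

lemma types_dyadic [simp]: "well_typed dyadic_tm" "typ_of dyadic_tm = N \<rightarrow> N \<rightarrow> N" "vars dyadic_tm = {}"
  by (auto simp: dyadic_tm_def)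

lemma val_dyadic [simp]:
  assumes "proper s" "well_typed a" "typ_of a = N" "well_typed b" "typ_of b = N"
  shows "rat_val (val (den s (dyadic a b))) = val (den s a) / 2 ^ val (den s b)"
  unfolding dyadic_tm_def using assms by (simp add: rat_val_dyadic)

lemma holds_qless [simp]:
  assumes "proper s" "well_typed a" "typ_of a = N" "well_typed b" "typ_of b = N"
  shows "holds s ((a <\<^sub>Q b) d) \<longleftrightarrow> rat_val (val (den s a)) < rat_val (val (den s b))"
  unfolding qless_def pless_def rat_val_less using assms by simp

lemma holds_qle [simp]:
  assumes "proper s" "well_typed a" "typ_of a = N" "well_typed b" "typ_of b = N"
  shows "holds s ((a \<le>\<^sub>Q b) d) \<longleftrightarrow> rat_val (val (den s a)) \<le> rat_val (val (den s b))"
  unfolding qle_def pneg_def using assms by (simp add: not_less)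

lemma holds_is_real [simp]:
  assumes "proper s" "well_typed x" "typ_of x = N1" "\<forall>y\<in>vars x. fst y < d"
  shows "holds s (is_real x d) \<longleftrightarrow> real_code (fnv (den s x))"
proof -
  have u: "den (s((d, N) := a)) x = den s x" "den (s((d, N) := a, (Suc d, N) := b)) x = den s x" for a b
    using den_upd_fresh[OF assms(4)] den_upd_fresh[of x "Suc d"] assms(4) less_SucI by metis+
  let ?P = "\<lambda>f n i. rat_val (f n) < rat_val (f (n + i)) + 1 / 2 ^ n \<and> rat_val (f (n + i)) < rat_val (f n) + 1 / 2 ^ n"
  have "holds s (is_real x d) \<longleftrightarrow> (\<forall>a. has_ty A a N \<longrightarrow> (\<forall>b. has_ty A b N \<longrightarrow>
      ?P (fnv (den s x)) (val a) (val b)))"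
    unfolding is_real_def builder_defs using assms(1-3) u by (auto simp: val_App'[where t = x])
  then show ?thesis unfolding real_code_def
    using ball_D_N[of "\<lambda>n. \<forall>b. has_ty A b N \<longrightarrow> ?P (fnv (den s x)) n (val b)"]
      ball_D_N[of "?P (fnv (den s x)) n" for n] by simp
qed

lemma holds_req [simp]:
  assumes "proper s" "well_typed x" "typ_of x = N1" "\<forall>z\<in>vars x. fst z < d"
    "well_typed y" "typ_of y = N1" "\<forall>z\<in>vars y. fst z < d"
  shows "holds s ((x =\<^sub>R y) d) \<longleftrightarrow> real_eq (fnv (den s x)) (fnv (den s y))"
  unfolding real_eq_def req_def builder_defs
  using assms den_upd_fresh[OF assms(4)] den_upd_fresh[OF assms(7)]
    ball_D_N[of "\<lambda>n. rat_val (fnv (den s x) n) \<le> rat_val (fnv (den s y) n) + 2 / 2 ^ n \<and>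
      rat_val (fnv (den s y) n) \<le> rat_val (fnv (den s x) n) + 2 / 2 ^ n"]
  by (auto simp: val_App'[where t = x] val_App'[where t = y])

lemma holds_rless [simp]:
  assumes "proper s" "well_typed x" "typ_of x = N1" "\<forall>z\<in>vars x. fst z < d"
    "well_typed y" "typ_of y = N1" "\<forall>z\<in>vars y. fst z < d"
  shows "holds s ((x <\<^sub>R y) d) \<longleftrightarrow> real_less (fnv (den s x)) (fnv (den s y))"
  unfolding real_less_def rless_def builder_defs
  using assms den_upd_fresh[OF assms(4)] den_upd_fresh[OF assms(7)]
    bex_D_N[of "\<lambda>n. rat_val (fnv (den s x) n) + 2 / 2 ^ n < rat_val (fnv (den s y) n)"]
  by (auto simp: val_App'[where t = x] val_App'[where t = y])

lemma holds_rle [simp]: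
  assumes "proper s" "well_typed x" "typ_of x = N1" "\<forall>z\<in>vars x. fst z < d"
    "well_typed y" "typ_of y = N1" "\<forall>z\<in>vars y. fst z < d"
  shows "holds s ((x \<le>\<^sub>R y) d) \<longleftrightarrow> \<not> real_less (fnv (den s y)) (fnv (den s x))"
  unfolding rle_def pneg_def using assms by simp

lemma holds_all_real [simp]:
  assumes "proper s"
  shows "holds s (all_real P d) \<longleftrightarrow> (\<forall>x. has_ty A x N1 \<longrightarrow> real_code (fnv x) \<longrightarrow>
    holds (s((d, N1) := x)) (P (Var d N1) (Suc d)))"
  unfolding all_real_def all_def pimp_def using assms by auto

lemma holds_ex_real [simp]:
  assumes "proper s"
  shows "holds s (ex_real P d) \<longleftrightarrow> (\<exists>x. has_ty A x N1 \<and> real_code (fnv x) \<and>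
    holds (s((d, N1) := x)) (P (Var d N1) (Suc d)))"
  unfolding ex_real_def ex_def pand_def using assms by auto

lemma types_rzero [simp]: "well_typed rzero" "typ_of rzero = N1" "vars rzero = {}"
  by (auto simp: rzero_def)

lemma den_rzero_upd [simp]: "den (s(x := y)) rzero = den s rzero"
  by (rule den_upd) simp

lemma rat_val_rzero [simp]: "proper s \<Longrightarrow> rat_val (fnv (den s rzero) n) = 0"
proof -
  assume s: "proper s"
  have "fnv (den s rzero) n = val (den s (dyadic Zero Zero))"
    unfolding rzero_def fnv_def den.simps(7)[of s "CombK _ _"] by (simp add: val_red[OF red_K])
  then show ?thesis using s by simp
qed

lemma real_code_rzero [simp]: "proper s \<Longrightarrow> real_code (fnv (den s rzero))"
  by (simp add: real_code_def)

definition empty_set_tm :: "fn cm" where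
  "empty_set_tm = CK N1 N1 \<bullet> den asg0 rzero"

lemma empty_set_ty [simp]: "has_ty A empty_set_tm RtoR"
  unfolding empty_set_tm_def by (rule has_ty_App[OF has_ty_K]) (simp add: proper_asg0)

lemma rat_val_empty_set: "rat_val (fnv (empty_set_tm \<bullet> x) n) = 0"
proof -
  have "fnv (empty_set_tm \<bullet> x) n = fnv (den asg0 rzero) n"
    unfolding empty_set_tm_def fnv_def by (rule val_red) (intro red.intros)
  then show ?thesis by (simp add: proper_asg0)
qed

lemma not_elem_empty_set [simp]:
  assumes "proper s" "s (p, RtoR) = empty_set_tm" "p < d" "e < d"
  shows "\<not> holds s ((Var e N1 \<in>\<^sub>R Var p RtoR) d)"
proof -
  have "den s (Var p RtoR \<cdot> Var e N1) = empty_set_tm \<bullet> s (e, N1)"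
    using assms by (simp add: den.simps(7))
  then show ?thesis using assms by (simp add: elem_def real_less_def rat_val_empty_set)
qed

lemma holds_is_set_empty:
  assumes "proper s" "s (p, RtoR) = empty_set_tm" "p < d"
  shows "holds s (is_set (Var p RtoR) d)"
  unfolding is_set_def pand_def pimp_def using assms
  by (auto simp: den.simps(7) real_code_def real_less_def real_eq_def rat_val_empty_set less_SucI)

lemma holds_perfect_empty:
  assumes "proper s" "s (p, RtoR) = empty_set_tm" "p < d"
  shows "holds s (perfect_set (Var p RtoR) d)"
  unfolding perfect_set_def closed_set_def Defs.open_class_def pand_def pneg_def pimp_def ex_def
  using assms holds_is_set_empty[OF assms] by (auto simp: less_SucI intro!: exI[of _ CZero])

end

section \<open>Countability of every set and the failure of NIN\<close>

context model
begin

text \<open>Oracle 1 separates all reals of the model, hence in particular the elements of any given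
  set.\<close>

lemma holds_countable_set:
  assumes "proper s" "p < d"
  shows "holds s (countable_set (Var p RtoR) d)"
proof -
  have "G 1 (fnv x) = G 1 (fnv y) \<longleftrightarrow> real_eq (fnv x) (fnv y)"
    if "has_ty A x N1" "real_code (fnv x)" "has_ty A y N1" "real_code (fnv y)" for x y
    using G1 cut_eq_iff fnv_in_A that by simp
  then show ?thesis unfolding countable_set_def ex_def pand_def pimp_def peq_def
    using assms by (auto intro!: exI[of _ "COrc 1"])
qed

lemma valid_CBT: "valid CBT"
proof -
  have "holds s CBT" if s: "proper s" for s
  proof -
    have "holds (s((0, RtoR) := C)) ((ex RtoR (\<lambda>P. ex RtoR (\<lambda>S.
         perfect_set P \<^bold>\<and> is_set S \<^bold>\<and> countable_set S \<^bold>\<and>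
         all_real (\<lambda>x. x \<in>\<^sub>R Var 0 RtoR \<^bold>\<longleftrightarrow> (x \<in>\<^sub>R P \<^bold>\<or> x \<in>\<^sub>R S)) \<^bold>\<and>
         \<^bold>\<not> ex_real (\<lambda>x. x \<in>\<^sub>R P \<^bold>\<and> x \<in>\<^sub>R S)))) 1)"
      if C: "has_ty A C RtoR" and closed: "holds (s((0, RtoR) := C)) (closed_set (Var 0 RtoR) 1)" for C
    proof -
      let ?s = "s((0, RtoR) := C, (1, RtoR) := empty_set_tm, (2, RtoR) := C)"
      have s': "proper ?s" using s C by simp
      have "holds ?s (perfect_set (Var 1 RtoR) 3)" "holds ?s (countable_set (Var 2 RtoR) 3)"
        using holds_perfect_empty[OF s', of 1 3] holds_countable_set[OF s', of 2 3] by simp_all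
      moreover have "holds ?s (is_set (Var 2 RtoR) 3)"
        using closed s C unfolding closed_set_def is_set_def pand_def pimp_def
        by (simp add: den.simps(7))
      moreover have "\<not> holds (?s((3, N1) := x)) ((Var 3 N1 \<in>\<^sub>R Var 1 RtoR) 4)" if "has_ty A x N1" for x
        by (rule not_elem_empty_set) (use s' that in auto)
      moreover have "holds (?s((3, N1) := x)) ((Var 3 N1 \<in>\<^sub>R Var 0 RtoR) 4) \<longleftrightarrow>
          holds (?s((3, N1) := x)) ((Var 3 N1 \<in>\<^sub>R Var 2 RtoR) 4)" if "has_ty A x N1" for x
        unfolding elem_def using s' that by (simp add: den.simps(7))
      ultimately have "holds ?s ((perfect_set (Var 1 RtoR) \<^bold>\<and> is_set (Var 2 RtoR) \<^bold>\<and> countable_set (Var 2 RtoR) \<^bold>\<and>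
         all_real (\<lambda>x. x \<in>\<^sub>R Var 0 RtoR \<^bold>\<longleftrightarrow> (x \<in>\<^sub>R Var 1 RtoR \<^bold>\<or> x \<in>\<^sub>R Var 2 RtoR)) \<^bold>\<and>
         \<^bold>\<not> ex_real (\<lambda>x. x \<in>\<^sub>R Var 1 RtoR \<^bold>\<and> x \<in>\<^sub>R Var 2 RtoR)) 3)"
        unfolding pand_def pneg_def piff_def por_def using s'
        by (simp add: numeral_3_eq_3[symmetric] eval_nat_numeral(2)[symmetric] del: One_nat_def)
      then show ?thesis unfolding ex_def using C empty_set_ty
        by (simp add: numeral_2_eq_2 numeral_3_eq_3)
          (rule exI[of _ empty_set_tm], rule conjI, rule empty_set_ty, rule exI[of _ C], rule conjI; assumption)
    qed
    then show ?thesis unfolding CBT_def all_def pimp_def by simp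
  qed
  then show ?thesis by (simp add: valid_def)
qed

lemma valid_PST: "valid PST"
  unfolding PST_def valid_def all_def pimp_def pand_def pneg_def
  using holds_countable_set[of _ 0 "Suc 0"] by auto

lemma not_valid_NIN: "\<not> valid NIN"
proof -
  have "G 1 (fnv x) = G 1 (fnv y) \<longleftrightarrow> real_eq (fnv x) (fnv y)"
    if "has_ty A x N1" "real_code (fnv x)" "has_ty A y N1" "real_code (fnv y)" for x y
    using G1 cut_eq_iff fnv_in_A that by simp
  then have "\<not> holds s NIN" if "proper s" for s
    unfolding NIN_def pneg_def ex_def pand_def pimp_def peq_def
    using that by (auto intro!: exI[of _ "COrc 1"])
  then show ?thesis using proper_asg0 by (auto simp: valid_def)
qed

end

section \<open>A generic model\<close>

text \<open>The Suslin functionals, from index 3 on, quantify over all functions and not over the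
  set under construction. Thus only oracle 1 varies while the model is being built.\<close>

definition orc :: "(fn \<Rightarrow> nat) \<Rightarrow> orcs" where
  "orc Y i f =
    (if i = 0 then LEAST n. f n = 0
     else if i = 1 then Y f
     else if i = 2 then if \<exists>n. f n = 0 then 0 else 1
     else if nf UNIV True (i - 3) f [] then 0 else 1)"

text \<open>The last family consists of Skolem functions on lists of a matrix \<open>f\<close>
  followed by parameters: for \<open>b\<close> true a witness of an existential quantifier, for
  \<open>b\<close> false a counterexample to a universal one. The family with
  \<open>orc (\<lambda>_. 0)\<close> covers all oracles except the injection, which
  \<open>step\<close> treats separately. There are countably many operations, so closing off
  preserves countability.\<close>

definition ops :: "(fn list \<Rightarrow> fn) set" where
  "ops = {\<lambda>_ n. n, \<lambda>_. Suc, \<lambda>_. pfst, \<lambda>_. psnd, \<lambda>fs n. pr ((fs ! 0) n) ((fs ! 1) n),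
      \<lambda>fs n. (fs ! 0) ((fs ! 1) n),
      \<lambda>fs n. rec_nat ((fs ! 0) n) (\<lambda>m a. (fs ! 1) (pr n (pr a m))) ((fs ! 2) n)} \<union>
    range (\<lambda>c _ _. c) \<union> range (\<lambda>k fs. col (fs ! 0) k) \<union>
    range (\<lambda>i fs n. orc (\<lambda>_. 0) i (col (fs ! 0) n)) \<union>
    range (\<lambda>(b, k) fs. SOME g. nf UNIV (\<not> b) k (hd fs) (tl fs @ [g]) = b)"

definition step :: "fn set \<Rightarrow> (fn \<Rightarrow> nat) \<Rightarrow> fn set" where
  "step B Y = (\<lambda>(F, fs). F fs) ` (ops \<times> lists B) \<union> (\<lambda>f n. Y (col f n)) ` B"

definition op_closed :: "fn set \<Rightarrow> (fn \<Rightarrow> nat) \<Rightarrow> bool" where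
  "op_closed B Y \<longleftrightarrow> step B Y \<subseteq> B"

lemma countable_step: "countable B \<Longrightarrow> countable (step B Y)"
  unfolding step_def ops_def by (auto intro!: countable_Un countable_image countable_SIGMA)

lemma step_op: "F \<in> ops \<Longrightarrow> set fs \<subseteq> B \<Longrightarrow> F fs \<in> step B Y"
  unfolding step_def by (auto intro!: image_eqI[of _ _ "(F, fs)"])

lemma step_Y: "f \<in> B \<Longrightarrow> (\<lambda>n. Y (col f n)) \<in> step B Y"
  unfolding step_def by auto

lemma step_cases:
  assumes "h \<in> step B Y"
  obtains (op) F fs where "F \<in> ops" "set fs \<subseteq> B" "h = F fs" | (val) f where "f \<in> B" "h = (\<lambda>n. Y (col f n))"
  using assms unfolding step_def by (auto simp: subset_iff)

lemma frame_closed: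
  assumes "op_closed B Y"
  shows "frame B (orc Y)"
proof -
  have op: "F fs \<in> B" if "F \<in> ops" "set fs \<subseteq> B" for F fs
    using step_op[OF that] assms by (auto simp: op_closed_def)
  show ?thesis
  proof
    fix c and f g h :: fn and i
    show "(\<lambda>n. n) \<in> B" using op[of "\<lambda>_ n. n" "[]"] by (simp add: ops_def)
    show "(\<lambda>_. c) \<in> B" using op[of "\<lambda>_ _. c" "[]"] by (auto simp: ops_def)
    show "Suc \<in> B" using op[of "\<lambda>_. Suc" "[]"] by (simp add: ops_def)
    show "pfst \<in> B" using op[of "\<lambda>_. pfst" "[]"] by (simp add: ops_def)
    show "psnd \<in> B" using op[of "\<lambda>_. psnd" "[]"] by (simp add: ops_def)
    assume f: "f \<in> B"
    have "(\<lambda>n. orc (\<lambda>_. 0) i (col f n)) \<in> B"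
      using op[of "\<lambda>fs n. orc (\<lambda>_. 0) i (col (fs ! 0) n)" "[f]"] f by (auto simp: ops_def)
    moreover have "(\<lambda>n. Y (col f n)) \<in> B" using step_Y[OF f] assms by (auto simp: op_closed_def)
    moreover have "orc Y i = (if i = 1 then Y else orc (\<lambda>_. 0) i)" by (auto simp: orc_def fun_eq_iff)
    ultimately show "(\<lambda>n. orc Y i (col f n)) \<in> B" by simp
    assume g: "g \<in> B"
    show "(\<lambda>n. pr (f n) (g n)) \<in> B"
      using op[of "\<lambda>fs n. pr ((fs ! 0) n) ((fs ! 1) n)" "[f, g]"] f g by (simp add: ops_def)
    show "(\<lambda>n. f (g n)) \<in> B"
      using op[of "\<lambda>fs n. (fs ! 0) ((fs ! 1) n)" "[f, g]"] f g by (simp add: ops_def)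
    assume h: "h \<in> B"
    show "(\<lambda>n. rec_nat (f n) (\<lambda>m a. g (pr n (pr a m))) (h n)) \<in> B"
      using op[of "\<lambda>fs n. rec_nat ((fs ! 0) n) (\<lambda>m a. (fs ! 1) (pr n (pr a m))) ((fs ! 2) n)" "[f, g, h]"]
        f g h by (simp add: ops_def)
  qed
qed

text \<open>A set closed under the Skolem functions among the operations is an elementary submodel of full
  second-order arithmetic, as far as normal forms are concerned.\<close>

lemma nf_closed:
  assumes "op_closed B Y"
  shows "f \<in> B \<Longrightarrow> set gs \<subseteq> B \<Longrightarrow> nf B b k f gs \<longleftrightarrow> nf UNIV b k f gs"
proof (induction k arbitrary: b gs)
  case (Suc k)
  have *: "\<exists>g\<in>B. nf UNIV (\<not> b) k f (gs @ [g]) = b" if "nf UNIV (\<not> b) k f (gs @ [h]) = b" for b h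
  proof
    let ?F = "\<lambda>fs. SOME g. nf UNIV (\<not> b) k (hd fs) (tl fs @ [g]) = b"
    show "nf UNIV (\<not> b) k f (gs @ [?F (f # gs)]) = b" using someI[of "\<lambda>g. nf UNIV (\<not> b) k f (gs @ [g]) = b", OF that] by simp
    have "?F \<in> ops" unfolding ops_def by (auto intro!: image_eqI[of _ _ "(b, k)"])
    then show "?F (f # gs) \<in> B" using step_op[of ?F "f # gs" B Y] Suc.prems assms by (auto simp: op_closed_def)
  qed
  have IH: "nf B b k f (gs @ [g]) \<longleftrightarrow> nf UNIV b k f (gs @ [g])" if "g \<in> B" for g b
    using Suc.IH[of "gs @ [g]"] Suc.prems that by simp
  show ?case
  proof (cases b)
    case True
    then show ?thesis using *[of True] IH by auto
  next
    case False
    have "(\<forall>g\<in>B. nf UNIV True k f (gs @ [g])) \<longleftrightarrow> (\<forall>g. nf UNIV True k f (gs @ [g]))"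
      using *[of False] by auto
    then show ?thesis using False IH by simp
  qed
qed simp

section \<open>Conditions and limits of chains\<close>

type_synonym cnd = "fn set \<times> (fn \<Rightarrow> nat) \<times> nat set"

abbreviation dm :: "cnd \<Rightarrow> fn set" where "dm p \<equiv> fst p"
abbreviation vl :: "cnd \<Rightarrow> fn \<Rightarrow> nat" where "vl p \<equiv> fst (snd p)"
abbreviation rs :: "cnd \<Rightarrow> nat set" where "rs p \<equiv> snd (snd p)"

definition separates :: "fn set \<Rightarrow> (fn \<Rightarrow> nat) \<Rightarrow> bool" where
  "separates B Y \<longleftrightarrow> (\<forall>f\<in>B. \<forall>g\<in>B. Y f = Y g \<longleftrightarrow> cut f = cut g)"

definition cond :: "cnd \<Rightarrow> bool" where
  "cond p \<longleftrightarrow> countable (dm p) \<and> separates (dm p) (vl p) \<and> infinite (rs p) \<and> vl p ` dm p \<inter> rs p = {}"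

definition agree :: "cnd \<Rightarrow> cnd \<Rightarrow> bool" where
  "agree p q \<longleftrightarrow> dm p \<subseteq> dm q \<and> (\<forall>f\<in>dm p. vl q f = vl p f)"

text \<open>The values of \<open>q\<close> at new arguments have to be taken from the reserve of \<open>p\<close>.\<close>

definition extends :: "cnd \<Rightarrow> cnd \<Rightarrow> bool" where
  "extends p q \<longleftrightarrow> agree p q \<and> rs q \<subseteq> rs p \<and> vl q ` dm q \<subseteq> vl p ` dm p \<union> rs p"

text \<open>A dropped value is withheld from all extensions of the resulting condition. Dropping one
  value per stage is what provides the limit of a chain with an infinite reserve.\<close>

definition drop_rs :: "cnd \<Rightarrow> nat \<Rightarrow> cnd" where
  "drop_rs p c = (dm p, vl p, rs p - {c})"

lemma drop_rs_simps [simp]: "dm (drop_rs p c) = dm p" "vl (drop_rs p c) = vl p" "rs (drop_rs p c) = rs p - {c}"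
  by (simp_all add: drop_rs_def)

lemma cond_drop_rs: "cond p \<Longrightarrow> cond (drop_rs p c)"
  unfolding cond_def drop_rs_simps by (intro conjI) (simp_all add: infinite_remove, blast)

lemma agree_refl: "agree p p"
  by (simp add: agree_def)

lemma agree_trans: "agree p q \<Longrightarrow> agree q r \<Longrightarrow> agree p r"
  by (auto simp: agree_def)

lemma extends_refl: "extends p p"
  by (auto simp: extends_def agree_def)

lemma extends_trans:
  assumes "extends p q" "extends q r" shows "extends p r"
proof -
  note pq = assms(1)[unfolded extends_def] and qr = assms(2)[unfolded extends_def]
  have "agree p r" by (rule agree_trans[OF pq[THEN conjunct1] qr[THEN conjunct1]])
  moreover have "rs q \<subseteq> rs p" "rs r \<subseteq> rs q" and im: "vl q ` dm q \<subseteq> vl p ` dm p \<union> rs p"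
    "vl r ` dm r \<subseteq> vl q ` dm q \<union> rs q"
    using pq qr by simp_all
  moreover from this(1) have "vl r ` dm r \<subseteq> vl p ` dm p \<union> rs p"
    by (intro subset_trans[OF im(2)] Un_least im(1) sup.coboundedI2)
  ultimately show ?thesis unfolding extends_def by simp
qed

lemma extends_drop_rs: "extends (drop_rs p c) q \<Longrightarrow> extends p q"
  unfolding extends_def agree_def drop_rs_simps by blast

lemma agree_chain: "(\<And>n. agree (p n) (p (Suc n))) \<Longrightarrow> m \<le> n \<Longrightarrow> agree (p m) (p n)"
  by (induction n) (auto simp: le_Suc_eq agree_refl intro: agree_trans)

lemma extends_chain: "(\<And>n. extends (p n) (p (Suc n))) \<Longrightarrow> m \<le> n \<Longrightarrow> extends (p m) (p n)"
  by (induction n) (auto simp: le_Suc_eq extends_refl intro: extends_trans)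

lemma finite_subset_chain:
  assumes "\<And>n. agree (p n) (p (Suc n))" "finite F" "F \<subseteq> (\<Union>n. dm (p n))"
  shows "\<exists>n. F \<subseteq> dm (p n)"
  using assms(2,3)
proof (induction F)
  case (insert f F)
  then obtain m n where "F \<subseteq> dm (p m)" "f \<in> dm (p n)" by auto
  moreover have "dm (p m) \<subseteq> dm (p (max m n))" "dm (p n) \<subseteq> dm (p (max m n))"
    using agree_chain[of p, OF assms(1)] by (simp_all add: agree_def)
  ultimately show ?case by blast
qed simp

text \<open>An operation has finitely many arguments, so they all appear at one stage, and the next
  stage contains the result.\<close>

lemma chain_union:
  assumes "\<And>n. agree (p n) (p (Suc n))" "\<And>n. separates (dm (p n)) (vl (p n))"
    "\<And>n. step (dm (p n)) (vl (p n)) \<subseteq> dm (p (Suc n))"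
  obtains Y where "\<And>n f. f \<in> dm (p n) \<Longrightarrow> Y f = vl (p n) f" "separates (\<Union>n. dm (p n)) Y"
    "op_closed (\<Union>n. dm (p n)) Y"
proof -
  let ?B = "\<Union>n. dm (p n)"
  define Y where "Y = (\<lambda>f. vl (p (LEAST n. f \<in> dm (p n))) f)"
  have Y: "Y f = vl (p n) f" if "f \<in> dm (p n)" for f n
  proof -
    have "f \<in> dm (p (LEAST n. f \<in> dm (p n)))" "(LEAST n. f \<in> dm (p n)) \<le> n"
      using that by (auto intro: LeastI Least_le)
    then show ?thesis using agree_chain[of p, OF assms(1)] unfolding Y_def agree_def by metis
  qed
  have "separates ?B Y" unfolding separates_def
  proof (intro ballI)
    fix f g assume "f \<in> ?B" "g \<in> ?B"
    then obtain n where "{f, g} \<subseteq> dm (p n)" using finite_subset_chain[of p, OF assms(1), of "{f, g}"] by auto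
    then show "Y f = Y g \<longleftrightarrow> cut f = cut g"
      using Y[of f n] Y[of g n] assms(2)[of n] by (simp add: separates_def)
  qed
  moreover have "op_closed ?B Y" unfolding op_closed_def
  proof
    fix h assume "h \<in> step ?B Y"
    then show "h \<in> ?B"
    proof (cases rule: step_cases)
      case (op F fs)
      then obtain n where "set fs \<subseteq> dm (p n)" using finite_subset_chain[of p, OF assms(1), of "set fs"] by auto
      then have "F fs \<in> step (dm (p n)) (vl (p n))" by (rule step_op[OF op(1)])
      then have "h \<in> dm (p (Suc n))" using assms(3)[of n] op(3) by (simp add: subset_iff)
      then show ?thesis by (rule UN_I[OF UNIV_I])
    next
      case (val f)
      then obtain n where n: "f \<in> dm (p n)" by blast
      \<comment> \<open>Here infinitely many arguments are involved, but taking columns is among the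
        operations, so all of them lie in the single stage \<open>Suc n\<close>, where
        \<open>Y\<close> is already fixed.\<close>
      have "col f k \<in> dm (p (Suc n))" for k
        using step_op[of "\<lambda>fs. col (fs ! 0) k" "[f]" "dm (p n)" "vl (p n)"] n assms(3)[of n]
        by (auto simp: ops_def)
      then have "h = (\<lambda>k. vl (p (Suc n)) (col f k))" using val(2) Y by blast
      moreover have "f \<in> dm (p (Suc n))" using n assms(1)[of n] by (auto simp: agree_def)
      ultimately have "h \<in> step (dm (p (Suc n))) (vl (p (Suc n)))" using step_Y by simp
      then show ?thesis using assms(3)[of "Suc n"] by blast
    qed
  qed
  ultimately show thesis using Y that by blast
qed

text \<open>The reserve of the limit consists of the values that were dropped along the way. It is not
  contained in the reserves of the later conditions, which the limit therefore only agrees with.\<close>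

lemma chain_limit:
  assumes "\<And>n. cond (p n)" "\<And>n. c n \<in> rs (p n)" "\<And>n. extends (drop_rs (p n) (c n)) (p (Suc n))"
    "\<And>n. step (dm (p n)) (vl (p n)) \<subseteq> dm (p (Suc n))"
  obtains q where "cond q" "op_closed (dm q) (vl q)" "extends (p 0) q" "\<And>n. agree (p n) q"
    "dm q = (\<Union>n. dm (p n))"
proof -
  have ext: "extends (p n) (p (Suc n))" for n using extends_drop_rs[OF assms(3)] .
  then have ag: "agree (p n) (p (Suc n))" for n by (simp add: extends_def)
  obtain Y where Y: "\<And>n f. f \<in> dm (p n) \<Longrightarrow> Y f = vl (p n) f" "separates (\<Union>n. dm (p n)) Y"
    "op_closed (\<Union>n. dm (p n)) Y"
    by (rule chain_union[of p, OF ag _ assms(4)]) (use assms(1) in \<open>auto simp: cond_def\<close>)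
  define q where "q = ((\<Union>n. dm (p n)), Y, range c)"
  have later: "extends (drop_rs (p m) (c m)) (p n)" if "m < n" for m n
    using extends_trans[OF assms(3) extends_chain[of p, OF ext, of "Suc m" n]] that by simp
  have c: "c n \<noteq> c m" if "m < n" for m n
    using later[OF that] assms(2)[of n] by (auto simp: extends_def)
  then have "inj c" by (metis linorder_neqE_nat injI)
  then have "infinite (range c)" by (rule range_inj_infinite)
  moreover have "Y f \<noteq> c m" if "f \<in> dm (p n)" for f n m
  proof -
    \<comment> \<open>A stage at which \<open>f\<close> is present and \<open>c m\<close> has
      already been dropped.\<close>
    let ?k = "n + Suc m"
    have "agree (p n) (p ?k)" by (rule agree_chain[of p, OF ag]) simp
    then have f: "f \<in> dm (p ?k)" using that by (auto simp: agree_def)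
    have "extends (drop_rs (p m) (c m)) (p ?k)" by (rule later) simp
    then have "vl (p ?k) f \<in> vl (p m) ` dm (p m) \<union> (rs (p m) - {c m})"
      using f by (simp add: extends_def image_subset_iff)
    then have "vl (p ?k) f \<noteq> c m" using assms(1)[of m] assms(2)[of m] by (auto simp: cond_def)
    then show ?thesis using Y(1)[OF f] by simp
  qed
  moreover have "countable (dm q)" using assms(1) by (simp add: q_def cond_def)
  ultimately have "cond q" using Y(2) by (auto simp: cond_def q_def)
  moreover have "agree (p n) q" for n using Y(1) by (auto simp: agree_def q_def)
  moreover have "extends (p 0) q" unfolding extends_def
  proof (intro conjI)
    show "rs q \<subseteq> rs (p 0)"
      using assms(2) extends_chain[of p, OF ext, of 0] by (auto simp: q_def extends_def)
    show "vl q ` dm q \<subseteq> vl (p 0) ` dm (p 0) \<union> rs (p 0)"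
    proof
      fix y assume "y \<in> vl q ` dm q"
      then obtain f n where "f \<in> dm (p n)" "y = Y f" by (auto simp: q_def)
      then have "y \<in> vl (p n) ` dm (p n)" using Y(1) by auto
      then show "y \<in> vl (p 0) ` dm (p 0) \<union> rs (p 0)"
        using extends_chain[of p, OF ext, of 0 n] by (auto simp: extends_def)
    qed
  qed fact
  ultimately show thesis using that[of q] Y(3) by (simp add: q_def)
qed

text \<open>A new function whose cut already occurs must take the old value. The other cuts receive
  the even positions in an enumeration \<open>e\<close> of values from the reserve, and the odd
  positions form the new reserve.\<close>

lemma extend_dom:
  assumes "cond p" "countable C"
  shows "\<exists>q. cond q \<and> extends p q \<and> dm q = dm p \<union> C"
proof -
  have sep: "separates (dm p) (vl p)" and inf: "infinite (rs p)" and disj: "vl p ` dm p \<inter> rs p = {}"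
    using assms(1) by (auto simp: cond_def)
  obtain e :: "nat \<Rightarrow> nat" where e: "inj e" "range e \<subseteq> rs p"
    using infinite_countable_subset[OF inf] by blast
  define old where "old f = (SOME g. g \<in> dm p \<and> cut g = cut f)" for f
  define new where "new f = e (2 * to_nat_on (cut ` C) (cut f))" for f
  define Y where "Y f = (if cut f \<in> cut ` dm p then vl p (old f) else new f)" for f
  have old: "old f \<in> dm p" "cut (old f) = cut f" if "cut f \<in> cut ` dm p" for f
    using someI_ex[of "\<lambda>g. g \<in> dm p \<and> cut g = cut f"] that unfolding old_def by auto
  have old_eq: "vl p (old f) = vl p f" if "f \<in> dm p" for f
    using old[of f] that sep by (simp add: separates_def)
  have new_eq: "new f = new g \<longleftrightarrow> cut f = cut g" if "f \<in> C" "g \<in> C" for f g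
    using that assms(2) e(1) by (auto simp: new_def inj_eq)
  have new_rs: "new f \<in> rs p" for f using e(2) by (auto simp: new_def)
  have old_rs: "vl p (old f) \<notin> rs p" if "cut f \<in> cut ` dm p" for f using old[OF that] disj by auto
  have Yeq: "Y f = Y g \<longleftrightarrow> cut f = cut g" if fg: "f \<in> dm p \<union> C" "g \<in> dm p \<union> C" for f g
  proof (cases "cut f \<in> cut ` dm p"; cases "cut g \<in> cut ` dm p")
    assume *: "cut f \<in> cut ` dm p" "cut g \<in> cut ` dm p"
    then show ?thesis using old[OF *(1)] old[OF *(2)] sep by (simp add: Y_def separates_def)
  next
    assume *: "cut f \<notin> cut ` dm p" "cut g \<notin> cut ` dm p"
    then have "f \<in> C" "g \<in> C" using fg by auto
    then show ?thesis using * new_eq by (simp add: Y_def)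
  next
    assume *: "cut f \<in> cut ` dm p" "cut g \<notin> cut ` dm p"
    then show ?thesis using old_rs[OF *(1)] new_rs[of g] by (auto simp: Y_def)
  next
    assume *: "cut f \<notin> cut ` dm p" "cut g \<in> cut ` dm p"
    then show ?thesis using old_rs[OF *(2)] new_rs[of f] by (auto simp: Y_def)
  qed
  define q where "q = (dm p \<union> C, Y, range (\<lambda>n. e (2 * n + 1)))"
  have "infinite (range (\<lambda>n. e (2 * n + 1)))"
    by (rule range_inj_infinite, rule injI) (use injD[OF e(1)] in fastforce)
  moreover have "Y f \<noteq> e (2 * n + 1)" for f n
  proof (cases "cut f \<in> cut ` dm p")
    case True
    then show ?thesis using old_rs[OF True] e(2) by (auto simp: Y_def)
  next
    case False
    have "2 * k \<noteq> 2 * n + (1::nat)" for k by presburger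
    then show ?thesis using False e(1) by (auto simp: Y_def new_def inj_eq)
  qed
  ultimately have "cond q" using assms Yeq by (auto simp: cond_def q_def separates_def)
  moreover have "extends p q" unfolding extends_def agree_def
  proof (intro conjI)
    show "\<forall>f\<in>dm p. vl q f = vl p f" using old_eq by (auto simp: q_def Y_def)
    show "vl q ` dm q \<subseteq> vl p ` dm p \<union> rs p" using old new_rs by (auto simp: q_def Y_def)
    show "rs q \<subseteq> rs p" using e(2) by (auto simp: q_def)
  qed (auto simp: q_def)
  ultimately show ?thesis by (auto simp: q_def)
qed

section \<open>Closed conditions and the decision of choice instances\<close>

definition good :: "cnd \<Rightarrow> bool" where
  "good p \<longleftrightarrow> cond p \<and> op_closed (dm p) (vl p)"

text \<open>Closure is reached in countably many rounds. Each adds the results of all operations and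
  the values of the injection along sequences, and sacrifices one reserve value.\<close>

lemma extend_good:
  assumes "cond p"
  shows "\<exists>q. good q \<and> extends p q"
proof -
  define Q where "Q p q \<longleftrightarrow> (\<exists>c\<in>rs p. extends (drop_rs p c) q) \<and> step (dm p) (vl p) \<subseteq> dm q" for p q
  have "\<exists>q. cond q \<and> Q p q" if p: "cond p" for p
  proof -
    from p obtain c where "c \<in> rs p" unfolding cond_def using infinite_imp_nonempty by blast
    moreover have "countable (step (dm p) (vl p))" using p countable_step by (simp add: cond_def)
    from extend_dom[OF cond_drop_rs[OF p] this, of c]
    obtain q where "cond q" "extends (drop_rs p c) q" "dm q = dm p \<union> step (dm p) (vl p)"
      unfolding drop_rs_simps by (elim exE conjE)
    moreover from this(3) have "step (dm p) (vl p) \<subseteq> dm q" by simp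
    ultimately show ?thesis unfolding Q_def by blast
  qed
  then have "\<exists>s. \<forall>n. (cond (s n) \<and> (n = 0 \<longrightarrow> s n = p)) \<and> Q (s n) (s (Suc n))"
    using assms by (intro dependent_nat_choice) blast+
  then obtain s where s: "\<And>n. cond (s n)" "\<And>n. Q (s n) (s (Suc n))" "s 0 = p" by blast
  then obtain c where "\<And>n. c n \<in> rs (s n)" "\<And>n. extends (drop_rs (s n) (c n)) (s (Suc n))"
    "\<And>n. step (dm (s n)) (vl (s n)) \<subseteq> dm (s (Suc n))" unfolding Q_def by metis
  from chain_limit[of s, OF s(1) this] s(3) show ?thesis unfolding good_def by metis
qed

abbreviation evc :: "cnd \<Rightarrow> fn cm \<Rightarrow> nat \<Rightarrow> bool" where "evc p \<equiv> ev (dm p) (orc (vl p))"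

lemma evc_mono: "evc p t n \<Longrightarrow> agree p q \<Longrightarrow> evc q t n"
  by (erule ev_mono) (auto simp: agree_def orc_def)

definition refuted :: "cnd \<Rightarrow> fn cm \<Rightarrow> bool" where
  "refuted q t \<longleftrightarrow> (\<exists>n. \<forall>r. good r \<longrightarrow> extends q r \<longrightarrow> (\<forall>f\<in>dm r. \<not> evc r (t \<bullet> num n \<bullet> CFun f) 0))"

definition solved :: "cnd \<Rightarrow> fn cm \<Rightarrow> bool" where
  "solved q t \<longleftrightarrow> (\<exists>g\<in>dm q. \<forall>n. evc q (t \<bullet> num n \<bullet> CFun (col g n)) 0)"

text \<open>If no good extension refutes the instance, then for each \<open>n\<close> every good
  extension of \<open>p\<close> has a further one with a witness for \<open>n\<close>. So the
  witnesses can be collected along a chain, for \<open>n\<close> = 0, 1, 2 and so on.\<close>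

lemma decide_choice:
  assumes "good p"
  shows "\<exists>q. good q \<and> extends p q \<and> (refuted q t \<or> solved q t)"
proof (cases "\<exists>q. good q \<and> extends p q \<and> refuted q t")
  case False
  then have ext: "\<exists>r. good r \<and> extends q r \<and> (\<exists>f\<in>dm r. evc r (t \<bullet> num n \<bullet> CFun f) 0)"
    if "good q" "extends p q" for q n
    using that unfolding refuted_def by blast
  define Q where "Q n q r \<longleftrightarrow> (\<exists>c\<in>rs q. extends (drop_rs q c) r) \<and> (\<exists>f\<in>dm r. evc r (t \<bullet> num n \<bullet> CFun f) 0)"
    for n q r
  have "\<exists>r. (good r \<and> extends p r) \<and> Q n q r" if q: "good q" "extends p q" for q n
  proof -
    from q obtain c where "c \<in> rs q" unfolding good_def cond_def using infinite_imp_nonempty by blast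
    \<comment> \<open>One value is withheld before the next witness is sought, as the limit
      construction demands. Closure is unaffected, since domain and values stay the same.\<close>
    have "good (drop_rs q c)" using q(1) cond_drop_rs by (simp add: good_def)
    moreover have "extends p (drop_rs q c)" using q(2) by (auto simp: extends_def agree_def)
    ultimately obtain r where r: "good r" "extends (drop_rs q c) r" "\<exists>f\<in>dm r. evc r (t \<bullet> num n \<bullet> CFun f) 0"
      using ext by blast
    then have "extends p r" using extends_trans q(2) extends_drop_rs by blast
    then show ?thesis using r \<open>c \<in> rs q\<close> unfolding Q_def by blast
  qed
  then have "\<exists>s. \<forall>n. ((good (s n) \<and> extends p (s n)) \<and> (n = 0 \<longrightarrow> s n = p)) \<and> Q n (s n) (s (Suc n))"
    using assms extends_refl by (intro dependent_nat_choice) blast+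
  then obtain s where s: "\<And>n. good (s n)" "\<And>n. Q n (s n) (s (Suc n))" "s 0 = p" by blast
  from s(2) obtain c where c: "\<And>n. c n \<in> rs (s n)" "\<And>n. extends (drop_rs (s n) (c n)) (s (Suc n))"
    unfolding Q_def by metis
  from s(2) obtain f where f: "\<And>n. f n \<in> dm (s (Suc n))" "\<And>n. evc (s (Suc n)) (t \<bullet> num n \<bullet> CFun (f n)) 0"
    unfolding Q_def by metis
  have "dm (s n) \<subseteq> dm (s (Suc n))" for n using c(2)[of n] by (simp add: extends_def agree_def)
  then have st: "step (dm (s n)) (vl (s n)) \<subseteq> dm (s (Suc n))" for n
    using s(1)[of n] unfolding good_def op_closed_def by blast
  have cs: "cond (s n)" for n using s(1) good_def by blast
  obtain q where q: "cond q" "extends p q" "\<And>n. agree (s n) q"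
    using chain_limit[of s, OF cs c st] s(3) by metis
  \<comment> \<open>The sequence of witnesses is formed outside the chain and may be missing from
    its limit. It is adjoined afterwards and the domain closed off again; the evaluations already
    achieved persist, since they only depend on agreement.\<close>
  define g where "g = (\<lambda>m. f (pfst m) (psnd m))"
  obtain q1 where q1: "cond q1" "extends q q1" "g \<in> dm q1"
    using extend_dom[OF q(1), of "{g}"] by auto
  obtain q2 where q2: "good q2" "extends q1 q2" using extend_good[OF q1(1)] by blast
  have "solved q2 t" unfolding solved_def
  proof (intro bexI[of _ g] allI)
    show "g \<in> dm q2" using q1 q2 by (auto simp: extends_def agree_def)
    fix n
    have "agree (s (Suc n)) q2"
      using agree_trans[OF agree_trans[OF q(3)[of "Suc n"], of q1], of q2] q1(2) q2(2)
      by (simp add: extends_def)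
    from evc_mono[OF f(2) this] show "evc q2 (t \<bullet> num n \<bullet> CFun (col g n)) 0" by (simp add: g_def)
  qed
  then show ?thesis using q2 q(2) q1(2) extends_trans by blast
qed blast

section \<open>The generic sequence and its union\<close>

definition next_cond :: "cnd \<Rightarrow> fn cm \<Rightarrow> cnd" where
  "next_cond p t = (SOME q. good q \<and> extends p q \<and> (refuted q t \<or> solved q t))"

definition task :: "cnd \<Rightarrow> nat \<Rightarrow> fn cm" where
  "task p = from_nat_into {t. has_ty (dm p) t (N \<rightarrow> N1 \<rightarrow> N)}"

text \<open>Bookkeeping: the step from stage \<open>pr j k\<close> treats the \<open>k\<close>-th
  term over the domain of stage \<open>j\<close>, so every term over the union gets its turn. By
  \<open>pfst_le\<close> the minimum equals \<open>pfst n\<close>; it makes visible that the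
  recursive call goes to an earlier stage.\<close>

fun gen :: "nat \<Rightarrow> cnd" where
  "gen 0 = (SOME p. good p)"
| "gen (Suc n) = next_cond (gen n) (task (gen (min (pfst n) n)) (psnd n))"

lemma good_gen_0: "good (gen 0)"
proof -
  have "cond ({}, \<lambda>_. 0, UNIV)" by (simp add: cond_def separates_def)
  then show ?thesis unfolding gen.simps using extend_good someI_ex[of good] by blast
qed

lemma gen_props: "good (gen n) \<and> extends (gen n) (gen (Suc n)) \<and>
  (refuted (gen (Suc n)) (task (gen (pfst n)) (psnd n)) \<or> solved (gen (Suc n)) (task (gen (pfst n)) (psnd n)))"
proof -
  have step: "good (gen (Suc n)) \<and> extends (gen n) (gen (Suc n)) \<and>
    (refuted (gen (Suc n)) (task (gen (pfst n)) (psnd n)) \<or> solved (gen (Suc n)) (task (gen (pfst n)) (psnd n)))"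
    if "good (gen n)" for n
    using someI_ex[OF decide_choice[OF that, of "task (gen (pfst n)) (psnd n)"]] pfst_le[of n]
    unfolding gen.simps next_cond_def[symmetric] by (simp add: min_def)
  have "good (gen n)" for n by (induction n) (use good_gen_0 step in blast)+
  then show ?thesis using step by blast
qed

text \<open>A refuted instance cannot have a witness in the union. The witness would appear at a
  later stage, and there the matrix already has a value, because that stage is a frame of its own;
  by monotonicity and determinacy this value is the one in the union, namely 0.\<close>

lemma generic_model_exists:
  "\<exists>B Y. model B (orc Y) \<and> op_closed B Y \<and>
    (\<forall>T. has_ty B T (N \<rightarrow> N1 \<rightarrow> N) \<longrightarrow> (\<forall>n. \<exists>f\<in>B. ev B (orc Y) (T \<bullet> num n \<bullet> CFun f) 0) \<longrightarrow>
      (\<exists>g\<in>B. \<forall>n. ev B (orc Y) (T \<bullet> num n \<bullet> CFun (col g n)) 0))"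
proof -
  let ?B = "\<Union>n. dm (gen n)"
  have ext: "extends (gen n) (gen (Suc n))" for n using gen_props by blast
  then have ag: "agree (gen n) (gen (Suc n))" for n by (simp add: extends_def)
  have st: "step (dm (gen n)) (vl (gen n)) \<subseteq> dm (gen (Suc n))" for n
    using gen_props[of n] unfolding good_def op_closed_def extends_def agree_def by blast
  obtain Y where Y: "\<And>n f. f \<in> dm (gen n) \<Longrightarrow> Y f = vl (gen n) f" "separates ?B Y" "op_closed ?B Y"
    by (rule chain_union[of gen, OF ag _ st]) (use gen_props in \<open>auto simp: good_def cond_def\<close>)
  \<comment> \<open>With its empty reserve this is not a condition, but \<open>agree\<close> ignores
    reserves.\<close>
  let ?q = "(?B, Y, {})"
  have agq: "agree (gen n) ?q" for n using Y(1) by (auto simp: agree_def)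
  have frame: "frame ?B (orc Y)" by (rule frame_closed[OF Y(3)])
  have "model ?B (orc Y)"
  proof (intro model.intro frame model_axioms.intro)
    show "f (orc Y 0 f) = 0" if "\<exists>n. f n = 0" for f using that by (auto simp: orc_def intro: LeastI)
  qed (use Y(2) in \<open>auto simp: orc_def separates_def\<close>)
  moreover have "\<exists>g\<in>?B. \<forall>n. ev ?B (orc Y) (T \<bullet> num n \<bullet> CFun (col g n)) 0"
    if T: "has_ty ?B T (N \<rightarrow> N1 \<rightarrow> N)" "\<And>n. \<exists>f\<in>?B. ev ?B (orc Y) (T \<bullet> num n \<bullet> CFun f) 0" for T
  proof -
    obtain j where "set_cm T \<subseteq> dm (gen j)"
      using finite_subset_chain[of gen, OF ag finite_set_cm has_ty_set_cm[OF T(1)]] by blast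
    then have Tj: "has_ty (dm (gen j)) T (N \<rightarrow> N1 \<rightarrow> N)" by (rule has_ty_restrict[OF T(1)])
    have "countable {t. has_ty (dm (gen j)) t (N \<rightarrow> N1 \<rightarrow> N)}"
      using gen_props[of j] countable_has_ty unfolding good_def cond_def by blast
    then obtain k where k: "task (gen j) k = T"
      using from_nat_into_surj[of _ T] Tj unfolding task_def by blast
    let ?n = "Suc (pr j k)"
    from gen_props[of "pr j k"] consider "refuted (gen ?n) T" | "solved (gen ?n) T" using k by auto
    then show ?thesis
    proof cases
      case 2
      then obtain g where "g \<in> dm (gen ?n)" "\<And>m. evc (gen ?n) (T \<bullet> num m \<bullet> CFun (col g m)) 0"
        unfolding solved_def by blast
      then show ?thesis using evc_mono[OF _ agq] by (metis UN_I UNIV_I fst_conv snd_conv)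
    next
      case 1
      then obtain m where m: "\<And>r f. good r \<Longrightarrow> extends (gen ?n) r \<Longrightarrow> f \<in> dm r \<Longrightarrow>
        \<not> evc r (T \<bullet> num m \<bullet> CFun f) 0" unfolding refuted_def by blast
      from T(2)[of m] obtain f i where f: "f \<in> dm (gen i)" "ev ?B (orc Y) (T \<bullet> num m \<bullet> CFun f) 0" by blast
      \<comment> \<open>A stage that contains the witness and the functions in \<open>T\<close>, and
        that extends the refuting condition.\<close>
      let ?l = "i + j + ?n"
      have "agree (gen i) (gen ?l)" by (rule agree_chain[of gen, OF ag]) simp
      then have fl: "f \<in> dm (gen ?l)" using f(1) unfolding agree_def by blast
      have agj: "agree (gen j) (gen ?l)" by (rule agree_chain[of gen, OF ag]) simp
      have extl: "extends (gen ?n) (gen ?l)" by (rule extends_chain[of gen, OF ext]) simp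
      have gl: "good (gen ?l)" using gen_props by blast
      interpret l: frame "dm (gen ?l)" "orc (vl (gen ?l))"
        by (rule frame_closed) (use gl good_def in blast)
      have "has_ty (dm (gen ?l)) T (N \<rightarrow> N1 \<rightarrow> N)"
        by (rule has_ty_mono[OF Tj]) (use agj agree_def in blast)
      then have "has_ty (dm (gen ?l)) (T \<bullet> num m \<bullet> CFun f) N"
        by (rule has_ty_App[OF has_ty_App[OF _ has_ty_num] has_ty_Fun[OF fl]])
      then have "evc (gen ?l) (T \<bullet> num m \<bullet> CFun f) (l.val (T \<bullet> num m \<bullet> CFun f))" using l.ev_val by simp
      moreover from evc_mono[OF this agq] f(2) have "l.val (T \<bullet> num m \<bullet> CFun f) = 0"
        using ev_det by (metis fst_conv snd_conv)
      ultimately have "evc (gen ?l) (T \<bullet> num m \<bullet> CFun f) 0" by simp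
      then show ?thesis using m[OF gl extl fl] by simp
    qed
  qed
  ultimately show ?thesis using Y(3) by blast
qed

theorem Z2_omega_not_NIN: "\<not> (Z2_omega \<union> QF_AC_01 \<union> {CBT, PST} \<turnstile> NIN)"
proof
  assume der: "Z2_omega \<union> QF_AC_01 \<union> {CBT, PST} \<turnstile> NIN"
  obtain B Y where "model B (orc Y)" and cut: "op_closed B Y" and
    choice: "\<And>T. has_ty B T (N \<rightarrow> N1 \<rightarrow> N) \<Longrightarrow> (\<And>n. \<exists>f\<in>B. ev B (orc Y) (T \<bullet> num n \<bullet> CFun f) 0) \<Longrightarrow>
      (\<exists>g\<in>B. \<forall>n. ev B (orc Y) (T \<bullet> num n \<bullet> CFun (col g n)) 0)"
    using generic_model_exists by blast
  interpret model B "orc Y" by fact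
  \<comment> \<open>The first three oracles are taken, so level \<open>k\<close> is oracle
    \<open>k + 3\<close>; \<open>nf_closed\<close> relativises its quantifiers to
    \<open>B\<close>.\<close>
  have "valid (Suslin2 k)" for k
    by (rule valid_Suslin2[of "k + 3"]) (use nf_closed[OF cut, of _ "[]"] in \<open>simp add: orc_def\<close>)
  moreover have "valid \<phi>" if "\<phi> \<in> QF_AC_01" for \<phi>
  proof (rule valid_QF_AC_01[OF _ that])
    fix T assume T: "has_ty B T (N \<rightarrow> N1 \<rightarrow> N)" "\<And>n. \<exists>f\<in>B. val (T \<bullet> num n \<bullet> CFun f) = 0"
    have "has_ty B (T \<bullet> num n \<bullet> CFun f) N" if "f \<in> B" for n f
      by (rule has_ty_App[OF has_ty_App[OF T(1) has_ty_num] has_ty_Fun[OF that]])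
    then have "\<exists>f\<in>B. E (T \<bullet> num n \<bullet> CFun f) 0" for n using T(2)[of n] ev_val by (metis mem_Collect_eq)
    from choice[OF T(1) this] show "\<exists>g\<in>B. \<forall>n. val (T \<bullet> num n \<bullet> CFun (col g n)) = 0"
      using val_eq by blast
  qed
  ultimately have "valid \<psi>" if "\<psi> \<in> Z2_omega \<union> QF_AC_01 \<union> {CBT, PST}" for \<psi>
    using that valid_RCA0_omega valid_CBT valid_PST unfolding Z2_omega_def Pi1_CA0_omega_def by blast
  then have "valid NIN" by (rule soundness[OF der])
  then show False using not_valid_NIN by blast
qed

section \<open>A model of arithmetical functions\<close>

text \<open>Formulas in one number variable, with further variables coded by pairing. Each compound
  constructor contains a negation, so that truth always means that some immediate successor is
  false; this gives \<open>tr_iff\<close> its uniform shape.\<close>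

datatype fo = FBot | FBase | FNand fo fo | FEx fo | FPre nat fo

instance fo :: countable by countable_datatype

text \<open>Atomic formulas have rank 1 and not 0, because a true one has the false formula
  \<open>FBot\<close> as its successor.\<close>

primrec rank :: "fo \<Rightarrow> nat" where
  "rank FBot = 0"
| "rank FBase = 1"
| "rank (FNand \<phi> \<psi>) = Suc (max (rank \<phi>) (rank \<psi>))"
| "rank (FEx \<phi>) = Suc (rank \<phi>)"
| "rank (FPre i \<phi>) = Suc (rank \<phi>)"

abbreviation dec :: "nat \<Rightarrow> fo" where "dec \<equiv> from_nat"
abbreviation enc :: "fo \<Rightarrow> nat" where "enc \<equiv> to_nat"

definition seq :: "nat \<Rightarrow> nat \<Rightarrow> nat" where "seq c i = list_decode c ! i"
definition lp :: "nat \<Rightarrow> nat \<Rightarrow> nat" where "lp i j = (i + j) * (i + j) + i"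
definition nand_code :: "nat \<Rightarrow> nat \<Rightarrow> nat" where "nand_code a b = enc (FNand (dec a) (dec b))"
definition ex_code :: "nat \<Rightarrow> nat" where "ex_code a = enc (FEx (dec a))"
definition pre_code :: "nat \<Rightarrow> nat \<Rightarrow> nat" where "pre_code i a = enc (FPre i (dec a))"
text \<open>Different numbers may decode to the same formula, so the outermost constructor is
  recognised on the canonical code.\<close>

definition nrm :: "nat \<Rightarrow> nat" where "nrm e = enc (dec e)"
definition cut_rel :: "nat \<Rightarrow> nat \<Rightarrow> nat \<Rightarrow> nat" where
  "cut_rel q a m = (if rat_val q + 2 / 2 ^ m < rat_val a then 0 else 1)"

text \<open>Since \<open>A\<close> only has to miss the truth predicate of its own language, that language may contain
  any functions as primitives. This includes the syntax of the language itself.\<close>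

definition basic :: "fn list" where
  "basic = [\<lambda>n. n, Suc, pfst, psnd, \<lambda>n. seq (pfst n) (psnd n), \<lambda>n. of_bool (pfst n < psnd n),
    \<lambda>n. nand_code (pfst n) (psnd n), ex_code, \<lambda>n. pre_code (pfst n) (psnd n), nrm,
    \<lambda>n. rank (dec n), \<lambda>n. lp (pfst n) (psnd n), \<lambda>n. cut_rel (pfst n) (pfst (psnd n)) (psnd (psnd n))]"

datatype pf = PBasic nat | PConst nat | PPair pf pf | PComp pf pf

instance pf :: countable by countable_datatype

primrec pfe :: "pf \<Rightarrow> fn" where
  "pfe (PBasic i) = basic ! i"
| "pfe (PConst c) = (\<lambda>_. c)"
| "pfe (PPair p q) = (\<lambda>n. pr (pfe p n) (pfe q n))"
| "pfe (PComp p q) = (\<lambda>n. pfe p (pfe q n))"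

definition prim :: "nat \<Rightarrow> fn" where "prim i = pfe (from_nat i)"

text \<open>\<open>FBase\<close> defines the graph of the universal function for all primitives.
  Hence \<open>prim\<close> is itself arithmetical, as is needed to describe the truth of
  \<open>FPre\<close> inside the language.\<close>

primrec sat :: "fo \<Rightarrow> nat \<Rightarrow> bool" where
  "sat FBot n = False"
| "sat FBase n = (prim (pfst (pfst n)) (psnd (pfst n)) = psnd n)"
| "sat (FNand \<phi> \<psi>) n = (\<not> (sat \<phi> n \<and> sat \<psi> n))"
| "sat (FEx \<phi>) n = (\<exists>m. \<not> sat \<phi> (pr n m))"
| "sat (FPre i \<phi>) n = (\<not> sat \<phi> (prim i n))"

section \<open>Closure properties of arithmetical predicates and functions\<close>

definition ar :: "(nat \<Rightarrow> bool) \<Rightarrow> bool" where "ar P \<longleftrightarrow> (\<exists>\<phi>. sat \<phi> = P)"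
definition af :: "fn \<Rightarrow> bool" where "af f \<longleftrightarrow> ar (\<lambda>n. f (pfst n) = psnd n)"

abbreviation H :: "fn set" where "H \<equiv> range prim"

lemma H_pfe: "pfe p \<in> H"
  by (rule range_eqI[of _ _ "to_nat p"]) (simp add: prim_def)

lemma H_iff: "f \<in> H \<longleftrightarrow> (\<exists>p. f = pfe p)"
  using H_pfe by (auto simp: prim_def)

lemma H_const: "(\<lambda>_. c) \<in> H"
  using H_pfe[of "PConst c"] by simp

lemma H_pair: "f \<in> H \<Longrightarrow> g \<in> H \<Longrightarrow> (\<lambda>n. pr (f n) (g n)) \<in> H"
proof -
  assume "f \<in> H" "g \<in> H"
  then obtain p q where "f = pfe p" "g = pfe q" unfolding H_iff by blast
  then show ?thesis using H_pfe[of "PPair p q"] by simp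
qed

lemma H_comp: "f \<in> H \<Longrightarrow> g \<in> H \<Longrightarrow> (\<lambda>n. f (g n)) \<in> H"
proof -
  assume "f \<in> H" "g \<in> H"
  then obtain p q where "f = pfe p" "g = pfe q" unfolding H_iff by blast
  then show ?thesis using H_pfe[of "PComp p q"] by simp
qed

lemma H_basic: "f \<in> set basic \<Longrightarrow> f \<in> H"
proof -
  assume "f \<in> set basic"
  then obtain i where "f = basic ! i" unfolding in_set_conv_nth by blast
  then show ?thesis using H_pfe[of "PBasic i"] by (simp only: pfe.simps)
qed

lemma H_id: "(\<lambda>n. n) \<in> H" and H_fst: "pfst \<in> H" and H_snd: "psnd \<in> H"
  by (rule H_basic, simp add: basic_def)+

lemma ar_not: "ar P \<Longrightarrow> ar (\<lambda>n. \<not> P n)"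
proof -
  assume "ar P"
  then obtain \<phi> where "sat \<phi> = P" by (auto simp: ar_def)
  then have "sat (FNand \<phi> \<phi>) = (\<lambda>n. \<not> P n)" by auto
  then show ?thesis unfolding ar_def by blast
qed

lemma ar_and: "ar P \<Longrightarrow> ar Q \<Longrightarrow> ar (\<lambda>n. P n \<and> Q n)"
proof -
  assume "ar P" "ar Q"
  then obtain \<phi> \<psi> where "sat \<phi> = P" "sat \<psi> = Q" by (auto simp: ar_def)
  then have "sat (FNand (FNand \<phi> \<psi>) (FNand \<phi> \<psi>)) = (\<lambda>n. P n \<and> Q n)" by auto
  then show ?thesis unfolding ar_def by blast
qed

lemma ar_or: "ar P \<Longrightarrow> ar Q \<Longrightarrow> ar (\<lambda>n. P n \<or> Q n)"
proof -
  assume "ar P" "ar Q"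
  from ar_not[OF ar_and[OF ar_not[OF this(1)] ar_not[OF this(2)]]] show ?thesis by simp
qed

lemma ar_imp: "ar P \<Longrightarrow> ar Q \<Longrightarrow> ar (\<lambda>n. P n \<longrightarrow> Q n)"
proof -
  assume "ar P" "ar Q"
  from ar_or[OF ar_not[OF this(1)] this(2)] show ?thesis by (simp only: imp_conv_disj)
qed

lemma ar_iff: "ar P \<Longrightarrow> ar Q \<Longrightarrow> ar (\<lambda>n. P n \<longleftrightarrow> Q n)"
proof -
  assume *: "ar P" "ar Q"
  from ar_and[OF ar_imp[OF *] ar_imp[OF *(2,1)]] show ?thesis by (simp only: iff_conv_conj_imp)
qed

lemma ar_ex: "ar (\<lambda>n. P (pfst n) (psnd n)) \<Longrightarrow> ar (\<lambda>n. \<exists>m. P n m)"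
proof -
  assume "ar (\<lambda>n. P (pfst n) (psnd n))"
  from ar_not[OF this] obtain \<phi> where "sat \<phi> = (\<lambda>n. \<not> P (pfst n) (psnd n))" by (auto simp: ar_def)
  then have "sat (FEx \<phi>) = (\<lambda>n. \<exists>m. P n m)" by (intro ext) simp
  then show ?thesis unfolding ar_def by blast
qed

lemma ar_all: "ar (\<lambda>n. P (pfst n) (psnd n)) \<Longrightarrow> ar (\<lambda>n. \<forall>m. P n m)"
proof -
  assume "ar (\<lambda>n. P (pfst n) (psnd n))"
  from ar_not[OF ar_ex[OF ar_not[OF this]]] show ?thesis by simp
qed

lemma ar_const: "ar (\<lambda>_. b)"
proof -
  have "sat FBot = (\<lambda>_. False)" by auto
  then have "ar (\<lambda>_. False)" unfolding ar_def by blast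
  with ar_not[OF this] show ?thesis by (cases b) auto
qed

lemma ar_pre: "f \<in> H \<Longrightarrow> ar P \<Longrightarrow> ar (\<lambda>n. P (f n))"
proof -
  assume "f \<in> H" "ar P"
  from ar_not[OF this(2)] this(1) obtain i \<phi> where "f = prim i" "sat \<phi> = (\<lambda>n. \<not> P n)"
    by (auto simp: ar_def)
  then have "sat (FPre i \<phi>) = (\<lambda>n. P (f n))" by auto
  then show ?thesis unfolding ar_def by blast
qed

lemma ar_base: "ar (sat FBase)"
  unfolding ar_def by blast

lemma af_H: "f \<in> H \<Longrightarrow> af f"
proof -
  assume "f \<in> H"
  then obtain i where f: "f = prim i" by blast
  have "(\<lambda>n. pr (pr i (pfst n)) (psnd n)) \<in> H" by (intro H_pair H_const H_fst H_snd)
  from ar_pre[OF this ar_base] show ?thesis by (simp add: af_def f)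
qed

lemma af_pair: "af f \<Longrightarrow> af g \<Longrightarrow> af (\<lambda>n. pr (f n) (g n))"
proof -
  assume "af f" "af g"
  have "(\<lambda>n. pr (pfst n) (pfst (psnd n))) \<in> H" "(\<lambda>n. pr (pfst n) (psnd (psnd n))) \<in> H"
    by (intro H_pair H_fst H_comp[OF H_fst H_snd] H_comp[OF H_snd H_snd])+
  from ar_and[OF ar_pre[OF this(1) \<open>af f\<close>[unfolded af_def]] ar_pre[OF this(2) \<open>af g\<close>[unfolded af_def]]]
  have "ar (\<lambda>n. f (pfst n) = pfst (psnd n) \<and> g (pfst n) = psnd (psnd n))" by simp
  moreover have "(pr a b = c) \<longleftrightarrow> a = pfst c \<and> b = psnd c" for a b c by auto
  ultimately show ?thesis unfolding af_def by simp
qed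

lemma ar_sub: "af f \<Longrightarrow> ar P \<Longrightarrow> ar (\<lambda>n. P (f n))"
proof -
  assume "af f" "ar P"
  from ar_and[OF this(1)[unfolded af_def] ar_pre[OF H_snd this(2)]]
  have "ar (\<lambda>n. f (pfst n) = psnd n \<and> P (psnd n))" .
  then have "ar (\<lambda>n. \<exists>m. f n = m \<and> P m)" by (rule ar_ex)
  then show ?thesis by simp
qed

lemma af_comp: "af f \<Longrightarrow> af g \<Longrightarrow> af (\<lambda>n. f (g n))"
proof -
  assume f: "af f" and g: "af g"
  have "(\<lambda>p. pr (pfst (pfst p)) (psnd p)) \<in> H"
    by (intro H_pair H_snd H_comp[OF H_fst H_fst])
  from ar_pre[OF this g[unfolded af_def]] have "af (\<lambda>n. g (pfst n))" by (simp add: af_def)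
  then have "af (\<lambda>n. pr (g (pfst n)) (psnd n))" by (rule af_pair[OF _ af_H[OF H_snd]])
  from ar_sub[OF this f[unfolded af_def]] show ?thesis by (simp add: af_def)
qed

lemma af_id: "af (\<lambda>n. n)" and af_const: "af (\<lambda>_. c)"
  by (intro af_H H_id H_const)+

lemma af_basic: "f \<in> set basic \<Longrightarrow> af g \<Longrightarrow> af (\<lambda>n. f (g n))"
  by (rule af_comp[OF af_H[OF H_basic]])

lemma af_basic_intros:
  "af f \<Longrightarrow> af (\<lambda>n. Suc (f n))"
  "af f \<Longrightarrow> af (\<lambda>n. pfst (f n))"
  "af f \<Longrightarrow> af (\<lambda>n. psnd (f n))"
  "af f \<Longrightarrow> af (\<lambda>n. ex_code (f n))"
  "af f \<Longrightarrow> af (\<lambda>n. nrm (f n))"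
  "af f \<Longrightarrow> af (\<lambda>n. rank (dec (f n)))"
  by (rule af_basic[of Suc] af_basic[of pfst] af_basic[of psnd] af_basic[of ex_code]
        af_basic[of nrm] af_basic[of "\<lambda>n. rank (dec n)"], simp add: basic_def, assumption)+

lemma af_basic2:
  assumes "(\<lambda>n. F (pfst n) (psnd n)) \<in> set basic" "af f" "af g"
  shows "af (\<lambda>n. F (f n) (g n))"
  using af_basic[OF assms(1) af_pair[OF assms(2,3)]] by simp

lemma af_basic2_intros:
  assumes "af f" "af g"
  shows "af (\<lambda>n. seq (f n) (g n))" "af (\<lambda>n. of_bool (f n < g n))" "af (\<lambda>n. nand_code (f n) (g n))"
    "af (\<lambda>n. pre_code (f n) (g n))" "af (\<lambda>n. lp (f n) (g n))"
  by (rule af_basic2[OF _ assms], simp add: basic_def)+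

lemma af_cut_rel: "af f \<Longrightarrow> af g \<Longrightarrow> af h \<Longrightarrow> af (\<lambda>n. cut_rel (f n) (g n) (h n))"
  using af_basic[of "\<lambda>n. cut_rel (pfst n) (pfst (psnd n)) (psnd (psnd n))" "\<lambda>n. pr (f n) (pr (g n) (h n))"]
  by (simp add: af_pair basic_def)

lemma af_prim: "af f \<Longrightarrow> af g \<Longrightarrow> af (\<lambda>n. prim (f n) (g n))"
proof -
  have "af (\<lambda>n. prim (pfst n) (psnd n))" using ar_base unfolding af_def
    by (rule back_subst[of ar]) (rule ext, simp)
  then show "af f \<Longrightarrow> af g \<Longrightarrow> ?thesis"
    using af_comp[of "\<lambda>n. prim (pfst n) (psnd n)" "\<lambda>n. pr (f n) (g n)"] af_pair[of f g] by simp
qed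

lemma ar_eq: "af f \<Longrightarrow> af g \<Longrightarrow> ar (\<lambda>n. f n = g n)"
  using ar_sub[OF af_pair[OF af_id, of g], of "\<lambda>n. f (pfst n) = psnd n"] by (simp add: af_def[of f])

lemma ar_less: "af f \<Longrightarrow> af g \<Longrightarrow> ar (\<lambda>n. f n < g n)"
  using ar_eq[OF af_basic2_intros(2)[of f g] af_const[of 1]] by (simp del: One_nat_def)

lemma ar_le: "af f \<Longrightarrow> af g \<Longrightarrow> ar (\<lambda>n. f n \<le> g n)"
  using ar_not[OF ar_less, of g f] by (simp add: not_less)

lemmas af_intros = af_id af_const af_pair af_basic_intros af_basic2_intros af_cut_rel af_prim
lemmas ar_intros = ar_not ar_and ar_or ar_imp ar_iff ar_eq ar_less ar_le ar_const

lemma af_relI: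
  assumes "\<And>n m. f n = m \<longleftrightarrow> P n m" "ar (\<lambda>n. P (pfst n) (psnd n))"
  shows "af f"
  using assms(2) unfolding af_def assms(1) .

lemma af_char:
  assumes "ar P"
  shows "af (\<lambda>n. if P n then 0 else 1)"
  by (rule af_relI[where P = "\<lambda>n m. P n \<and> m = 0 \<or> \<not> P n \<and> m = 1"], force)
    (intro ar_intros af_intros ar_sub[OF _ assms])

lemma seq_exists: "\<exists>c. \<forall>i\<le>k. seq c i = f i"
  by (rule exI[of _ "list_encode (map f [0..<Suc k])"]) (simp add: seq_def del: upt_Suc)

text \<open>Goedel's device: a value of the recursion is described through a code of the finite
  sequence of all earlier values.\<close>

lemma af_rec:
  assumes f: "af f" and g: "af g" and h: "af h"
  shows "af (\<lambda>n. rec_nat (f n) (\<lambda>m a. g (pr n (pr a m))) (h n))"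
proof (rule af_relI)
  let ?P = "\<lambda>n y. \<exists>c. seq c 0 = f n \<and> (\<forall>m. m < h n \<longrightarrow> seq c (Suc m) = g (pr n (pr (seq c m) m))) \<and> seq c (h n) = y"
  show "rec_nat (f n) (\<lambda>m a. g (pr n (pr a m))) (h n) = y \<longleftrightarrow> ?P n y" for n y
  proof
    let ?r = "rec_nat (f n) (\<lambda>m a. g (pr n (pr a m)))"
    assume "?r (h n) = y"
    moreover obtain c where "\<forall>i\<le>h n. seq c i = ?r i" using seq_exists[of "h n" ?r] by blast
    ultimately show "?P n y" by (intro exI[of _ c]) auto
  next
    assume "?P n y"
    then obtain c where c: "seq c 0 = f n" "\<And>m. m < h n \<Longrightarrow> seq c (Suc m) = g (pr n (pr (seq c m) m))"
      "seq c (h n) = y" by blast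
    have "m \<le> h n \<Longrightarrow> rec_nat (f n) (\<lambda>m a. g (pr n (pr a m))) m = seq c m" for m
      by (induction m) (auto simp: c)
    then show "rec_nat (f n) (\<lambda>m a. g (pr n (pr a m))) (h n) = y" using c by simp
  qed
  show "ar (\<lambda>n. ?P (pfst n) (psnd n))"
    by (rule ar_ex) (intro ar_intros ar_all af_intros af_comp[OF f] af_comp[OF g] af_comp[OF h])
qed

section \<open>Definability of truth for bounded rank\<close>

definition succ_rel :: "nat \<Rightarrow> nat \<Rightarrow> bool" where
  "succ_rel n q \<longleftrightarrow> (nrm (pfst n) = enc FBase \<and> sat FBase (psnd n) \<and> q = pr (enc FBot) 0) \<or>
    (\<exists>a. \<exists>b. nrm (pfst n) = nand_code a b \<and> (q = pr a (psnd n) \<or> q = pr b (psnd n))) \<or>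
    (\<exists>a. \<exists>m. nrm (pfst n) = ex_code a \<and> q = pr a (pr (psnd n) m)) \<or>
    (\<exists>i. \<exists>a. nrm (pfst n) = pre_code i a \<and> q = pr a (prim i (psnd n)))"

definition tr :: "nat \<Rightarrow> bool" where "tr n = sat (dec (pfst n)) (psnd n)"
definition rk :: "nat \<Rightarrow> nat" where "rk n = rank (dec (pfst n))"

lemma ar_succ_rel: "af f \<Longrightarrow> af g \<Longrightarrow> ar (\<lambda>n. succ_rel (f n) (g n))"
proof -
  have "ar (\<lambda>n. succ_rel (pfst n) (psnd n))" unfolding succ_rel_def
    by (intro ar_intros ar_ex af_intros ar_sub[OF _ ar_base])
  from ar_sub[OF af_pair this, of f g] show "af f \<Longrightarrow> af g \<Longrightarrow> ?thesis" by simp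
qed

text \<open>Truth is the winning condition of the game along \<open>succ_rel\<close>, in which ranks decrease.\<close>

lemma succ_rel_rk: "succ_rel n q \<Longrightarrow> rk q < rk n"
  unfolding succ_rel_def nrm_def nand_code_def ex_code_def pre_code_def to_nat_split rk_def
  by (auto dest!: injD[OF inj_to_nat] simp: less_Suc_eq_le)

lemma tr_iff: "tr n \<longleftrightarrow> (\<exists>q. succ_rel n q \<and> \<not> tr q)"
proof -
  have s: "\<exists>a. dec a = \<phi>" for \<phi> by (metis from_nat_to_nat)
  show ?thesis
    unfolding succ_rel_def nrm_def nand_code_def ex_code_def pre_code_def tr_def to_nat_split
    by (cases "dec (pfst n)") (auto dest!: injD[OF inj_to_nat] intro: s, (metis from_nat_to_nat pr_simps(1,2))+)
qed

text \<open>By \<open>tr_iff\<close>, one quantifier over successors leads from rank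
  \<open>K\<close> to rank \<open>Suc K\<close>. The defining formula grows with \<open>K\<close>,
  so nothing follows about truth without a bound.\<close>

lemma ar_tr_bounded: "ar (\<lambda>n. rk n \<le> K \<and> tr n)"
proof (induction K)
  case 0
  \<comment> \<open>A true position has a successor, and that successor has smaller rank.\<close>
  have "\<not> (rk n \<le> 0 \<and> tr n)" for n using tr_iff[of n] succ_rel_rk[of n] by force
  then have "(\<lambda>n. rk n \<le> 0 \<and> tr n) = (\<lambda>_. False)" by blast
  then show ?case using ar_const[of False] by (simp only:)
next
  case (Suc K)
  have "rk n \<le> Suc K \<and> tr n \<longleftrightarrow> rk n \<le> Suc K \<and> (\<exists>q. succ_rel n q \<and> \<not> (rk q \<le> K \<and> tr q))" for n
    using tr_iff[of n] succ_rel_rk[of n] by (auto simp: less_le_trans less_Suc_eq_le) (meson leD less_le_trans not_less_eq_eq)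
  moreover have "ar (\<lambda>n. rk n \<le> Suc K \<and> (\<exists>q. succ_rel n q \<and> \<not> (rk q \<le> K \<and> tr q)))"
    unfolding rk_def
    by (intro ar_intros af_intros ar_ex ar_succ_rel ar_sub[OF _ Suc[unfolded rk_def]])
  ultimately show ?case by simp
qed

text \<open>Tarski's argument: the formula saying that the formula coded by \<open>n\<close> is
  false at \<open>n\<close> is applied to its own code.\<close>

lemma not_ar_tr: "\<not> ar tr"
proof
  assume "ar tr"
  have "ar (\<lambda>n. \<not> tr (pr n n))" by (intro ar_not ar_sub[OF _ \<open>ar tr\<close>] af_intros)
  then obtain \<phi> where "sat \<phi> = (\<lambda>n. \<not> tr (pr n n))" by (auto simp: ar_def)
  then have "sat \<phi> (enc \<phi>) \<longleftrightarrow> \<not> tr (pr (enc \<phi>) (enc \<phi>))" by metis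
  then show False by (simp add: tr_def)
qed

section \<open>An arithmetical injection on cuts\<close>

definition codes :: "nat \<Rightarrow> nat \<Rightarrow> fn \<Rightarrow> bool" where
  "codes k e f \<longleftrightarrow> rank (dec e) \<le> k \<and> (\<forall>q. tr (pr e q) \<longleftrightarrow> q \<in> cut f)"

text \<open>Minimising the rank before the code makes the index function available level by level.\<close>

definition index :: "fn \<Rightarrow> nat" where
  "index f = (let k = LEAST k. \<exists>e. codes k e f in pr k (LEAST e. codes k e f))"

lemma mem_cut: "q \<in> cut f \<longleftrightarrow> (\<exists>m. cut_rel q (f m) m = 0)"
  by (auto simp: cut_def cut_rel_def)

text \<open>All columns of \<open>f\<close> are instances of one formula. Fixing the column number
  costs a constant amount of rank, whatever that number is.\<close>

lemma codes_bound:
  assumes "af f"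
  shows "\<exists>K. \<forall>n. \<exists>e. codes K e (col f n)"
proof -
  have "ar (\<lambda>p. psnd p \<in> cut (col f (pfst p)))" unfolding mem_cut
    by (intro ar_ex ar_intros af_intros af_comp[OF assms])
  then obtain \<phi> where \<phi>: "sat \<phi> = (\<lambda>p. psnd p \<in> cut (col f (pfst p)))" by (auto simp: ar_def)
  \<comment> \<open>\<open>FPre\<close> substitutes the column number but also negates, and
    \<open>FNand\<close> of the result with itself undoes the negation; this accounts for the
    increase by 2.\<close>
  have "codes (rank \<phi> + 2) (enc (FNand (FPre i \<phi>) (FPre i \<phi>))) (col f n)" if "prim i = (\<lambda>q. pr n q)" for i n
    using that \<phi> by (simp add: codes_def tr_def)
  moreover have "\<exists>i. prim i = (\<lambda>q. pr n q)" for n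
    using H_pair[OF H_const[of n] H_id] by (metis rangeE)
  ultimately show ?thesis by blast
qed

text \<open>A description of the graph of \<open>index\<close> that only refers to levels up to
  \<open>K\<close>, where bounded truth is available.\<close>

lemma codes_index:
  assumes "codes K e f"
  shows "index f = y \<longleftrightarrow> pfst y \<le> K \<and> codes (pfst y) (psnd y) f \<and> (\<forall>k. k < pfst y \<longrightarrow> (\<forall>e. \<not> codes k e f)) \<and>
    (\<forall>e. e < psnd y \<longrightarrow> \<not> codes (pfst y) e f)"
proof -
  define k where "k = (LEAST k. \<exists>e. codes k e f)"
  define e' where "e' = (LEAST e. codes k e f)"
  have k: "\<exists>e. codes k e f" "k \<le> K" "\<And>k' e. k' < k \<Longrightarrow> \<not> codes k' e f"
    using LeastI[of "\<lambda>k. \<exists>e. codes k e f" K] Least_le[of "\<lambda>k. \<exists>e. codes k e f" K] assms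
      not_less_Least[of _ "\<lambda>k. \<exists>e. codes k e f"] unfolding k_def[symmetric] by blast+
  have e': "codes k e' f" "\<And>e. e < e' \<Longrightarrow> \<not> codes k e f"
    using k(1) unfolding e'_def by (auto intro: LeastI dest: not_less_Least)
  have ix: "index f = pr k e'" by (simp add: index_def k_def e'_def Let_def)
  show ?thesis
  proof
    assume "index f = y"
    then show "pfst y \<le> K \<and> codes (pfst y) (psnd y) f \<and> (\<forall>k. k < pfst y \<longrightarrow> (\<forall>e. \<not> codes k e f)) \<and>
      (\<forall>e. e < psnd y \<longrightarrow> \<not> codes (pfst y) e f)" using ix k e' by auto
  next
    assume y: "pfst y \<le> K \<and> codes (pfst y) (psnd y) f \<and> (\<forall>k. k < pfst y \<longrightarrow> (\<forall>e. \<not> codes k e f)) \<and>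
      (\<forall>e. e < psnd y \<longrightarrow> \<not> codes (pfst y) e f)"
    then have "pfst y = k" using k e'(1) by (metis linorder_neqE_nat)
    moreover from this have "psnd y = e'" using y e' by (metis linorder_neqE_nat)
    ultimately show "index f = y" using ix pr_simps(3) by metis
  qed
qed

lemma af_index:
  assumes "af f"
  shows "af (\<lambda>n. index (col f n))"
proof -
  obtain K where K: "\<And>n. \<exists>e. codes K e (col f n)" using codes_bound[OF assms] by blast
  \<comment> \<open>For \<open>k\<close> at most \<open>K\<close>, the first conjunct already
    implies the bound on \<open>rk\<close>, so \<open>C\<close> agrees with \<open>codes\<close>
    there while only using truth of rank at most \<open>K\<close>.\<close>
  define C where "C k e n \<longleftrightarrow> rank (dec e) \<le> k \<and> (\<forall>q. (rk (pr e q) \<le> K \<and> tr (pr e q)) \<longleftrightarrow> (\<exists>m. cut_rel q (f (pr n m)) m = 0))"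
    for k e n
  have C: "codes k e (col f n) \<longleftrightarrow> C k e n" if "k \<le> K" for k e n
    using that by (auto simp: codes_def C_def mem_cut rk_def)
  have ar_C: "ar (\<lambda>n. C (k n) (e n) (i n))" if "af k" "af e" "af i" for k e i
  proof -
    have "ar (\<lambda>p. C (pfst p) (pfst (psnd p)) (psnd (psnd p)))" unfolding C_def
      by (intro ar_all ar_ex ar_intros af_intros af_comp[OF assms] ar_sub[OF _ ar_tr_bounded])
    from ar_sub[OF af_pair[OF that(1) af_pair[OF that(2,3)]] this] show ?thesis by simp
  qed
  show ?thesis
  proof (rule af_relI)
    fix n y
    obtain e where "codes K e (col f n)" using K by blast
    from codes_index[OF this, of y] show "index (col f n) = y \<longleftrightarrow> pfst y \<le> K \<and> C (pfst y) (psnd y) n \<and>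
      (\<forall>k. k < pfst y \<longrightarrow> (\<forall>e. \<not> C k e n)) \<and> (\<forall>e. e < psnd y \<longrightarrow> \<not> C (pfst y) e n)"
      using C by (metis less_imp_le order_trans)
  next
    show "ar (\<lambda>p. pfst (psnd p) \<le> K \<and> C (pfst (psnd p)) (psnd (psnd p)) (pfst p) \<and>
      (\<forall>k. k < pfst (psnd p) \<longrightarrow> (\<forall>e. \<not> C k e (pfst p))) \<and>
      (\<forall>e. e < psnd (psnd p) \<longrightarrow> \<not> C (pfst (psnd p)) e (pfst p)))"
      by (intro ar_all ar_intros af_intros ar_C)
  qed
qed

text \<open>The search oracle has the default 0 where no zero exists, so that its graph has an
  explicit arithmetical description for every argument.\<close>

definition arith_orc :: orcs where
  "arith_orc i f =
    (if i = 0 then if \<exists>n. f n = 0 then LEAST n. f n = 0 else 0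
     else if i = 1 then index f
     else if i = 2 then if \<exists>n. f n = 0 then 0 else 1
     else 0)"

lemma af_orc:
  assumes "af f"
  shows "af (\<lambda>n. arith_orc i (col f n))"
proof -
  have "af (\<lambda>n. if \<exists>m. f (pr n m) = 0 then LEAST m. f (pr n m) = 0 else 0)"
  proof (rule af_relI)
    show "(if \<exists>m. f (pr n m) = 0 then LEAST m. f (pr n m) = 0 else 0) = y \<longleftrightarrow>
        f (pr n y) = 0 \<and> (\<forall>m. m < y \<longrightarrow> f (pr n m) \<noteq> 0) \<or> y = 0 \<and> (\<forall>m. f (pr n m) \<noteq> 0)" for n y
    proof (cases "\<exists>m. f (pr n m) = 0")
      case True
      let ?L = "LEAST m. f (pr n m) = 0"
      have L: "f (pr n ?L) = 0" "\<And>m. m < ?L \<Longrightarrow> f (pr n m) \<noteq> 0"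
        using LeastI_ex[OF True] not_less_Least by blast+
      have "?L = y \<longleftrightarrow> f (pr n y) = 0 \<and> (\<forall>m. m < y \<longrightarrow> f (pr n m) \<noteq> 0)"
        using L by (metis linorder_neqE_nat)
      moreover have "\<not> (\<forall>m. f (pr n m) \<noteq> 0)" using True by blast
      ultimately show ?thesis using True by (simp only: if_True simp_thms)
    next
      case False
      then show ?thesis by (auto simp only: if_False)
    qed
    show "ar (\<lambda>p. f (pr (pfst p) (psnd p)) = 0 \<and> (\<forall>m. m < psnd p \<longrightarrow> f (pr (pfst p) m) \<noteq> 0) \<or>
        psnd p = 0 \<and> (\<forall>m. f (pr (pfst p) m) \<noteq> 0))"
      by (intro ar_all ar_intros af_intros af_comp[OF assms])
  qed
  moreover have "af (\<lambda>n. if \<exists>m. f (pr n m) = 0 then 0 else 1)"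
    by (intro af_char ar_ex ar_intros af_intros af_comp[OF assms])
  ultimately show ?thesis using af_index[OF assms] af_const[of 0]
    unfolding arith_orc_def by (cases "i = 0"; cases "i = 1"; cases "i = 2") auto
qed

text \<open>The index contains a code from which the cut can be read off. Conversely,
  \<open>codes\<close>, and with it \<open>index\<close>, depends on \<open>f\<close> only through
  its cut.\<close>

lemma index_eq_iff:
  assumes "af f" "af g"
  shows "index f = index g \<longleftrightarrow> cut f = cut g"
proof
  have ex: "\<exists>K e. codes K e f" if f: "af f" for f
  proof -
    have "ar (\<lambda>q. q \<in> cut f)" unfolding mem_cut by (intro ar_ex ar_intros af_intros af_comp[OF f])
    then obtain \<phi> where "sat \<phi> = (\<lambda>q. q \<in> cut f)" by (auto simp: ar_def)
    then have "codes (rank \<phi>) (enc \<phi>) f" by (simp add: codes_def tr_def)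
    then show ?thesis by blast
  qed
  assume "index f = index g"
  moreover obtain K e K' e' where "codes K e f" "codes K' e' g" using ex assms by blast
  ultimately have "codes (pfst (index f)) (psnd (index f)) f" "codes (pfst (index f)) (psnd (index f)) g"
    using codes_index by metis+
  then show "cut f = cut g" unfolding codes_def by blast
next
  assume "cut f = cut g"
  then have "codes k e f = codes k e g" for k e by (simp add: codes_def)
  then show "index f = index g" by (simp add: index_def)
qed

interpretation arith: model "{f. af f}" arith_orc
proof
  show "f (arith_orc 0 f) = 0" if "\<exists>n. f n = 0" for f
    using that by (auto simp: arith_orc_def intro: LeastI)
  show "arith_orc 1 f = arith_orc 1 g \<longleftrightarrow> cut f = cut g" if "f \<in> {f. af f}" "g \<in> {f. af f}" for f g
    using that index_eq_iff by (simp add: arith_orc_def)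
  show "(\<lambda>n. rec_nat (f n) (\<lambda>m a. g (pr n (pr a m))) (h n)) \<in> {f. af f}"
    if "f \<in> {f. af f}" "g \<in> {f. af f}" "h \<in> {f. af f}" for f g h
    using that af_rec by simp
  show "(\<lambda>n. f (g n)) \<in> {f. af f}" if "f \<in> {f. af f}" "g \<in> {f. af f}" for f g
    using that af_comp by simp
  show "(\<lambda>n. arith_orc i (col f n)) \<in> {f. af f}" if "f \<in> {f. af f}" for f i
    using that af_orc by simp
  show "arith_orc 2 f = (if \<exists>n. f n = 0 then 0 else 1)" for f by (simp add: arith_orc_def)
qed (simp_all add: af_id af_const af_pair af_basic_intros(1-3)[OF af_id])

section \<open>Recursion along the natural numbers\<close>

lemma lp_inject [simp]: "lp i j = lp i' j' \<longleftrightarrow> i = i' \<and> j = j'"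
proof
  assume eq: "lp i j = lp i' j'"
  \<comment> \<open>The value \<open>lp i j\<close> lies strictly below the next square after that
    of \<open>i + j\<close>, so it determines the sum and then \<open>i\<close>.\<close>
  have "\<not> i + j < i' + j'" if "lp i j = lp i' j'" for i j i' j'
  proof
    assume "i + j < i' + j'"
    then have "Suc (i + j) * Suc (i + j) \<le> (i' + j') * (i' + j')" by (intro mult_le_mono) auto
    then show False using that by (simp add: lp_def)
  qed
  from this[OF eq] this[OF eq[symmetric]] have "i + j = i' + j'" by simp
  then show "i = i' \<and> j = j'" using eq by (simp add: lp_def)
qed simp

definition order_fn :: fn where
  "order_fn n = (if \<exists>i j. n = lp i j \<and> i \<le> j then 0 else 1)"

text \<open>Zeros are members. A successor \<open>q\<close> is stored together with its rank, that
  is, as the pair at which the solution of the recursion records whether \<open>q\<close> is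
  true.\<close>

definition succ_fn :: fn where
  "succ_fn n = (if \<exists>a q. n = lp a (lp q (rk q)) \<and> succ_rel a q then 0 else 1)"

lemma order_fn_eq: "order_fn (lp i j) = 0 \<longleftrightarrow> i \<le> j"
  by (auto simp: order_fn_def)

lemma succ_fn_eq: "succ_fn (lp a p) = 0 \<longleftrightarrow> (\<exists>q. p = lp q (rk q) \<and> succ_rel a q)"
  by (auto simp: succ_fn_def)

lemma af_order_fn: "af order_fn"
  unfolding order_fn_def[abs_def] by (intro af_char ar_ex ar_intros af_intros)

lemma af_succ_fn: "af succ_fn"
  unfolding succ_fn_def[abs_def] rk_def by (intro af_char ar_ex ar_intros af_intros ar_succ_rel)

text \<open>A solution of this recursion along \<open>\<omega>\<close> computes the truth of the codes of rank \<open>j\<close> in its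
  \<open>j\<close>-th column.\<close>

lemma recursion_tr:
  assumes "\<And>n j. y (lp n j) = 0 \<longleftrightarrow>
    (\<exists>p. succ_fn (lp n p) = 0 \<and> \<not> (\<exists>m i. p = lp m i \<and> i < j \<and> y p = 0))"
  shows "y (lp n (rk n)) = 0 \<longleftrightarrow> tr n"
proof (induction "rk n" arbitrary: n rule: less_induct)
  case less
  have "y (lp n (rk n)) = 0 \<longleftrightarrow> (\<exists>q. succ_rel n q \<and> \<not> (rk q < rk n \<and> y (lp q (rk q)) = 0))"
    unfolding assms[of n "rk n"] succ_fn_eq by auto
  also have "\<dots> \<longleftrightarrow> (\<exists>q. succ_rel n q \<and> \<not> tr q)" using less succ_rel_rk by blast
  finally show ?case by (simp only: tr_iff[of n])
qed

text \<open>The formula iterated by the recursion, with number variable \<open>Var 0 N\<close>, set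
  variable \<open>Var 0 N1\<close> and parameter \<open>Var 1 N1\<close>, which will hold
  \<open>succ_fn\<close>. It says that some successor is not recorded as true, so by
  \<open>tr_iff\<close> it computes truth at one rank from truth at the smaller ranks.\<close>

definition jump_fm :: fm where
  "jump_fm = Ex 2 N (And (Mem (l2_pair (Var 0 N) (Var 2 N)) (Var 1 N1)) (Neg (Mem (Var 2 N) (Var 0 N1))))"

lemma arithmetical_jump: "arithmetical jump_fm"
  unfolding jump_fm_def l2_pair_def
  by (intro arithmetical.intros l2_term.intros)

context frame
begin

lemma val_l2_pair [simp]:
  assumes "proper s" "well_typed a" "typ_of a = N" "well_typed b" "typ_of b = N"
  shows "val (den s (l2_pair a b)) = lp (val (den s a)) (val (den s b))"
  unfolding l2_pair_def lp_def using assms by simp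

lemma types_l2_pair [simp]:
  assumes "well_typed a" "typ_of a = N" "well_typed b" "typ_of b = N"
  shows "well_typed (l2_pair a b)" "typ_of (l2_pair a b) = N"
  unfolding l2_pair_def using assms by simp_all

lemma holds_well_order:
  assumes "proper s" "fnv (s (3, N1)) = order_fn"
  shows "holds s (well_order (Var 3 N1) 4)"
proof -
  have "holds s (linear_order (Var 3 N1) 4)"
    unfolding linear_order_def in_field_def builder_defs Mem_def
    using assms by (auto simp: order_fn_eq)
  moreover have "\<exists>x. has_ty A x N \<and> \<not> fnv f (Suc (val x)) < fnv f (val x)" for f
  proof (rule ccontr)
    assume "\<not> ?thesis"
    then have "fnv f (Suc n) < fnv f n" for n by (metis num_in_D(2) val_num)
    then show False using wf_less wf_iff_no_infinite_down_chain[of "{(x, y :: nat). x < y}"] by auto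
  qed
  ultimately show ?thesis
    unfolding well_order_def in_field_def ord_less_def builder_defs Mem_def
    using assms by (simp add: order_fn_eq) (metis not_le linorder_neqE_nat)
qed

lemma holds_All_N:
  assumes "proper s" "wf_fm \<phi>"
  shows "holds s (All i N \<phi>) \<longleftrightarrow> (\<forall>n. holds (s((i, N) := num n)) \<phi>)"
  unfolding holds.simps using holds_num[OF assms] num_in_D(2) by metis

lemma holds_Ex_N:
  assumes "proper s" "wf_fm \<phi>"
  shows "holds s (Ex i N \<phi>) \<longleftrightarrow> (\<exists>n. holds (s((i, N) := num n)) \<phi>)"
  using holds_All_N[OF assms(1), of "Neg \<phi>" i] assms(2) unfolding holds.simps(2,3) wf_fm.simps by simp

lemma holds_All_N1:
  assumes "proper s" "wf_fm \<phi>"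
  shows "holds s (All i N1 \<phi>) \<longleftrightarrow> (\<forall>f\<in>A. holds (s((i, N1) := CFun f)) \<phi>)"
  unfolding holds.simps using holds_Fun[OF assms] Fun_in_D fnv_in_A by (metis mem_Collect_eq)

lemma holds_builders:
  "holds s ((P \<^bold>\<and> Q) d) \<longleftrightarrow> holds s (P d) \<and> holds s (Q d)"
  "holds s ((P \<^bold>\<longrightarrow> Q) d) \<longleftrightarrow> (holds s (P d) \<longrightarrow> holds s (Q d))"
  "holds s ((P \<^bold>\<longleftrightarrow> Q) d) \<longleftrightarrow> (holds s (P d) \<longleftrightarrow> holds s (Q d))"
  "holds s ((\<^bold>\<not> P) d) \<longleftrightarrow> \<not> holds s (P d)"
  "holds s ((t \<doteq> u) d) \<longleftrightarrow> val (den s t) = val (den s u)"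
  "holds s ((t \<^bold>\<in> u) d) \<longleftrightarrow> val (den s (u \<cdot> t)) = 0"
  "holds s (all_var i N1 P d) \<longleftrightarrow> holds s (All i N1 (P d))"
  by (auto simp: builder_defs Mem_def)

lemma wf_builders:
  "wf_fm ((P \<^bold>\<and> Q) d) \<longleftrightarrow> wf_fm (P d) \<and> wf_fm (Q d)"
  "wf_fm ((P \<^bold>\<longrightarrow> Q) d) \<longleftrightarrow> wf_fm (P d) \<and> wf_fm (Q d)"
  "wf_fm ((P \<^bold>\<longleftrightarrow> Q) d) \<longleftrightarrow> wf_fm (P d) \<and> wf_fm (Q d)"
  "wf_fm ((\<^bold>\<not> P) d) \<longleftrightarrow> wf_fm (P d)"
  "wf_fm ((t \<doteq> u) d) \<longleftrightarrow> wf_fm (Eq t u)"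
  "wf_fm ((t \<^bold>\<in> u) d) \<longleftrightarrow> wf_fm (Eq (u \<cdot> t) Zero)"
  "wf_fm (all \<tau> F d) \<longleftrightarrow> wf_fm (F (Var d \<tau>) (Suc d))"
  "wf_fm (ex \<tau> F d) \<longleftrightarrow> wf_fm (F (Var d \<tau>) (Suc d))"
  "wf_fm (all_var i \<tau> P d) \<longleftrightarrow> wf_fm (P d)"
  "wf_fm (ex_var i \<tau> P d) \<longleftrightarrow> wf_fm (P d)"
  by (auto simp: builder_defs Mem_def)

lemma holds_quantifiers:
  assumes "proper s"
  shows "wf_fm (F (Var d N) (Suc d)) \<Longrightarrow>
      holds s (all N F d) \<longleftrightarrow> (\<forall>n. holds (s((d, N) := num n)) (F (Var d N) (Suc d)))"
    and "wf_fm (F (Var d N) (Suc d)) \<Longrightarrow>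
      holds s (ex N F d) \<longleftrightarrow> (\<exists>n. holds (s((d, N) := num n)) (F (Var d N) (Suc d)))"
    and "wf_fm (P d) \<Longrightarrow> holds s (ex_var i N P d) \<longleftrightarrow> (\<exists>n. holds (s((i, N) := num n)) (P d))"
  unfolding all_def ex_def ex_var_def using holds_All_N[OF assms] holds_Ex_N[OF assms] by simp_all

lemmas holds_rules = holds_builders holds_quantifiers wf_builders

text \<open>The names result from starting the builder at 3: the order has name 3, the solution 4,
  and inside the recursion the pair has name 5 and the stage name 6. Name 0 belongs to the variables
  of \<open>jump_fm\<close>.\<close>

lemma holds_is_below:
  assumes "proper s" "fnv (s (3, N1)) = order_fn"
  shows "holds s (is_below (Var 3 N1) (Var 4 N1) (Var 6 N) (Var 0 N1) 7) \<longleftrightarrow>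
    (\<forall>p. fnv (s (0, N1)) p = 0 \<longleftrightarrow> (\<exists>m i. p = lp m i \<and> i < val (s (6, N)) \<and> fnv (s (4, N1)) p = 0))"
proof -
  have less: "i \<le> j \<and> j \<noteq> i \<and> b \<longleftrightarrow> i < j \<and> b" for i j :: nat and b by auto
  show ?thesis using assms unfolding is_below_def ord_less_def
    by (simp add: holds_rules order_fn_eq less not_le order_less_imp_le cong: conj_cong)
qed

lemma holds_jump:
  assumes "proper s" "fnv (s (1, N1)) = succ_fn"
  shows "holds s jump_fm \<longleftrightarrow> (\<exists>p. succ_fn (lp (val (s (0, N))) p) = 0 \<and> fnv (s (0, N1)) p \<noteq> 0)"
  unfolding jump_fm_def Mem_def using assms
  by (subst holds_Ex_N) (simp_all del: holds.simps(4))

lemma wf_jump [simp]: "wf_fm jump_fm"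
  by (simp add: jump_fm_def Mem_def)

lemma wf_is_below [simp]: "wf_fm (is_below (Var 3 N1) (Var 4 N1) (Var 6 N) (Var 0 N1) d)"
  by (simp add: is_below_def ord_less_def builder_defs Mem_def)

text \<open>The recursion formula refers to the earlier stages through a universal quantifier over
  sets. By the hypothesis \<open>below\<close> such a set exists in the model, so the quantifier is
  not vacuous, and all such sets have the same zeros, so it can be eliminated.\<close>

lemma holds_recursion:
  assumes s: "proper s" "fnv (s (3, N1)) = order_fn" "fnv (s (1, N1)) = succ_fn"
    and rec: "holds s (recursion_along jump_fm 0 0 (Var 3 N1) (Var 4 N1) 5)"
    and below: "\<And>j. \<exists>z\<in>A. \<forall>p. z p = 0 \<longleftrightarrow> (\<exists>m i. p = lp m i \<and> i < j \<and> fnv (s (4, N1)) p = 0)"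
  shows "fnv (s (4, N1)) (lp n j) = 0 \<longleftrightarrow>
    (\<exists>p. succ_fn (lp n p) = 0 \<and> \<not> (\<exists>m i. p = lp m i \<and> i < j \<and> fnv (s (4, N1)) p = 0))"
proof -
  let ?y = "fnv (s (4, N1))"
  let ?below = "\<lambda>j z. \<forall>p. z p = 0 \<longleftrightarrow> (\<exists>m i. p = lp m i \<and> i < j \<and> ?y p = 0)"
  let ?s = "\<lambda>q j a. s((5, N) := num q, (6, N) := num j, (0, N) := num a)"
  have s': "proper (?s q j a)" for q j a using s(1) by simp
  have below_jump: "holds (?s q j a) (all_var 0 N1 (is_below (Var 3 N1) (Var 4 N1) (Var 6 N) (Var 0 N1) \<^bold>\<longrightarrow> (\<lambda>d. jump_fm)) 7) \<longleftrightarrow>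
      (\<forall>z\<in>A. ?below j z \<longrightarrow> (\<exists>p. succ_fn (lp a p) = 0 \<and> z p \<noteq> 0))" for q j a
    using s s' Fun_in_D
    by (simp add: holds_rules holds_All_N1 holds_is_below holds_jump del: holds.simps(4))
  have "holds s (recursion_along jump_fm 0 0 (Var 3 N1) (Var 4 N1) 5) \<longleftrightarrow> (\<forall>q. ?y q = 0 \<longleftrightarrow> (\<exists>j a. q = lp a j \<and>
      (\<forall>z\<in>A. ?below j z \<longrightarrow> (\<exists>p. succ_fn (lp a p) = 0 \<and> z p \<noteq> 0))))"
    using s s' unfolding recursion_along_def in_field_def
    by (simp add: holds_rules order_fn_eq below_jump[unfolded all_var_def] del: holds.simps(3,4))
  note rec_iff = this
  have rec': "?y q = 0 \<longleftrightarrow> (\<exists>j a. q = lp a j \<and>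
      (\<forall>z\<in>A. ?below j z \<longrightarrow> (\<exists>p. succ_fn (lp a p) = 0 \<and> z p \<noteq> 0)))" for q
    by (rule rec_iff[THEN iffD1, OF rec, THEN spec])
  obtain z where z: "z \<in> A" "?below j z" using below by blast
  have "(\<forall>z\<in>A. ?below j z \<longrightarrow> (\<exists>p. succ_fn (lp n p) = 0 \<and> z p \<noteq> 0)) \<longleftrightarrow>
      (\<exists>p. succ_fn (lp n p) = 0 \<and> \<not> (\<exists>m i. p = lp m i \<and> i < j \<and> ?y p = 0))"
  proof
    assume "\<forall>z\<in>A. ?below j z \<longrightarrow> (\<exists>p. succ_fn (lp n p) = 0 \<and> z p \<noteq> 0)"
    from bspec[OF this z(1)] z(2) obtain p where "succ_fn (lp n p) = 0" "z p \<noteq> 0" by blast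
    then show "\<exists>p. succ_fn (lp n p) = 0 \<and> \<not> (\<exists>m i. p = lp m i \<and> i < j \<and> ?y p = 0)"
      unfolding z(2)[THEN spec, of p] by (intro exI conjI)
  next
    assume "\<exists>p. succ_fn (lp n p) = 0 \<and> \<not> (\<exists>m i. p = lp m i \<and> i < j \<and> ?y p = 0)"
    then obtain p where p: "succ_fn (lp n p) = 0" "\<not> (\<exists>m i. p = lp m i \<and> i < j \<and> ?y p = 0)" by (elim exE conjE)
    show "\<forall>z\<in>A. ?below j z \<longrightarrow> (\<exists>p. succ_fn (lp n p) = 0 \<and> z p \<noteq> 0)"
    proof (intro ballI impI exI conjI)
      show "succ_fn (lp n p) = 0" by fact
      fix z assume "?below j z"
      then show "z p \<noteq> 0" using p(2) spec by metis
    qed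
  qed
  moreover have "?y (lp n j) = 0 \<longleftrightarrow> (\<forall>z\<in>A. ?below j z \<longrightarrow> (\<exists>p. succ_fn (lp n p) = 0 \<and> z p \<noteq> 0))"
    by (subst rec'[of "lp n j"]) (simp only: lp_inject, blast)
  ultimately show ?thesis by (simp only:)
qed

end

theorem ACA0_omega_not_ATR0: "\<not> (\<forall>\<phi>\<in>ATR0. ACA0_omega \<union> {CBT, PST} \<turnstile> \<phi>)"
proof
  assume der: "\<forall>\<phi>\<in>ATR0. ACA0_omega \<union> {CBT, PST} \<turnstile> \<phi>"
  \<comment> \<open>The builder starts above the names 0, 1 and 2 that occur in
    \<open>jump_fm\<close>; the parameter \<open>Var 1 N1\<close> stays free in the axiom and is set
    to \<open>succ_fn\<close> by the assignment.\<close>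
  let ?\<phi> = "all N1 (\<lambda>X. well_order X \<^bold>\<longrightarrow> ex N1 (\<lambda>Y. recursion_along jump_fm 0 0 X Y)) 3"
  have "\<forall>(i, \<tau>)\<in>fv jump_fm. i < 3"
    unfolding jump_fm_def Mem_def l2_pair_def by auto
  then have "?\<phi> \<in> ATR0"
    unfolding ATR0_def ATR_axioms_def using arithmetical_jump by (intro UnI2 CollectI exI conjI refl) auto
  then have "ACA0_omega \<union> {CBT, PST} \<turnstile> ?\<phi>" using der by blast
  then have "arith.valid ?\<phi>"
    using arith.valid_RCA0_omega arith.valid_exists2 arith.valid_CBT arith.valid_PST
    by (elim arith.soundness) (auto simp: ACA0_omega_def)
  define s where "s = (arith.asg0((1, N1) := CFun succ_fn))((3, N1) := CFun order_fn)"
  have s: "arith.proper s" unfolding s_def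
    using arith.proper_asg0 af_order_fn af_succ_fn by (simp add: has_ty_Fun)
  have "arith.holds s (well_order (Var 3 N1) 4)"
    by (rule arith.holds_well_order[OF s]) (simp add: s_def)
  moreover have "arith.holds (arith.asg0((1, N1) := CFun succ_fn)) ?\<phi>"
    using \<open>arith.valid ?\<phi>\<close> arith.proper_asg0 af_succ_fn unfolding arith.valid_def by (simp add: has_ty_Fun)
  then have "arith.holds s (well_order (Var 3 N1) 4) \<longrightarrow>
      (\<exists>y. has_ty {f. af f} y N1 \<and> arith.holds (s((4, N1) := y)) (recursion_along jump_fm 0 0 (Var 3 N1) (Var 4 N1) 5))"
    using af_order_fn unfolding all_def pimp_def ex_def s_def
    by (simp add: has_ty_Fun eval_nat_numeral)
  ultimately obtain y where y: "has_ty {f. af f} y N1"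
    "arith.holds (s((4, N1) := y)) (recursion_along jump_fm 0 0 (Var 3 N1) (Var 4 N1) 5)" by blast
  have af_y: "af (arith.fnv y)" using arith.fnv_in_A y(1) by simp
  \<comment> \<open>The part of the solution below \<open>j\<close> is arithmetical in the solution,
    which is itself arithmetical as an object of the model.\<close>
  have "\<exists>z\<in>{f. af f}. \<forall>p. z p = 0 \<longleftrightarrow> (\<exists>m i. p = lp m i \<and> i < j \<and> arith.fnv y p = 0)" for j
  proof -
    have "ar (\<lambda>p. \<exists>m i. p = lp m i \<and> i < j \<and> arith.fnv y p = 0)"
      by (intro ar_ex ar_intros af_intros af_comp[OF af_y])
    from af_char[OF this] show ?thesis by (intro bexI) auto
  qed
  then have "arith.fnv y (lp n j) = 0 \<longleftrightarrow>
      (\<exists>p. succ_fn (lp n p) = 0 \<and> \<not> (\<exists>m i. p = lp m i \<and> i < j \<and> arith.fnv y p = 0))" for n j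
    using arith.holds_recursion[of "s((4, N1) := y)" n j] s y by (simp add: s_def)
  then have "tr n \<longleftrightarrow> arith.fnv y (lp n (rk n)) = 0" for n using recursion_tr[of "arith.fnv y" n] by blast
  moreover have "ar (\<lambda>n. arith.fnv y (lp n (rk n)) = 0)" unfolding rk_def
    by (intro ar_intros af_intros af_comp[OF af_y])
  ultimately have "ar (\<lambda>n. tr n)" by (simp only:)
  then show False using not_ar_tr by blast
qed

theorem theorem3p15:
  shows "\<not> (Z2_omega \<union> QF_AC_01 \<union> {CBT, PST} \<turnstile> NIN) \<and>
    \<not> (\<forall>\<phi>\<in>ATR0. ACA0_omega \<union> {CBT, PST} \<turnstile> \<phi>)"
  using Z2_omega_not_NIN ACA0_omega_not_ATR0 by blast

end
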